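(* Let $N\ge1$, $n\ge3$, and let $u,v$ be modular units for $\Gamma(N)$ such that $1-u$ is also a modular unit. Write the restriction of $r_n(2)(\{u\}_{n-1}\otimes v)$ to the imaginary axis $\{\tau=iy: y>0\}$ (the modular symbol $\{0,\infty\}$) as $\phi(y)\,dy$. Then $\phi\in\mathcal{P}$.
   Context: $\mathcal{P}$ is the class of functions $\phi:(0,+\infty)\to\mathbb{C}$ such that $\phi(y)=\sum_{j=0}^{j_\infty}y^j\sum_{n\ge0}a_n^{(j)}e^{-2\pi ny/N}$ and $\phi(1/y)=\sum_{j=0}^{j_0}y^j\sum_{n\ge0}b_n^{(j)}e^{-2\pi ny/N}$ for some integers $j_\infty,j_0\ge0$ and sequences of polynomial growth in $n$. Modular units for $\Gamma(N)$: non-zero meromorphic functions on $\overline{\Gamma(N)\backslash\mathfrak{h}}$ with zeros and poles only at cusps. $B_k$ are Bernoulli numbers ($B_1=-\frac12$, $B_2=\frac16$). For $m\ge2$, $P_m(z)=R_m\bigl(\sum_{k=0}^{m-1}\frac{2^kB_k}{k!}\log^k|z|\,\mathrm{Li}_{m-k}(z)\bigr)$ with $R_m=\mathrm{Re}$ ($m$ odd), $\mathrm{Im}$ ($m$ even), $\mathrm{Li}_1(z)=-\log(1-z)$, extended by $0$ at $0,\infty$; $\widehat{\mathcal{L}}_m=P_m$ ($m$ odd), $iP_m$ ($m$ even). With $\alpha(f,g)=-\log|f|\,d\log|g|+\log|g|\,d\log|f|$, $d\arg g=\mathrm{Im}(dg/g)$, $d\log|f|=\mathrm{Re}(df/f)$: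 $r_n(2)(\{f\}_{n-1}\otimes g)=i\widehat{\mathcal{L}}_{n-1}(f)\,d\arg g-\frac{2^{n-1}B_{n-1}}{(n-1)!}\alpha(1-f,f)\log^{n-3}|f|\log|g|-\sum_{k=2}^{n-2}\frac{2^kB_k}{k!}\widehat{\mathcal{L}}_{n-k}(f)\log^{k-2}|f|\,d\log|f|\cdot\log|g|$. *)

theory Defs
  imports "HOL-Complex_Analysis.Complex_Analysis" "HOL-Library.Landau_Symbols"
    "HOL-Number_Theory.Cong"
begin

subsection \<open>The class P of functions on the positive half-line\<close>

definition poly_growth :: "(nat \<Rightarrow> complex) \<Rightarrow> bool" where
  "poly_growth a \<longleftrightarrow> (\<exists>k. a \<in> O(\<lambda>n. of_nat n ^ k))"

text \<open>Only the values of \<open>\<phi>\<close> on the positive reals matter. The series below converge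
  absolutely, by polynomial growth of the coefficients.\<close>

definition has_exp_expansion :: "nat \<Rightarrow> (real \<Rightarrow> complex) \<Rightarrow> bool" where
  "has_exp_expansion N \<phi> \<longleftrightarrow>
     (\<exists>(J::nat) (a :: nat \<Rightarrow> nat \<Rightarrow> complex). (\<forall>j\<le>J. poly_growth (a j)) \<and>
        (\<forall>y>0. \<phi> y = (\<Sum>j\<le>J. of_real (y ^ j) *
                        (\<Sum>n. a j n * of_real (exp (- 2 * pi * real n * y / real N))))))"

definition class_P :: "nat \<Rightarrow> (real \<Rightarrow> complex) set" where
  "class_P N = {\<phi>. has_exp_expansion N \<phi> \<and> has_exp_expansion N (\<lambda>y. \<phi> (1 / y))}"


subsection \<open>Modular units\<close>

definition upper_half :: "complex set" where
  "upper_half = {\<tau>. Im \<tau> > 0}"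

definition SL2Z :: "(int ^ 2 ^ 2) set" where
  "SL2Z = {A. det A = 1}"

definition Gamma_N :: "nat \<Rightarrow> (int ^ 2 ^ 2) set" where
  "Gamma_N N = {A \<in> SL2Z. \<forall>i j. [A $ i $ j = mat 1 $ i $ j] (mod int N)}"

definition mobius :: "int ^ 2 ^ 2 \<Rightarrow> complex \<Rightarrow> complex" where
  "mobius A \<tau> = (of_int (A $ 1 $ 1) * \<tau> + of_int (A $ 1 $ 2)) /
                (of_int (A $ 2 $ 1) * \<tau> + of_int (A $ 2 $ 2))"

text \<open>Every cusp has the form \<open>A\<infinity>\<close> with \<open>A \<in> SL2Z\<close>, and a local parameter there on the compactified
  curve is \<open>exp (2\<pi>i A\<^sup>-\<^sup>1\<tau> / N)\<close>, because \<open>Gamma_N N\<close> is normal in \<open>SL2Z\<close>.\<close>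

definition meromorphic_at_cusps :: "nat \<Rightarrow> (complex \<Rightarrow> complex) \<Rightarrow> bool" where
  "meromorphic_at_cusps N f \<longleftrightarrow>
     (\<forall>A\<in>SL2Z. \<exists>h Y. h meromorphic_on {0} \<and>
        (\<forall>\<tau>. Im \<tau> > Y \<and> \<tau> \<in> upper_half \<longrightarrow>
             f (mobius A \<tau>) = h (exp (2 * of_real pi * \<i> * \<tau> / of_nat N))))"

text \<open>Meromorphic functions on the compactification of \<open>\<Gamma>(N)\<close> acting on the upper half-plane, viewed as
  functions on the upper half-plane (the values elsewhere are irrelevant).\<close>

definition modular_function :: "nat \<Rightarrow> (complex \<Rightarrow> complex) \<Rightarrow> bool" where
  "modular_function N f \<longleftrightarrow>
     f nicely_meromorphic_on upper_half \<and>
     (\<forall>A\<in>Gamma_N N. \<forall>\<tau>\<in>upper_half. f (mobius A \<tau>) = f \<tau>) \<and>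
     meromorphic_at_cusps N f"

definition modular_unit :: "nat \<Rightarrow> (complex \<Rightarrow> complex) \<Rightarrow> bool" where
  "modular_unit N f \<longleftrightarrow>
     modular_function N f \<and> (\<forall>\<tau>\<in>upper_half. f \<tau> \<noteq> 0 \<and> \<not> is_pole f \<tau>)"


subsection \<open>Bernoulli numbers and single-valued polylogarithms\<close>

definition bernoulli :: "nat \<Rightarrow> real" where
  "bernoulli k = fact k * fps_nth (fps_X / (fps_exp 1 - 1)) k"

lemma bernoulli_recurrence:
  "(\<Sum>k\<le>n. real (Suc n choose k) * bernoulli k) = (if n = 0 then 1 else 0)"
proof -
  define B :: "real fps" where "B = fps_X / (fps_exp 1 - 1)"
  define E :: "real fps" where "E = fps_exp 1 - 1"
  have nz: "E \<noteq> 0" 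
  proof
    assume "E = 0"
    then have "fps_nth E 1 = 0" by simp
    then show False by (simp add: E_def)
  qed
  have "fps_nth E 0 = 0" by (simp add: E_def)
  moreover have "fps_nth E 1 \<noteq> 0" by (simp add: E_def)
  ultimately have "subdegree E = 1" by (intro subdegreeI) auto
  with nz have "E dvd fps_X" by (simp add: fps_dvd_iff)
  then have BE: "B * E = fps_X" unfolding B_def E_def by (metis dvd_div_mult_self)
  have "fps_nth (B * E) (Suc n) = (\<Sum>k\<le>n. fps_nth B k * (1 / fact (Suc n - k)))"
    by (simp add: fps_mult_nth E_def atMost_atLeast0)
  also have "\<dots> = (\<Sum>k\<le>n. real (Suc n choose k) * bernoulli k / fact (Suc n))"
  proof (rule sum.cong)
    fix k assume "k \<in> {..n}"
    then show "fps_nth B k * (1 / fact (Suc n - k)) = real (Suc n choose k) * bernoulli k / fact (Suc n)"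
      by (simp add: bernoulli_def B_def binomial_fact field_simps del: fact_Suc)
  qed simp
  finally have "(\<Sum>k\<le>n. real (Suc n choose k) * bernoulli k) / fact (Suc n) = (if n = 0 then 1 else 0)"
    by (simp add: BE sum_divide_distrib fps_X_def del: fact_Suc)
  then show ?thesis by (cases "n = 0") (simp_all del: fact_Suc)
qed

lemma
  shows bernoulli_0: "bernoulli 0 = 1"
    and bernoulli_1: "bernoulli 1 = -1/2"
    and bernoulli_2: "bernoulli 2 = 1/6"
proof -
  show 0: "bernoulli 0 = 1" using bernoulli_recurrence[of 0] by simp
  show 1: "bernoulli 1 = -1/2" using bernoulli_recurrence[of 1] 0 by (simp add: atMost_Suc)
  show 2: "bernoulli 2 = 1/6" using bernoulli_recurrence[of 2] 0 1 
    by (simp add: numeral_2_eq_2 atMost_Suc)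
qed

text \<open>The principal branch of the polylogarithm: \<open>Li\<^sub>1(z) = -log(1 - z)\<close> and
  \<open>d Li\<^sub>m\<^sub>+\<^sub>1(z) = Li\<^sub>m(z) dz/z\<close>, integrated along the segment from \<open>0\<close> to \<open>z\<close>. On the cut
  \<open>z > 1\<close> this is the boundary value from below for every \<open>m\<close>, as
  \<open>Ln\<close> has imaginary part \<open>\<pi>\<close> on the negative reals. Using the same branch
  for all \<open>m\<close> at once is what makes the combination \<open>P_fun\<close> below continuous across the cut.\<close>

fun polylog :: "nat \<Rightarrow> complex \<Rightarrow> complex" where
  "polylog 0 z = z / (1 - z)"
| "polylog (Suc 0) z = - Ln (1 - z)"
| "polylog (Suc (Suc m)) z = integral {0..1} (\<lambda>t. polylog (Suc m) (of_real t * z) / of_real t)"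

lemma polylog_power_series:
  assumes "norm z < 1"
  shows "(\<lambda>k. z ^ Suc k / of_nat (Suc k) ^ Suc m) sums polylog (Suc m) z"
  using assms
proof (induction m arbitrary: z)
  case 0
  have "(\<lambda>n. ((-1)^Suc n / of_nat n) * (-z) ^ n) sums ln (1 + (-z))"
    using Ln_series[of "-z"] 0 by simp
  then have "(\<lambda>n. - (((-1)^Suc n / of_nat n) * (-z) ^ n)) sums - ln (1 + (-z))"
    by (rule sums_minus)
  then have "(\<lambda>n. z ^ n / of_nat n) sums - ln (1 - z)"
    by (simp add: power_minus' [symmetric] flip: power_mult_distrib)
  then have "(\<lambda>n. z ^ Suc n / of_nat (Suc n)) sums - ln (1 - z)"
    by (subst sums_Suc_iff) simp
  then show ?case by simp
next
  case (Suc m)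
  define f where "f = (\<lambda>n t. \<Sum>k<n. of_real t ^ k * (z ^ Suc k / of_nat (Suc k) ^ Suc m))"
  define g where "g = (\<lambda>t. \<Sum>k. of_real t ^ k * (z ^ Suc k / of_nat (Suc k) ^ Suc m))"
  have ul: "uniform_limit {0..1} f g sequentially"
    unfolding f_def g_def
  proof (rule Weierstrass_m_test)
    show "summable (\<lambda>k. norm z ^ Suc k)" using Suc.prems by simp
  next
    fix k and t :: real assume t: "t \<in> {0..1}"
    have "norm (of_real t ^ k * (z ^ Suc k / of_nat (Suc k) ^ Suc m))
          = t ^ k * (norm z ^ Suc k / real (Suc k) ^ Suc m)"
      using t by (simp add: norm_mult norm_divide norm_power del: of_nat_Suc)
    also have "\<dots> \<le> 1 * (norm z ^ Suc k / 1)"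
      using t by (intro mult_mono divide_left_mono power_le_one one_le_power) auto
    finally show "norm (of_real t ^ k * (z ^ Suc k / of_nat (Suc k) ^ Suc m)) \<le> norm z ^ Suc k" by simp
  qed
  have hi: "(f n has_integral (\<Sum>k<n. z ^ Suc k / of_nat (Suc k) ^ Suc (Suc m))) {0..1}" for n
    unfolding f_def
  proof (rule has_integral_sum)
    fix k
    have "((\<lambda>t. t ^ k) has_integral (1 / real (Suc k))) {0..1}"
    proof -
      have "((\<lambda>t. t ^ Suc k / real (Suc k)) has_vector_derivative t ^ k) (at t within {0..1})" for t :: real
        unfolding has_real_derivative_iff_has_vector_derivative[symmetric]
        by (rule derivative_eq_intros refl | simp del: of_nat_Suc power_Suc)+
      from fundamental_theorem_of_calculus[OF _ this] show ?thesis by simp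
    qed
    from has_integral_mult_left[OF has_integral_of_real[OF this], of "z ^ Suc k / of_nat (Suc k) ^ Suc m"]
    show "((\<lambda>t. of_real t ^ k * (z ^ Suc k / of_nat (Suc k) ^ Suc m)) has_integral
      z ^ Suc k / of_nat (Suc k) ^ Suc (Suc m)) {0..1}" by (simp add: o_def mult_ac)
  qed simp
  have co: "continuous_on {0..1} (f n)" for n
    unfolding f_def by (intro continuous_intros)
  obtain I J where I: "\<And>n. (f n has_integral I n) {0..1}" and J: "(g has_integral J) {0..1}"
    and IJ: "(I \<longlongrightarrow> J) sequentially"
    using uniform_limit_integral[OF ul co] by auto
  have "I = (\<lambda>n. \<Sum>k<n. z ^ Suc k / of_nat (Suc k) ^ Suc (Suc m))"
    using I hi by (blast intro: has_integral_unique)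
  with IJ have sJ: "(\<lambda>k. z ^ Suc k / of_nat (Suc k) ^ Suc (Suc m)) sums J" by (simp add: sums_def)
  have "polylog (Suc m) (of_real t * z) / of_real t = g t" if "t \<in> {0..1} - {0}" for t
  proof -
    have t: "0 < t" "t \<le> 1" using that by auto
    have "norm (of_real t * z) < 1"
      using t Suc.prems mult_le_one[of t "norm z"] by (simp add: norm_mult) (smt (verit) mult_left_le_one_le norm_ge_zero)
    from sums_divide[OF Suc.IH[OF this], of "of_real t"]
    have "(\<lambda>k. (of_real t * z) ^ Suc k / of_nat (Suc k) ^ Suc m / of_real t) sums
       (polylog (Suc m) (of_real t * z) / of_real t)" .
    moreover have "(of_real t * z) ^ Suc k / of_nat (Suc k) ^ Suc m / of_real t
        = of_real t ^ k * (z ^ Suc k / of_nat (Suc k) ^ Suc m)" for k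
      using t by (simp add: power_mult_distrib del: of_nat_Suc)
    ultimately have "(\<lambda>k. of_real t ^ k * (z ^ Suc k / of_nat (Suc k) ^ Suc m)) sums
       (polylog (Suc m) (of_real t * z) / of_real t)"
      by simp
    then show ?thesis unfolding g_def by (simp add: sums_iff)
  qed
  then have "((\<lambda>t. polylog (Suc m) (of_real t * z) / of_real t) has_integral J) {0..1}"
    by (intro has_integral_spike_finite[OF _ _ J, of "{0}"]) auto
  then have "polylog (Suc (Suc m)) z = J" by (simp add: integral_unique)
  with sJ show ?case by simp
qed

text \<open>The points \<open>0\<close> and \<open>\<infinity>\<close> are where the value is prescribed to be \<open>0\<close>; \<open>\<infinity>\<close> is not needed here.
  At \<open>z = 1\<close> the logarithmic term carries the factor \<open>ln 1 = 0\<close>, so for \<open>m \<ge> 2\<close> the value is the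
  one given by continuity.\<close>

definition P_fun :: "nat \<Rightarrow> complex \<Rightarrow> real" where
  "P_fun m z = (if z = 0 then 0 else
     (if odd m then Re else Im)
       (\<Sum>k<m. of_real (2 ^ k * bernoulli k / fact k * ln (norm z) ^ k) * polylog (m - k) z))"

definition L_hat :: "nat \<Rightarrow> complex \<Rightarrow> complex" where
  "L_hat m z = (if odd m then of_real (P_fun m z) else \<i> * of_real (P_fun m z))"


subsection \<open>The regulator 1-form\<close>

text \<open>A 1-form is a function of a point and a tangent vector.\<close>

type_synonym 'a one_form = "complex \<Rightarrow> complex \<Rightarrow> 'a"

definition dlog :: "(complex \<Rightarrow> complex) \<Rightarrow> complex one_form" where
  "dlog f \<tau> w = deriv f \<tau> * w / f \<tau>"

definition dlog_abs :: "(complex \<Rightarrow> complex) \<Rightarrow> real one_form" where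
  "dlog_abs f \<tau> w = Re (dlog f \<tau> w)"

definition d_arg :: "(complex \<Rightarrow> complex) \<Rightarrow> real one_form" where
  "d_arg f \<tau> w = Im (dlog f \<tau> w)"

definition alpha :: "(complex \<Rightarrow> complex) \<Rightarrow> (complex \<Rightarrow> complex) \<Rightarrow> real one_form" where
  "alpha f g \<tau> w =
     - ln (norm (f \<tau>)) * dlog_abs g \<tau> w + ln (norm (g \<tau>)) * dlog_abs f \<tau> w"

text \<open>\<open>r2 n f g\<close> is the form \<open>r\<^sub>n(2)({f}\<^sub>n\<^sub>-\<^sub>1 \<otimes> g)\<close>.\<close>

definition r2 :: "nat \<Rightarrow> (complex \<Rightarrow> complex) \<Rightarrow> (complex \<Rightarrow> complex) \<Rightarrow> complex one_form" where
  "r2 n f g \<tau> w =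
     \<i> * L_hat (n - 1) (f \<tau>) * of_real (d_arg g \<tau> w)
     - of_real (2 ^ (n - 1) * bernoulli (n - 1) / fact (n - 1) * alpha (\<lambda>z. 1 - f z) f \<tau> w
                 * ln (norm (f \<tau>)) ^ (n - 3) * ln (norm (g \<tau>)))
     - (\<Sum>k=2..n-2. of_real (2 ^ k * bernoulli k / fact k) * L_hat (n - k) (f \<tau>)
          * of_real (ln (norm (f \<tau>)) ^ (k - 2) * dlog_abs f \<tau> w * ln (norm (g \<tau>))))"

text \<open>The coefficient \<open>\<phi>\<close> in \<open>c\<^sup>*\<omega> = \<phi>(y) dy\<close> for a curve \<open>c\<close>.\<close>

definition restrict_form :: "complex one_form \<Rightarrow> (real \<Rightarrow> complex) \<Rightarrow> real \<Rightarrow> complex" where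
  "restrict_form \<omega> c y = \<omega> (c y) (vector_derivative c (at y))"

end

theory Submission
  imports Defs "HOL-Analysis.Kronecker_Approximation_Theorem"
begin

text \<open>The functions on the half-line having an exponential expansion form a ring which is closed under complex
  conjugation and under taking primitives. Hence it suffices to know the expansions, at both ends of the imaginary
  axis, of the logarithmic derivatives of \<open>u\<close>, \<open>1 - u\<close> and \<open>v\<close>; polynomial growth of their coefficients is Hecke's
  bound for modular forms of weight 2. Then \<open>log|u|\<close>, \<open>log|1 - u|\<close> and \<open>log|v|\<close> are obtained by integration, and so
  is \<open>P\<^sub>m(u)\<close> by induction on \<open>m\<close>, because the differential of \<open>P\<^sub>m(z)\<close> is a polynomial in \<open>log|z|\<close> and
  \<open>P\<^sub>1, \<dots>, P\<^sub>m\<^sub>-\<^sub>1\<close> with coefficients \<open>d log|z|\<close>, \<open>d arg z\<close> and the real or imaginary part of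
  \<open>dz / (1 - z)\<close>. Since \<open>u\<close> may be real and greater than 1 on the whole imaginary axis, this formula is also
  needed on the cut of the polylogarithms: there the jumps of the \<open>Li\<^sub>k\<close> cancel in \<open>P\<^sub>m\<close>, as \<open>t / sinh t\<close> is even.\<close>

subsection \<open>Exponential expansions\<close>

text \<open>The expansion of \<open>u\<close> in q cannot be substituted into the polylogarithms: at
  a cusp \<open>u\<close> may tend to 0, 1 or infinity, and between the cusps it may cross the cut.
  Integration avoids such asymptotics, since every constant has an expansion and the constants of
  integration may stay unknown. It does need a differential that refers to P_1, ..., P_(m-1) only.
  This rests on two properties of the coefficients 2^k B_k / k!: a Riccati equation of their
  generating function regroups the multiples of d log|z| into combinations of lower weight, and the
  vanishing of the odd coefficients beyond the first ensures that the correct real or imaginary part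
  is taken of each of them. Points of the cut are handled by a second family of polylogarithms,
  whose cut runs upwards from 1; it defines the same P_m although the individual functions differ.
  The powers of y arise because the constant term of a series has a primitive linear in y.\<close>

lemma poly_growth_iff:
  "poly_growth a \<longleftrightarrow> (\<exists>C k. C \<ge> 0 \<and> (\<forall>n. norm (a n) \<le> C * (real n + 1) ^ k))"
proof
  assume "poly_growth a"
  then obtain k where "a \<in> O(\<lambda>n. of_nat n ^ k)" by (auto simp: poly_growth_def)
  then obtain c where c: "c > 0" "eventually (\<lambda>n. norm (a n) \<le> c * norm (of_nat n ^ k :: complex)) sequentially"
    by (rule landau_o.bigE)
  then obtain n0 where n0: "\<And>n. n \<ge> n0 \<Longrightarrow> norm (a n) \<le> c * real n ^ k"
    by (auto simp: eventually_sequentially norm_power)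
  \<comment> \<open>The sum absorbs the finitely many terms on which the Landau condition is silent.
    The base n + 1 keeps the bound usable at n = 0, where a positive power of n would force the term
    to vanish.\<close>
  define C where "C = c + (\<Sum>i<n0. norm (a i))"
  have C: "C \<ge> c" "C \<ge> 0" using c by (auto simp: C_def sum_nonneg intro!: add_nonneg_nonneg)
  have "norm (a n) \<le> C * (real n + 1) ^ k" for n
  proof (cases "n < n0")
    case True
    have "norm (a n) \<le> (\<Sum>i<n0. norm (a i))" using True by (intro member_le_sum) auto
    also have "\<dots> \<le> C * 1" using c by (simp add: C_def)
    also have "\<dots> \<le> C * (real n + 1) ^ k" using C by (intro mult_left_mono one_le_power) auto
    finally show ?thesis .
  next
    case False
    then have "norm (a n) \<le> c * real n ^ k" using n0 by simp
    also have "\<dots> \<le> C * (real n + 1) ^ k" using C c by (intro mult_mono power_mono) auto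
    finally show ?thesis .
  qed
  with C show "\<exists>C k. C \<ge> 0 \<and> (\<forall>n. norm (a n) \<le> C * (real n + 1) ^ k)" by blast
next
  assume "\<exists>C k. C \<ge> 0 \<and> (\<forall>n. norm (a n) \<le> C * (real n + 1) ^ k)"
  then obtain C k where C: "C \<ge> 0" "\<And>n. norm (a n) \<le> C * (real n + 1) ^ k" by blast
  have "a \<in> O(\<lambda>n. of_nat n ^ k)"
  proof (rule landau_o.bigI)
    show "C * 2 ^ k + 1 > 0" using C by (simp add: add_nonneg_pos)
    show "eventually (\<lambda>n. norm (a n) \<le> (C * 2 ^ k + 1) * norm (of_nat n ^ k :: complex)) sequentially"
      using eventually_ge_at_top[of 1]
    proof eventually_elim
      case (elim n)
      have "norm (a n) \<le> C * (real n + 1) ^ k" by (rule C)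
      also have "\<dots> \<le> C * (2 * real n) ^ k" using C elim by (intro mult_left_mono power_mono) auto
      also have "\<dots> \<le> (C * 2 ^ k + 1) * real n ^ k" by (simp add: power_mult_distrib algebra_simps)
      finally show ?case by (simp add: norm_power)
    qed
  qed
  then show "poly_growth a" by (auto simp: poly_growth_def)
qed

lemma poly_growth_mono:
  assumes "poly_growth a" "\<And>n. norm (b n) \<le> norm (a n)"
  shows "poly_growth b"
  using assms unfolding poly_growth_iff by (meson order_trans)

lemma poly_growth_0 [simp]: "poly_growth (\<lambda>n. 0)"
  unfolding poly_growth_iff by (auto intro!: exI[of _ 0])

lemma poly_growth_add:
  assumes "poly_growth a" "poly_growth b"
  shows "poly_growth (\<lambda>n. a n + b n)"
proof -
  obtain C k where C: "C \<ge> 0" "\<And>n. norm (a n) \<le> C * (real n + 1) ^ k" 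
    using assms(1) unfolding poly_growth_iff by blast
  obtain D l where D: "D \<ge> 0" "\<And>n. norm (b n) \<le> D * (real n + 1) ^ l" 
    using assms(2) unfolding poly_growth_iff by blast
  have "norm (a n + b n) \<le> (C + D) * (real n + 1) ^ (k + l)" for n
  proof -
    have "norm (a n + b n) \<le> norm (a n) + norm (b n)" by (rule norm_triangle_ineq)
    also have "\<dots> \<le> C * (real n + 1) ^ k + D * (real n + 1) ^ l" by (intro add_mono C D)
    also have "\<dots> \<le> C * (real n + 1) ^ (k + l) + D * (real n + 1) ^ (k + l)"
      using C D by (intro add_mono mult_left_mono power_increasing) auto
    finally show ?thesis by (simp add: algebra_simps)
  qed
  with C D show ?thesis unfolding poly_growth_iff by (meson add_nonneg_nonneg)
qed

text \<open>Each summand is bounded by the product of the two bounds at n, and the number n + 1 of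
  summands raises the exponent by one.\<close>

lemma poly_growth_convolution:
  assumes "poly_growth a" "poly_growth b"
  shows "poly_growth (\<lambda>n. \<Sum>i\<le>n. a i * b (n - i))"
proof -
  obtain C k where C: "C \<ge> 0" "\<And>n. norm (a n) \<le> C * (real n + 1) ^ k" 
    using assms(1) unfolding poly_growth_iff by blast
  obtain D l where D: "D \<ge> 0" "\<And>n. norm (b n) \<le> D * (real n + 1) ^ l" 
    using assms(2) unfolding poly_growth_iff by blast
  have "norm (\<Sum>i\<le>n. a i * b (n - i)) \<le> (C * D) * (real n + 1) ^ (k + l + 1)" for n
  proof -
    have "norm (\<Sum>i\<le>n. a i * b (n - i)) \<le> (\<Sum>i\<le>n. (C * (real n + 1) ^ k) * (D * (real n + 1) ^ l))"
    proof (rule sum_norm_le)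
      fix i assume i: "i \<in> {..n}"
      have "norm (a i) \<le> C * (real n + 1) ^ k"
        using C(2)[of i] by (rule order_trans) (use i C(1) in \<open>auto intro!: mult_left_mono power_mono\<close>)
      moreover have "norm (b (n - i)) \<le> D * (real n + 1) ^ l"
        using D(2)[of "n - i"] by (rule order_trans) (use i D(1) in \<open>auto intro!: mult_left_mono power_mono\<close>)
      ultimately show "norm (a i * b (n - i)) \<le> (C * (real n + 1) ^ k) * (D * (real n + 1) ^ l)"
        unfolding norm_mult using C D by (intro mult_mono) auto
    qed
    also have "\<dots> = (C * D) * (real n + 1) ^ (k + l + 1)" by (simp add: power_add)
    finally show ?thesis .
  qed
  with C D show ?thesis unfolding poly_growth_iff by (meson mult_nonneg_nonneg)
qed

text \<open>Differentiating a power series gains a factor n: \<open>diffs\<close> turns the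
  coefficients n^k into (n + 1)^(k + 1) without shrinking the disc of convergence.\<close>

lemma summable_power_times_geometric:
  fixes x :: real
  assumes "norm x < 1"
  shows "summable (\<lambda>n. real n ^ k * x ^ n)"
  using assms
proof (induction k arbitrary: x)
  case 0
  then show ?case by simp
next
  case (Suc k)
  have "summable (\<lambda>n. diffs (\<lambda>n. real n ^ k) n * x ^ n)"
    by (rule termdiff_converges[of _ 1]) (use Suc in auto)
  then have "summable (\<lambda>n. x * (real (Suc n) ^ Suc k * x ^ n))"
    by (intro summable_mult) (simp add: diffs_def)
  then have "summable (\<lambda>n. real (Suc n) ^ Suc k * x ^ Suc n)" by (simp add: mult_ac)
  then show ?case by (subst (asm) summable_Suc_iff)
qed

lemma poly_growth_summable:
  fixes x :: real
  assumes "poly_growth a" "0 \<le> x" "x < 1"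
  shows "summable (\<lambda>n. norm (a n * of_real x ^ n))"
proof -
  obtain k where "a \<in> O(\<lambda>n. of_nat n ^ k)" using assms(1) by (auto simp: poly_growth_def)
  then have "(\<lambda>n. norm (a n * of_real x ^ n)) \<in> O(\<lambda>n. norm (of_nat n ^ k * of_real x ^ n :: complex))"
    by (simp add: landau_o.big.mult)
  also have "(\<lambda>n. norm (of_nat n ^ k * of_real x ^ n :: complex)) = (\<lambda>n. real n ^ k * x ^ n)"
    using assms by (simp add: norm_mult norm_power)
  finally show ?thesis
    by (rule summable_comparison_test_bigo[rotated])
       (use summable_power_times_geometric[of x k] assms in \<open>auto simp: abs_mult\<close>)
qed

section \<open>Power series in exp (-2 pi y / N), the local parameter at the cusp infinity on the
  imaginary axis\<close>

definition qser :: "nat \<Rightarrow> (nat \<Rightarrow> complex) \<Rightarrow> real \<Rightarrow> complex" where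
  "qser N a y = (\<Sum>n. a n * of_real (exp (- 2 * pi * real n * y / real N)))"

lemma qser_term: "of_real (exp (- 2 * pi * real n * y / real N)) = (of_real (exp (- 2 * pi * y / real N)) :: complex) ^ n"
  by (simp flip: of_real_power exp_of_nat_mult add: field_simps)

lemma has_exp_expansion_qser:
  "has_exp_expansion N \<phi> \<longleftrightarrow> (\<exists>J a. (\<forall>j\<le>J. poly_growth (a j)) \<and>
     (\<forall>y>0. \<phi> y = (\<Sum>j\<le>J. of_real (y ^ j) * qser N (a j) y)))"
  by (simp add: has_exp_expansion_def qser_def)

lemma has_exp_expansion_cong:
  assumes "has_exp_expansion N f" "\<And>y. y > 0 \<Longrightarrow> f y = g y"
  shows "has_exp_expansion N g"
  using assms unfolding has_exp_expansion_def by simp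

context
  fixes N :: nat
  assumes N: "N > 0"
begin

lemma qser_base: "y > 0 \<Longrightarrow> 0 < exp (- 2 * pi * y / real N) \<and> exp (- 2 * pi * y / real N) < 1"
  using N by (simp add: field_simps)

lemma qser_summable:
  assumes "poly_growth a" "y > 0"
  shows "summable (\<lambda>n. norm (a n * of_real (exp (- 2 * pi * real n * y / real N))))"
  unfolding qser_term using poly_growth_summable[OF assms(1), of "exp (- 2 * pi * y / real N)"] qser_base[OF assms(2)]
  by simp

lemma qser_add:
  assumes "poly_growth a" "poly_growth b" "y > 0"
  shows "qser N (\<lambda>n. a n + b n) y = qser N a y + qser N b y"
  unfolding qser_def ring_distribs
  by (intro suminf_add[symmetric] summable_norm_cancel[OF qser_summable] assms)

lemma qser_mult:
  assumes "poly_growth a" "poly_growth b" "y > 0"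
  shows "qser N (\<lambda>n. \<Sum>i\<le>n. a i * b (n - i)) y = qser N a y * qser N b y"
proof -
  have "qser N a y * qser N b y = (\<Sum>n. \<Sum>i\<le>n. (a i * of_real (exp (- 2 * pi * real i * y / real N))) *
          (b (n - i) * of_real (exp (- 2 * pi * real (n - i) * y / real N))))"
    unfolding qser_def by (rule Cauchy_product) (intro qser_summable assms)+
  also have "\<dots> = qser N (\<lambda>n. \<Sum>i\<le>n. a i * b (n - i)) y"
    unfolding qser_def
  proof (intro arg_cong[of _ _ suminf] ext)
    fix n
    show "(\<Sum>i\<le>n. (a i * of_real (exp (- 2 * pi * real i * y / real N))) *
          (b (n - i) * of_real (exp (- 2 * pi * real (n - i) * y / real N))))
        = (\<Sum>i\<le>n. a i * b (n - i)) * of_real (exp (- 2 * pi * real n * y / real N))"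
      unfolding sum_distrib_right qser_term
    proof (rule sum.cong)
      fix i assume "i \<in> {..n}"
      then have "(z::complex) ^ n = z ^ i * z ^ (n - i)" for z by (simp flip: power_add)
      then show "a i * of_real (exp (- 2 * pi * y / real N)) ^ i * (b (n - i) * of_real (exp (- 2 * pi * y / real N)) ^ (n - i)) 
         = a i * b (n - i) * of_real (exp (- 2 * pi * y / real N)) ^ n"
        by (simp add: mult_ac)
    qed simp
  qed
  finally show ?thesis by simp
qed

lemma has_exp_expansion_add:
  assumes "has_exp_expansion N f" "has_exp_expansion N g"
  shows "has_exp_expansion N (\<lambda>y. f y + g y)"
proof -
  obtain J a where a: "\<And>j. j \<le> J \<Longrightarrow> poly_growth (a j)" 
     "\<And>y. y > 0 \<Longrightarrow> f y = (\<Sum>j\<le>J. of_real (y ^ j) * qser N (a j) y)"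
    using assms(1) unfolding has_exp_expansion_qser by blast
  obtain K b where b: "\<And>j. j \<le> K \<Longrightarrow> poly_growth (b j)" 
     "\<And>y. y > 0 \<Longrightarrow> g y = (\<Sum>j\<le>K. of_real (y ^ j) * qser N (b j) y)"
    using assms(2) unfolding has_exp_expansion_qser by blast
  \<comment> \<open>Beyond index J the sequences are arbitrary, so they are replaced by zero before
    both sums are padded to the common length J + K.\<close>
  define a' where "a' = (\<lambda>j. if j \<le> J then a j else (\<lambda>n. 0))"
  define b' where "b' = (\<lambda>j. if j \<le> K then b j else (\<lambda>n. 0))"
  have g: "poly_growth (a' j)" "poly_growth (b' j)" for j using a b by (auto simp: a'_def b'_def)
  have z: "qser N (\<lambda>n. 0) y = 0" for y by (simp add: qser_def)
  have fa: "f y = (\<Sum>j\<le>J+K. of_real (y ^ j) * qser N (a' j) y)" if "y > 0" for y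
    unfolding a(2)[OF that] by (rule sum.mono_neutral_cong_left) (auto simp: a'_def z)
  have gb: "g y = (\<Sum>j\<le>J+K. of_real (y ^ j) * qser N (b' j) y)" if "y > 0" for y
    unfolding b(2)[OF that] by (rule sum.mono_neutral_cong_left) (auto simp: b'_def z)
  have "f y + g y = (\<Sum>j\<le>J+K. of_real (y ^ j) * qser N (\<lambda>n. a' j n + b' j n) y)" if "y > 0" for y
    by (simp add: fa gb that qser_add g ring_distribs sum.distrib)
  then show ?thesis unfolding has_exp_expansion_qser
    by (intro exI[of _ "J + K"] exI[of _ "\<lambda>j n. a' j n + b' j n"]) (auto intro: poly_growth_add g)
qed

lemma has_exp_expansion_monomial:
  assumes "poly_growth a"
  shows "has_exp_expansion N (\<lambda>y. of_real (y ^ j) * qser N a y)"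
  unfolding has_exp_expansion_qser
proof (intro exI conjI allI impI)
  let ?a = "\<lambda>i. if i = j then a else (\<lambda>n. 0)"
  show "poly_growth (?a i)" for i using assms by simp
  show "of_real (y ^ j) * qser N a y = (\<Sum>i\<le>j. of_real (y ^ i) * qser N (?a i) y)" for y
  proof -
    have "(\<Sum>i\<le>j. of_real (y ^ i) * qser N (?a i) y) = (\<Sum>i\<in>{j}. of_real (y ^ i) * qser N (?a i) y)"
      by (rule sum.mono_neutral_right) (auto simp: qser_def)
    then show ?thesis by simp
  qed
qed

lemma has_exp_expansion_0: "has_exp_expansion N (\<lambda>y. 0)"
  using has_exp_expansion_monomial[of "\<lambda>n. 0" 0] by (simp add: qser_def)

lemma has_exp_expansion_const: "has_exp_expansion N (\<lambda>y. c)"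
proof -
  have "poly_growth (\<lambda>n. if n = 0 then c else 0)"
    unfolding poly_growth_iff by (rule exI[of _ "norm c"], rule exI[of _ 0]) auto
  moreover have "qser N (\<lambda>n. if n = 0 then c else 0) y = c" for y
  proof -
    have "qser N (\<lambda>n. if n = 0 then c else 0) y = (\<Sum>n. if n = 0 then c else 0)"
      unfolding qser_def by (rule suminf_cong) auto
    also have "\<dots> = c" using suminf_finite[of "{0}" "\<lambda>n. if n = 0 then c else (0::complex)"] by simp
    finally show ?thesis .
  qed
  ultimately show ?thesis
    using has_exp_expansion_cong[OF has_exp_expansion_monomial[of "\<lambda>n. if n = 0 then c else 0" 0]] by simp
qed

lemma has_exp_expansion_sum:
  assumes "\<And>i. i \<in> I \<Longrightarrow> has_exp_expansion N (f i)"
  shows "has_exp_expansion N (\<lambda>y. \<Sum>i\<in>I. f i y)"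
  using assms
proof (induction I rule: infinite_finite_induct)
  case (insert i I)
  then have "has_exp_expansion N (\<lambda>y. f i y + (\<Sum>i\<in>I. f i y))"
    by (intro has_exp_expansion_add) simp_all
  with insert show ?case by simp
qed (simp_all add: has_exp_expansion_0)

lemma has_exp_expansion_mult:
  assumes "has_exp_expansion N f" "has_exp_expansion N g"
  shows "has_exp_expansion N (\<lambda>y. f y * g y)"
proof -
  obtain J a where a: "\<And>j. j \<le> J \<Longrightarrow> poly_growth (a j)" 
     "\<And>y. y > 0 \<Longrightarrow> f y = (\<Sum>j\<le>J. of_real (y ^ j) * qser N (a j) y)"
    using assms(1) unfolding has_exp_expansion_qser by blast
  obtain K b where b: "\<And>j. j \<le> K \<Longrightarrow> poly_growth (b j)" 
     "\<And>y. y > 0 \<Longrightarrow> g y = (\<Sum>j\<le>K. of_real (y ^ j) * qser N (b j) y)"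
    using assms(2) unfolding has_exp_expansion_qser by blast
  have "has_exp_expansion N (\<lambda>y. \<Sum>j\<le>J. \<Sum>k\<le>K. of_real (y ^ (j + k)) * qser N (\<lambda>n. \<Sum>i\<le>n. a j i * b k (n - i)) y)"
    by (intro has_exp_expansion_sum has_exp_expansion_monomial poly_growth_convolution a b) auto
  then show ?thesis
  proof (rule has_exp_expansion_cong)
    fix y :: real assume y: "y > 0"
    show "(\<Sum>j\<le>J. \<Sum>k\<le>K. of_real (y ^ (j + k)) * qser N (\<lambda>n. \<Sum>i\<le>n. a j i * b k (n - i)) y) = f y * g y"
      unfolding a(2)[OF y] b(2)[OF y] sum_product
      by (intro sum.cong refl) (simp add: qser_mult a b y power_add mult_ac)
  qed
qed

lemma has_exp_expansion_power: "has_exp_expansion N f \<Longrightarrow> has_exp_expansion N (\<lambda>y. f y ^ k)"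
  using has_exp_expansion_mult[of f "\<lambda>y. f y ^ m" for m]
  by (induction k) (simp_all add: has_exp_expansion_const)

text \<open>On the imaginary axis the exponentials are real, so conjugation acts on the coefficients
  alone. This makes real parts, imaginary parts and log|f| accessible.\<close>

lemma has_exp_expansion_cnj:
  assumes "has_exp_expansion N f"
  shows "has_exp_expansion N (\<lambda>y. cnj (f y))"
proof -
  obtain J a where a: "\<And>j. j \<le> J \<Longrightarrow> poly_growth (a j)" 
     "\<And>y. y > 0 \<Longrightarrow> f y = (\<Sum>j\<le>J. of_real (y ^ j) * qser N (a j) y)"
    using assms(1) unfolding has_exp_expansion_qser by blast
  have "poly_growth (\<lambda>n. cnj (a j n))" if "j \<le> J" for j
    using a(1)[OF that] by (rule poly_growth_mono) auto
  moreover have "cnj (f y) = (\<Sum>j\<le>J. of_real (y ^ j) * qser N (\<lambda>n. cnj (a j n)) y)" if "y > 0" for y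
  proof -
    have "cnj (qser N (a j) y) = qser N (\<lambda>n. cnj (a j n)) y" if "j \<le> J" for j
    proof -
      have "(\<lambda>n. a j n * of_real (exp (- 2 * pi * real n * y / real N))) sums qser N (a j) y"
        unfolding qser_def by (intro summable_sums summable_norm_cancel[OF qser_summable] a that \<open>y > 0\<close>)
      from bounded_linear.sums[OF bounded_linear_cnj this] show ?thesis by (simp add: qser_def sums_iff)
    qed
    then show ?thesis by (simp add: a(2)[OF that])
  qed
  ultimately show ?thesis unfolding has_exp_expansion_qser
    by (intro exI[of _ J] exI[of _ "\<lambda>j n. cnj (a j n)"]) auto
qed

lemma has_exp_expansion_Re:
  assumes "has_exp_expansion N f"
  shows "has_exp_expansion N (\<lambda>y. of_real (Re (f y)))"
  using has_exp_expansion_mult[OF has_exp_expansion_const[of "1/2"]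
      has_exp_expansion_add[OF assms has_exp_expansion_cnj[OF assms]]]
  by (simp add: complex_add_cnj)

lemma has_exp_expansion_Im:
  assumes "has_exp_expansion N f"
  shows "has_exp_expansion N (\<lambda>y. of_real (Im (f y)))"
  using has_exp_expansion_Re[OF has_exp_expansion_mult[OF has_exp_expansion_const[of "-\<i>"] assms]] by simp

section \<open>Primitives of exponential expansions\<close>

lemma poly_growth_qser_primitive:
  assumes "poly_growth a"
  shows "poly_growth (\<lambda>n. - a n * of_real (real N / (2 * pi * real n)))" (is "poly_growth ?b")
proof (rule poly_growth_mono)
  show "poly_growth (\<lambda>n. of_nat N * a n)"
    using assms unfolding poly_growth_def by (auto intro!: exI)
  fix n
  have "norm (?b n) \<le> real N * norm (a n)"
  proof (cases "n = 0")
    case False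
    have "1 \<le> 2 * pi * real n" using False pi_ge_two mult_mono[of 1 "2 * pi" 1 "real n"] by simp
    then have "norm (a n) * (real N / (2 * pi * real n)) \<le> norm (a n) * (real N / 1)"
      by (intro mult_left_mono divide_left_mono) auto
    then show ?thesis by (simp add: norm_mult norm_divide mult.commute)
  qed (simp)
  then show "norm (?b n) \<le> norm (of_nat N * a n)" by (simp add: norm_mult)
qed

text \<open>Integrating exp (-2 pi n y / N) divides by -2 pi n / N. At n = 0 division by zero yields
  0, so the constant term is dropped from the primitive and shows up as \<open>- a 0\<close> in the
  derivative.\<close>

lemma qser_deriv:
  assumes "poly_growth a" "y > 0"
  shows "(qser N (\<lambda>n. - a n * of_real (real N / (2 * pi * real n))) has_vector_derivative qser N a y - a 0) (at y)"
proof -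
  define b where "b = (\<lambda>n. - a n * of_real (real N / (2 * pi * real n)))"
  have b: "poly_growth b" unfolding b_def by (rule poly_growth_qser_primitive) fact
  define x where "x = (\<lambda>y. of_real (exp (- 2 * pi * y / real N)) :: complex)"
  have x1: "norm (x y) < 1" using qser_base[OF assms(2)] by (simp add: x_def)
  obtain r where r: "norm (x y) < r" "r < 1" using x1 dense by blast
  have r0: "r > 0" using r by (smt (verit) norm_ge_zero)
  have sm: "summable (\<lambda>n. b n * of_real r ^ n)"
    using poly_growth_summable[OF b, of r] r r0 by (auto intro: summable_norm_cancel)
  have D: "((\<lambda>x. \<Sum>n. b n * x ^ n) has_field_derivative (\<Sum>n. diffs b n * x y ^ n)) (at (x y))"
    by (rule termdiffs_strong[OF sm]) (use r r0 in auto)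
  have xd: "(x has_vector_derivative - of_real (2 * pi / N) * x y) (at y)"
  proof -
    have "((\<lambda>y. exp (- 2 * pi * y / real N)) has_real_derivative - (2 * pi / N) * exp (- 2 * pi * y / real N)) (at y)"
      using N by (auto intro!: derivative_eq_intros)
    from has_vector_derivative_of_real[OF this] show ?thesis
      unfolding x_def by (rule has_vector_derivative_eq_rhs) simp
  qed
  have "((\<lambda>y. \<Sum>n. b n * x y ^ n) has_vector_derivative (- of_real (2 * pi / N) * x y) * (\<Sum>n. diffs b n * x y ^ n)) (at y)"
    using field_vector_diff_chain_at[OF xd D] by (simp add: o_def)
  also have "(\<lambda>y. \<Sum>n. b n * x y ^ n) = qser N b"
    by (intro ext) (simp only: qser_def qser_term x_def)
  also have "(- of_real (2 * pi / N) * x y) * (\<Sum>n. diffs b n * x y ^ n) = qser N a y - a 0"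
  proof -
    have "summable (\<lambda>n. diffs b n * x y ^ n)"
    proof (rule termdiff_converges[OF x1])
      fix z :: complex assume "norm z < 1"
      then have "summable (\<lambda>n. norm (b n * of_real (norm z) ^ n))"
        by (intro poly_growth_summable b) auto
      then show "summable (\<lambda>n. b n * z ^ n)"
        by (intro summable_norm_cancel[of "\<lambda>n. b n * z ^ n"]) (simp add: norm_mult norm_power)
    qed
    then have "(\<lambda>n. (- of_real (2 * pi / N) * x y) * (diffs b n * x y ^ n)) sums 
        ((- of_real (2 * pi / N) * x y) * (\<Sum>n. diffs b n * x y ^ n))"
      by (intro sums_mult summable_sums)
    also have "(\<lambda>n. (- of_real (2 * pi / N) * x y) * (diffs b n * x y ^ n)) = (\<lambda>n. a (Suc n) * x y ^ Suc n)"
    proof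
      fix n
      have "of_real (2 * pi / N) * (of_nat (Suc n) * complex_of_real (real N / (2 * pi * real (Suc n)))) = 1"
        using N by (simp add: field_simps del: of_nat_Suc)
      then show "(- of_real (2 * pi / N) * x y) * (diffs b n * x y ^ n) = a (Suc n) * x y ^ Suc n"
        unfolding diffs_def b_def by (simp add: mult_ac del: of_nat_Suc of_real_divide of_real_mult)
    qed
    finally have 1: "(\<lambda>n. a (Suc n) * x y ^ Suc n) sums ((- of_real (2 * pi / N) * x y) * (\<Sum>n. diffs b n * x y ^ n))" .
    have "(\<lambda>n. a n * x y ^ n) sums qser N a y"
      using summable_sums[OF summable_norm_cancel[OF qser_summable[OF assms]]]
      unfolding qser_def qser_term x_def .
    then have "(\<lambda>n. a (Suc n) * x y ^ Suc n) sums (qser N a y - a 0)"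
      by (subst sums_Suc_iff) simp
    with 1 show ?thesis by (rule sums_unique2)
  qed
  finally show ?thesis by (simp add: b_def)
qed

lemma has_exp_expansion_ident: "has_exp_expansion N (\<lambda>y. of_real y)"
proof -
  have "poly_growth (\<lambda>n. if n = 0 then 1 else 0)"
    unfolding poly_growth_iff by (rule exI[of _ "1"], rule exI[of _ 0]) auto
  from has_exp_expansion_monomial[OF this, of 1]
  have "has_exp_expansion N (\<lambda>y. of_real y * qser N (\<lambda>n. if n = 0 then 1 else 0) y)" by simp
  then show ?thesis
  proof (rule has_exp_expansion_cong)
    fix y :: real
    have "qser N (\<lambda>n. if n = 0 then 1 else 0) y = (\<Sum>n. if n = 0 then 1 else 0)"
      unfolding qser_def by (rule suminf_cong) auto
    then show "of_real y * qser N (\<lambda>n. if n = 0 then 1 else 0) y = of_real y" 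
      using suminf_finite[of "{0}" "\<lambda>n. if n = 0 then 1 else (0::complex)"] by simp
  qed
qed

text \<open>Integration by parts. Let A be the series of \<open>a\<close> and B the termwise
  primitive of A - a_0. Then y^(j+1) A is the derivative of y^(j+1) B + a_0 y^(j+2) / (j+2), less
  (j+1) y^j B. The last term falls under the induction hypothesis for another sequence, hence the
  generality in \<open>a\<close>.\<close>

lemma monomial_primitive:
  assumes "poly_growth a"
  shows "\<exists>H. has_exp_expansion N H \<and>
           (\<forall>y>0. (H has_vector_derivative of_real (y ^ j) * qser N a y) (at y))"
  using assms
proof (induction j arbitrary: a)
  case 0
  define G where "G = qser N (\<lambda>n. - a n * of_real (real N / (2 * pi * real n)))"
  have "has_exp_expansion N (\<lambda>y. of_real (y ^ 0) * G y + a 0 * of_real y)"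
    unfolding G_def
    by (intro has_exp_expansion_add has_exp_expansion_mult has_exp_expansion_const has_exp_expansion_ident
         has_exp_expansion_monomial poly_growth_qser_primitive 0)
  moreover have "((\<lambda>y. of_real (y ^ 0) * G y + a 0 * of_real y) has_vector_derivative of_real (y ^ 0) * qser N a y) (at y)"
    if "y > 0" for y
  proof -
    have "((\<lambda>y. G y + a 0 * of_real y) has_vector_derivative (qser N a y - a 0) + a 0 * of_real 1) (at y)"
      unfolding G_def
      by (intro has_vector_derivative_add qser_deriv 0 that has_vector_derivative_mult_right
            has_vector_derivative_of_real DERIV_ident)
    then show ?thesis by simp
  qed
  ultimately show ?case by blast
next
  case (Suc j)
  define b where "b = (\<lambda>n. - a n * of_real (real N / (2 * pi * real n)))"
  have b: "poly_growth b" unfolding b_def by (rule poly_growth_qser_primitive) fact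
  obtain K where K: "has_exp_expansion N K" 
     "\<And>y. y > 0 \<Longrightarrow> (K has_vector_derivative of_real (y ^ j) * qser N b y) (at y)"
    using Suc.IH[OF b] by blast
  define c :: complex where "c = 1 / of_nat (j + 2)"
  have "of_nat (j + 2) \<noteq> (0 :: complex)" unfolding of_nat_eq_0_iff by simp
  from nonzero_eq_divide_eq[THEN iffD1, OF this c_def] have c: "c * of_nat (j + 2) = 1" .
  define H where "H = (\<lambda>y. of_real (y ^ Suc j) * qser N b y + a 0 * c * of_real (y ^ Suc (Suc j)) + - of_nat (Suc j) * K y)"
  have "has_exp_expansion N H"
    unfolding H_def of_real_power[of _ "Suc (Suc j)"]
    by (intro has_exp_expansion_add has_exp_expansion_mult has_exp_expansion_const has_exp_expansion_ident
         has_exp_expansion_monomial has_exp_expansion_power b K)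
  moreover have "(H has_vector_derivative of_real (y ^ Suc j) * qser N a y) (at y)" if "y > 0" for y
  proof -
    have p: "((\<lambda>y. complex_of_real (y ^ Suc k)) has_vector_derivative of_real (of_nat (Suc k) * y ^ k)) (at y)" for k
      using DERIV_pow[of "Suc k" y UNIV] by (intro has_vector_derivative_of_real) simp
    have d: "(qser N b has_vector_derivative qser N a y - a 0) (at y)"
      unfolding b_def by (rule qser_deriv) (use Suc that in auto)
    have "(H has_vector_derivative (of_real (y ^ Suc j) * (qser N a y - a 0) + of_real (of_nat (Suc j) * y ^ j) * qser N b y)
      + (a 0 * c) * of_real (of_nat (Suc (Suc j)) * y ^ Suc j) + - of_nat (Suc j) * (of_real (y ^ j) * qser N b y)) (at y)"
      unfolding H_def
      by (intro has_vector_derivative_add has_vector_derivative_mult[OF p d]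
            has_vector_derivative_mult_right[OF p] has_vector_derivative_mult_right[OF K(2)] that)
    moreover have "(a 0 * c) * of_real (of_nat (Suc (Suc j)) * y ^ Suc j) = a 0 * of_real (y ^ Suc j)"
      using c by (simp add: mult_ac del: of_nat_Suc power_Suc)
    ultimately show ?thesis by (simp add: algebra_simps)
  qed
  ultimately show ?case by blast
qed

text \<open>Two primitives on the half-line differ by a constant, and constants have expansions, so
  the claim holds for every primitive and not just for the one constructed.\<close>

lemma has_exp_expansion_primitive:
  assumes "has_exp_expansion N \<phi>" "\<And>y. y > 0 \<Longrightarrow> (f has_vector_derivative \<phi> y) (at y)"
  shows "has_exp_expansion N f"
proof -
  obtain J a where a: "\<And>j. j \<le> J \<Longrightarrow> poly_growth (a j)" 
     "\<And>y. y > 0 \<Longrightarrow> \<phi> y = (\<Sum>j\<le>J. of_real (y ^ j) * qser N (a j) y)"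
    using assms(1) unfolding has_exp_expansion_qser by blast
  have "\<forall>j. \<exists>H. j \<le> J \<longrightarrow> has_exp_expansion N H \<and>
           (\<forall>y>0. (H has_vector_derivative of_real (y ^ j) * qser N (a j) y) (at y))"
    using monomial_primitive a(1) by blast
  then obtain H where H: "\<And>j. j \<le> J \<Longrightarrow> has_exp_expansion N (H j)"
     "\<And>j y. j \<le> J \<Longrightarrow> y > 0 \<Longrightarrow> (H j has_vector_derivative of_real (y ^ j) * qser N (a j) y) (at y)"
    by metis
  define G where "G = (\<lambda>y. \<Sum>j\<le>J. H j y)"
  have G: "has_exp_expansion N G" unfolding G_def by (intro has_exp_expansion_sum H) auto
  have "((\<lambda>y. f y - G y) has_vector_derivative 0) (at y within {0<..})" if "y \<in> {0<..}" for y
  proof -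
    have "(G has_vector_derivative \<phi> y) (at y)"
      unfolding G_def a(2)[OF that[unfolded greaterThan_iff]] by (intro has_vector_derivative_sum H) (use that in auto)
    from has_vector_derivative_diff[OF assms(2) this] that
    have "((\<lambda>y. f y - G y) has_vector_derivative 0) (at y)" by simp
    then show ?thesis by (rule has_vector_derivative_at_within)
  qed
  then obtain c where c: "\<And>y. y \<in> {0<..} \<Longrightarrow> f y - G y = c"
    using has_vector_derivative_zero_constant[of "{0<..}" "\<lambda>y. f y - G y"] by (metis convex_real_interval(3))
  from has_exp_expansion_add[OF G has_exp_expansion_const[of c]]
  show ?thesis by (rule has_exp_expansion_cong) (use c in \<open>force simp: algebra_simps\<close>)
qed

end

text \<open>Coefficients of one-forms on the imaginary axis have weight 2, functions have weight 0: the
  involution \<open>\<tau> \<mapsto> -1/\<tau>\<close> acts on \<open>\<phi>(y) dy\<close> with the Jacobian factor \<open>y\<^sup>-\<^sup>2\<close>.\<close>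

definition weight_P :: "nat \<Rightarrow> nat \<Rightarrow> (real \<Rightarrow> complex) \<Rightarrow> bool" where
  "weight_P N s f \<longleftrightarrow> has_exp_expansion N f \<and> has_exp_expansion N (\<lambda>y. f (1 / y) / of_real (y ^ s))"

lemma weight_P_cong:
  assumes "weight_P N s f" "\<And>y. y > 0 \<Longrightarrow> f y = g y"
  shows "weight_P N s g"
  using assms unfolding weight_P_def has_exp_expansion_def by simp

context
  fixes N :: nat
  assumes N: "N > 0"
begin

lemma weight_P_add: "weight_P N s f \<Longrightarrow> weight_P N s g \<Longrightarrow> weight_P N s (\<lambda>y. f y + g y)"
  unfolding weight_P_def add_divide_distrib by (auto intro!: has_exp_expansion_add N)

lemma weight_P_mult: "weight_P N s f \<Longrightarrow> weight_P N t g \<Longrightarrow> weight_P N (s + t) (\<lambda>y. f y * g y)"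
  unfolding weight_P_def
  using has_exp_expansion_mult[OF N, of f g]
    has_exp_expansion_mult[OF N, of "\<lambda>y. f (1 / y) / of_real (y ^ s)" "\<lambda>y. g (1 / y) / of_real (y ^ t)"]
  by (simp add: power_add)

lemma weight_P_mult_0: "weight_P N 0 f \<Longrightarrow> weight_P N s g \<Longrightarrow> weight_P N s (\<lambda>y. f y * g y)"
  using weight_P_mult[of 0 f s g] by simp

lemma weight_P_const: "weight_P N 0 (\<lambda>y. c)"
  unfolding weight_P_def using has_exp_expansion_const[OF N] by simp

lemma weight_P_cmult: "weight_P N s f \<Longrightarrow> weight_P N s (\<lambda>y. c * f y)"
  by (rule weight_P_mult_0[OF weight_P_const])

lemma weight_P_minus: "weight_P N s f \<Longrightarrow> weight_P N s (\<lambda>y. - f y)"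
  using weight_P_cmult[of s f "-1"] by simp

lemma weight_P_diff: "weight_P N s f \<Longrightarrow> weight_P N s g \<Longrightarrow> weight_P N s (\<lambda>y. f y - g y)"
  using weight_P_add[of s f "\<lambda>y. - g y"] weight_P_minus[of s g] by simp

lemma weight_P_sum: "(\<And>i. i \<in> I \<Longrightarrow> weight_P N s (f i)) \<Longrightarrow> weight_P N s (\<lambda>y. \<Sum>i\<in>I. f i y)"
  unfolding weight_P_def sum_divide_distrib by (auto intro!: has_exp_expansion_sum N)

lemma weight_P_power: "weight_P N 0 f \<Longrightarrow> weight_P N 0 (\<lambda>y. f y ^ k)"
  unfolding weight_P_def by (auto intro!: has_exp_expansion_power N)

lemma weight_P_Re: "weight_P N s f \<Longrightarrow> weight_P N s (\<lambda>y. of_real (Re (f y)))"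
  unfolding weight_P_def
  using has_exp_expansion_Re[OF N, of f] has_exp_expansion_Re[OF N, of "\<lambda>y. f (1 / y) / of_real (y ^ s)"]
  by (simp add: Re_divide_of_real del: of_real_power)

lemma weight_P_Im: "weight_P N s f \<Longrightarrow> weight_P N s (\<lambda>y. of_real (Im (f y)))"
  unfolding weight_P_def
  using has_exp_expansion_Im[OF N, of f] has_exp_expansion_Im[OF N, of "\<lambda>y. f (1 / y) / of_real (y ^ s)"]
  by (simp add: Im_divide_of_real del: of_real_power)

text \<open>The class P admits every power of y, so multiplying by y^s to remove the Jacobian factor
  stays inside it.\<close>

lemma weight_P_imp_class_P:
  assumes "weight_P N s f"
  shows "f \<in> class_P N"
proof -
  have "has_exp_expansion N (\<lambda>y. of_real y ^ s * (f (1 / y) / of_real (y ^ s)))"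
    using assms unfolding weight_P_def
    by (intro has_exp_expansion_mult has_exp_expansion_power has_exp_expansion_ident N) auto
  then have "has_exp_expansion N (\<lambda>y. f (1 / y))"
    by (rule has_exp_expansion_cong) auto
  with assms show ?thesis by (simp add: weight_P_def class_P_def)
qed

text \<open>The derivative of f(1/y) is -\<phi>(1/y) / y^2, which is what weight 2 provides at the
  other end; the primitive therefore has weight 0.\<close>

lemma weight_P_primitive:
  assumes "weight_P N 2 \<phi>" "\<And>y. y > 0 \<Longrightarrow> (f has_vector_derivative \<phi> y) (at y)"
  shows "weight_P N 0 f"
proof -
  have "has_exp_expansion N f"
    using has_exp_expansion_primitive[OF N] assms unfolding weight_P_def by blast
  moreover have "has_exp_expansion N (\<lambda>y. f (1 / y))"
  proof (rule has_exp_expansion_primitive[OF N])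
    show "has_exp_expansion N (\<lambda>y. -1 * (\<phi> (1 / y) / of_real (y ^ 2)))"
      using assms(1) unfolding weight_P_def by (intro has_exp_expansion_mult has_exp_expansion_const N) auto
    fix y :: real assume y: "y > 0"
    have "((\<lambda>y. 1 / y) has_vector_derivative - (1 / y\<^sup>2)) (at y)"
      unfolding has_real_derivative_iff_has_vector_derivative[symmetric]
      using y by (auto intro!: derivative_eq_intros simp: power2_eq_square)
    from vector_diff_chain_at[OF this assms(2)] y
    show "((\<lambda>y. f (1 / y)) has_vector_derivative -1 * (\<phi> (1 / y) / of_real (y ^ 2))) (at y)"
      by (simp add: o_def scaleR_conv_of_real)
  qed
  ultimately show ?thesis by (simp add: weight_P_def)
qed

end

subsection \<open>The differential of the single-valued combination\<close>

definition bern_coeff :: "nat \<Rightarrow> real" where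
  "bern_coeff k = 2 ^ k * bernoulli k / fact k"

lemma bern_coeff_0 [simp]: "bern_coeff 0 = 1" and bern_coeff_1 [simp]: "bern_coeff (Suc 0) = -1"
  using bernoulli_0 bernoulli_1 by (simp_all add: bern_coeff_def)

text \<open>The generating function of \<open>bern_coeff\<close> is 2 t / (e^(2 t) - 1). The product
  form suits the arguments below, which multiply by e^(2 t) - 1 and cancel it.\<close>

lemma bern_coeff_fps: "Abs_fps bern_coeff * (fps_exp 2 - 1) = fps_const 2 * fps_X"
proof (rule fps_ext)
  fix n
  show "fps_nth (Abs_fps bern_coeff * (fps_exp 2 - 1)) n = fps_nth (fps_const 2 * fps_X :: real fps) n"
  proof (cases n)
    case (Suc m)
    have "fps_nth (Abs_fps bern_coeff * (fps_exp 2 - 1)) n = (\<Sum>k\<le>m. bern_coeff k * (2 ^ (Suc m - k) / fact (Suc m - k)))"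
      unfolding Suc by (simp add: fps_mult_nth atMost_atLeast0 Suc_diff_le)
    also have "\<dots> = 2 ^ Suc m / fact (Suc m) * (\<Sum>k\<le>m. real (Suc m choose k) * bernoulli k)"
      unfolding sum_distrib_left
    proof (rule sum.cong)
      fix k assume "k \<in> {..m}"
      then have k: "k \<le> Suc m" by simp
      then have "(2::real) ^ Suc m = 2 ^ k * 2 ^ (Suc m - k)" by (simp flip: power_add)
      then show "bern_coeff k * (2 ^ (Suc m - k) / fact (Suc m - k)) = 2 ^ Suc m / fact (Suc m) * (real (Suc m choose k) * bernoulli k)"
        using k by (simp add: bern_coeff_def binomial_fact del: fact_Suc power_Suc)
    qed simp
    also have "\<dots> = fps_nth (fps_const 2 * fps_X :: real fps) n"
      unfolding bernoulli_recurrence by (simp add: Suc)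
    finally show ?thesis .
  qed simp
qed

lemma fps_compose_minus_nth: "fps_nth (f oo (fps_const (-1) * fps_X)) n = (-1) ^ n * (fps_nth f n :: 'a :: field)"
  by (rule fps_nth_compose_linear)

lemma fps_exp_minus_one_nz: "fps_exp 2 - 1 \<noteq> (0 :: real fps)"
proof
  assume "fps_exp 2 - 1 = (0 :: real fps)"
  then have "fps_nth (fps_exp 2 - 1 :: real fps) 1 = 0" by simp
  then show False by simp
qed

text \<open>\<open>t coth t\<close> and \<open>t / sinh t\<close> are even, and they equal \<open>b(t) + t\<close> and \<open>b(t) e\<^sup>t\<close> for
  \<open>b(t) = 2 t / (e\<^sup>2\<^sup>t - 1)\<close>.\<close>

lemma even_fps_aux:
  fixes g :: "real fps"
  assumes "g * (fps_exp 2 - 1) = fps_X * h" 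
    and "(h oo (fps_const (-1) * fps_X)) * fps_exp 2 = h" and "odd n"
  shows "fps_nth g n = 0"
proof -
  define m where "m = (fps_const (-1) * fps_X :: real fps)"
  define e where "e = (fps_exp 2 :: real fps)"
  have m0: "fps_nth m 0 = 0" by (simp add: m_def)
  have em: "(e oo m) * e = 1"
    unfolding m_def e_def fps_exp_compose_linear by (simp flip: fps_exp_add_mult)
  have "(g oo m) * ((e oo m) - 1) = - fps_X * (h oo m)"
    using arg_cong[OF assms(1), of "\<lambda>f. f oo m"]
    unfolding fps_compose_mult_distrib[OF m0] fps_compose_sub_distrib e_def [symmetric]
    by (simp add: m_def fps_const_neg[symmetric] del: fps_const_neg)
  \<comment> \<open>Multiplying by e^(2 t) turns e^(-2 t) - 1 into 1 - e^(2 t). The signs on the two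
    sides cancel, so g(-t) satisfies the same equation as g(t).\<close>
  then have "(g oo m) * ((e oo m) * e - e) = - fps_X * ((h oo m) * e)"
    by (metis (no_types, opaque_lifting) left_diff_distrib mult.assoc mult_1)
  then have "(g oo m) * (1 - e) = - fps_X * h"
    unfolding em assms(2)[folded e_def m_def] .
  then have "(g oo m) * (e - 1) = fps_X * h" by (simp add: algebra_simps)
  then have "(g oo m) * (e - 1) = g * (e - 1)" using assms(1) by (simp add: e_def)
  then have "g oo m = g" using fps_exp_minus_one_nz by (simp add: e_def)
  then have "fps_nth g n = (-1) ^ n * fps_nth g n"
    using fps_compose_minus_nth[of g n] by (simp add: m_def)
  with \<open>odd n\<close> show ?thesis by simp
qed

text \<open>Adding t to b(t) to make it even alters the coefficient at 1 alone, whence the bound on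
  \<open>n\<close>.\<close>

lemma bern_coeff_odd:
  assumes "odd n" "n > 1"
  shows "bern_coeff n = 0"
proof -
  have "fps_nth (Abs_fps bern_coeff + fps_X) n = 0"
  proof (rule even_fps_aux[where h = "fps_exp 2 + 1"])
    show "(Abs_fps bern_coeff + fps_X) * (fps_exp 2 - 1) = fps_X * (fps_exp 2 + 1)"
      unfolding distrib_right bern_coeff_fps by (simp add: algebra_simps numeral_fps_const)
    show "((fps_exp 2 + 1) oo (fps_const (-1) * fps_X)) * fps_exp 2 = (fps_exp 2 + 1 :: real fps)"
      unfolding fps_compose_add_distrib fps_exp_compose_linear
      by (simp add: distrib_right flip: fps_exp_add_mult)
  qed fact
  with assms show ?thesis by (simp add: fps_X_def)
qed

lemma bern_coeff_exp_odd:
  assumes "odd n"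
  shows "fps_nth (Abs_fps bern_coeff * fps_exp 1) n = 0"
proof (rule even_fps_aux[where h = "fps_const 2 * fps_exp 1"])
  have "Abs_fps bern_coeff * fps_exp 1 * (fps_exp 2 - 1) = Abs_fps bern_coeff * (fps_exp 2 - 1) * fps_exp 1"
    by (simp only: mult_ac)
  then show "Abs_fps bern_coeff * fps_exp 1 * (fps_exp 2 - 1) = fps_X * (fps_const 2 * fps_exp 1)"
    unfolding bern_coeff_fps by (simp only: mult_ac)
  show "(fps_const 2 * fps_exp 1 oo fps_const (- 1) * fps_X) * fps_exp 2 = (fps_const 2 * fps_exp 1 :: real fps)"
    by (subst fps_compose_mult_distrib) (simp_all add: fps_exp_compose_linear mult.assoc flip: fps_exp_add_mult)
qed fact

text \<open>Coefficient form of the Riccati equation t (b + b') = b (1 - t - b) for b(t) = 2 t /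
  (e^(2 t) - 1). The sum starts at 2 because 1 - t is the initial part of b.\<close>

lemma bern_coeff_convolution:
  assumes "k > 0"
  shows "bern_coeff (k - 1) + real k * bern_coeff k = - (\<Sum>j=2..k. bern_coeff j * bern_coeff (k - j))"
proof -
  define b where "b = Abs_fps bern_coeff"
  define e where "e = (fps_exp 2 :: real fps)"
  define X where "X = (fps_X :: real fps)"
  have e0: "e - 1 \<noteq> 0" unfolding e_def by (rule fps_exp_minus_one_nz)
  have 1: "b * (e - 1) = 2 * X" using bern_coeff_fps by (simp add: b_def e_def X_def numeral_fps_const)
  have de: "fps_deriv e = 2 * e" by (simp add: e_def numeral_fps_const)
  have 2: "fps_deriv b * (e - 1) + b * (2 * e) = 2"
    using arg_cong[OF 1, of fps_deriv] by (simp add: de X_def add.commute)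
  have "(X * (b + fps_deriv b) - b * (1 - X - b)) * (e - 1) ^ 2 = 0"
  proof -
    have "(X * (b + fps_deriv b) - b * (1 - X - b)) * (e - 1) ^ 2 =
       X * (b * (e - 1)) * (e - 1) + X * (fps_deriv b * (e - 1)) * (e - 1) - b * (e - 1) * (e - 1) + X * (b * (e - 1)) * (e - 1) + (b * (e - 1)) * (b * (e - 1))"
      by (simp add: power2_eq_square algebra_simps)
    also have "fps_deriv b * (e - 1) = 2 - b * (2 * e)" using 2 by (simp add: algebra_simps)
    also have "X * (2 - b * (2 * e)) * (e - 1) = 2 * X * (e - 1) - 2 * X * e * (b * (e - 1))"
      by (simp add: algebra_simps)
    finally show ?thesis unfolding 1 by (simp add: algebra_simps)
  qed
  then have eq: "X * (b + fps_deriv b) = b * (1 - X - b)" using e0 by simp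
  have c: "1 - X - b = - Abs_fps (\<lambda>n. if n \<ge> 2 then bern_coeff n else 0)"
  proof (rule fps_ext)
    fix n show "fps_nth (1 - X - b) n = fps_nth (- Abs_fps (\<lambda>n. if n \<ge> 2 then bern_coeff n else 0)) n"
      by (cases "n = 0 \<or> n = 1") (auto simp: X_def b_def fps_X_def)
  qed
  have "fps_nth (X * (b + fps_deriv b)) k = bern_coeff (k - 1) + real k * bern_coeff k"
    using assms by (cases k) (auto simp: X_def b_def)
  moreover have "fps_nth (b * (1 - X - b)) k = - fps_nth (Abs_fps (\<lambda>n. if n \<ge> 2 then bern_coeff n else 0) * b) k"
    unfolding c by (simp add: mult.commute)
  moreover have "fps_nth (Abs_fps (\<lambda>n. if n \<ge> 2 then bern_coeff n else 0) * b) k = (\<Sum>j=2..k. bern_coeff j * bern_coeff (k - j))"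
    unfolding fps_mult_nth by (rule sum.mono_neutral_cong_right) (auto simp: b_def)
  ultimately show ?thesis using eq by simp
qed

definition Re_Im :: "nat \<Rightarrow> complex \<Rightarrow> real" where
  "Re_Im m = (if odd m then Re else Im)"

lemma Re_Im_add [simp]: "Re_Im m (x + y) = Re_Im m x + Re_Im m y"
  and Re_Im_minus [simp]: "Re_Im m (- x) = - Re_Im m x"
  and Re_Im_0 [simp]: "Re_Im m 0 = 0"
  and Re_Im_sum: "Re_Im m (\<Sum>i\<in>I. f i) = (\<Sum>i\<in>I. Re_Im m (f i))"
  and Re_Im_of_real_mult [simp]: "Re_Im m (of_real r * x) = r * Re_Im m x"
  and bounded_linear_Re_Im: "bounded_linear (Re_Im m)"
  by (auto simp: Re_Im_def bounded_linear_Re bounded_linear_Im)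

lemma Re_Im_ii: "Re_Im m (of_real r * \<i> ^ k) = 0" if "even (m + k)"
  using that by (cases "even k") (auto simp: Re_Im_def elim!: evenE oddE)

text \<open>With w = Ln z this is the contribution to P_m of the jumps of all Li_k across the cut.
  The inner sum is the coefficient of t^(m-1) in b(a t) e^(w t) with a = Re w. The factor b(a t)
  e^(a t) is even with real coefficients, so its term of index k, with k even, meets i^(m-1-k).
  Together with the outer i the product is real or imaginary, whichever \<open>Re_Im m\<close>
  discards.\<close>

lemma Re_Im_bern_exp:
  fixes w :: complex
  shows "Re_Im m (2 * pi * \<i> * (\<Sum>k<m. of_real (bern_coeff k * Re w ^ k) * (w ^ (m - 1 - k) / fact (m - 1 - k)))) = 0"
proof (cases m)
  case (Suc n)
  define B where "B = Abs_fps (\<lambda>k. complex_of_real (bern_coeff k * Re w ^ k))"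
  define G where "G = B * fps_exp (of_real (Re w))"
  have "(\<Sum>k<m. of_real (bern_coeff k * Re w ^ k) * (w ^ (m - 1 - k) / fact (m - 1 - k))) = fps_nth (B * fps_exp w) n"
    unfolding fps_mult_nth B_def by (simp add: Suc lessThan_Suc_atMost atMost_atLeast0)
  also have "fps_exp w = fps_exp (of_real (Re w)) * fps_exp (\<i> * of_real (Im w))"
    by (simp flip: fps_exp_add_mult complex_eq)
  also have "fps_nth (B * (fps_exp (of_real (Re w)) * fps_exp (\<i> * of_real (Im w)))) n = fps_nth (G * fps_exp (\<i> * of_real (Im w))) n"
    by (simp add: G_def mult.assoc)
  also have "\<dots> = (\<Sum>k=0..n. fps_nth G k * (of_real (Im w ^ (n - k) / fact (n - k)) * \<i> ^ (n - k)))"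
    unfolding fps_mult_nth by (simp add: power_mult_distrib mult.commute)
  finally have eq: "(\<Sum>k<m. of_real (bern_coeff k * Re w ^ k) * (w ^ (m - 1 - k) / fact (m - 1 - k))) = \<dots>" .
  have G: "fps_nth G k = of_real (Re w ^ k * fps_nth (Abs_fps bern_coeff * fps_exp 1) k)" for k
  proof -
    have "fps_nth G k = (\<Sum>i=0..k. of_real (Re w ^ k * (bern_coeff i * (1 / fact (k - i)))))"
      unfolding G_def B_def fps_mult_nth
    proof (intro sum.cong refl)
      fix i assume "i \<in> {0..k}"
      then have "Re w ^ k = Re w ^ i * Re w ^ (k - i)" by (simp flip: power_add)
      then show "fps_nth (Abs_fps (\<lambda>k. complex_of_real (bern_coeff k * Re w ^ k))) i * fps_nth (fps_exp (complex_of_real (Re w))) (k - i)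
          = of_real (Re w ^ k * (bern_coeff i * (1 / fact (k - i))))" by simp
    qed
    then show ?thesis unfolding fps_mult_nth by (simp add: sum_distrib_left)
  qed
  show ?thesis
    unfolding eq sum_distrib_left Re_Im_sum
  proof (intro sum.neutral ballI)
    fix k assume k: "k \<in> {0..n}"
    show "Re_Im m (2 * pi * \<i> * (fps_nth G k * (of_real (Im w ^ (n - k) / fact (n - k)) * \<i> ^ (n - k)))) = 0"
    proof (cases "even k")
      case True
      have "2 * pi * \<i> * (fps_nth G k * (of_real (Im w ^ (n - k) / fact (n - k)) * \<i> ^ (n - k))) =
          of_real (2 * pi * (Re w ^ k * fps_nth (Abs_fps bern_coeff * fps_exp 1) k) * (Im w ^ (n - k) / fact (n - k))) * \<i> ^ Suc (n - k)"
        unfolding G by simp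
      then show ?thesis using True k Suc by (simp only:) (intro Re_Im_ii, auto)
    qed (simp add: G bern_coeff_exp_odd)
  qed
qed (simp add: Re_Im_def)

text \<open>\<open>L\<close> is a parameter because the combination is formed with three families:
  \<open>polylog\<close>, its continuation from below, and the reflection of the latter in the real
  line.\<close>

definition log_comb :: "(nat \<Rightarrow> complex \<Rightarrow> complex) \<Rightarrow> nat \<Rightarrow> complex \<Rightarrow> complex" where
  "log_comb L m z = (\<Sum>k<m. of_real (bern_coeff k * ln (norm z) ^ k) * L (m - k) z)"

lemma P_fun_log_comb: "z \<noteq> 0 \<Longrightarrow> P_fun m z = Re_Im m (log_comb polylog m z)"
  by (simp add: P_fun_def log_comb_def Re_Im_def bern_coeff_def)

lemma has_vector_derivative_ln_norm:
  fixes \<gamma> :: "real \<Rightarrow> complex"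
  assumes "(\<gamma> has_vector_derivative w) (at y)" "\<gamma> y \<noteq> 0"
  shows "((\<lambda>t. ln (norm (\<gamma> t))) has_real_derivative Re (w / \<gamma> y)) (at y)"
proof -
  define z where "z = \<gamma> y"
  have z: "norm z > 0" using assms(2) by (simp add: z_def)
  have "(norm has_derivative (\<lambda>h. inner h (sgn z))) (at z)"
    using assms(2) by (intro has_derivative_norm) (simp add: z_def)
  from has_derivative_compose[OF assms(1)[unfolded has_vector_derivative_def] this[unfolded z_def]]
  have "((\<lambda>t. norm (\<gamma> t)) has_derivative (\<lambda>h. h * inner w (sgn z))) (at y)"
    by (simp add: z_def)
  then have "((\<lambda>t. norm (\<gamma> t)) has_real_derivative inner w (sgn z)) (at y)"
    by (simp add: has_field_derivative_def mult_commute_abs)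
  from DERIV_chain2[OF DERIV_ln[of "norm (\<gamma> y)"] this] z
  have "((\<lambda>t. ln (norm (\<gamma> t))) has_real_derivative inverse (norm z) * inner w (sgn z)) (at y)"
    by (simp add: z_def)
  also have "inverse (norm z) * inner w (sgn z) = Re (w / z)"
    using z by (simp add: sgn_div_norm inner_complex_def Re_divide flip: cmod_power2) (simp add: power2_eq_square field_simps)
  finally show ?thesis by (simp add: z_def)
qed

text \<open>The left side collects the multiples of d log|z| in the differential of
  \<open>log_comb\<close>, with a = log|z|. There L(m - k) has the coefficient (b_(k-1) + k b_k)
  a^(k-1); the convolution identity and an exchange of sums turn this into combinations of weight m
  - j.\<close>

lemma log_comb_reorganise:
  fixes a :: real and L :: "nat \<Rightarrow> complex"
  shows "(\<Sum>k<m - 1. of_real (bern_coeff k * a ^ k) * L (m - 1 - k)) 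
          + (\<Sum>k<m. of_real (bern_coeff k * (real k * a ^ (k - 1))) * L (m - k))
       = - (\<Sum>j=2..m-1. of_real (bern_coeff j * a ^ (j - 1)) * (\<Sum>i<m - j. of_real (bern_coeff i * a ^ i) * L (m - j - i)))"
proof -
  have "(\<Sum>k<m - 1. of_real (bern_coeff k * a ^ k) * L (m - 1 - k))
      = (\<Sum>k=1..m-1. of_real (bern_coeff (k - 1) * a ^ (k - 1)) * L (m - k))"
    by (rule sum.reindex_bij_witness[of _ "\<lambda>k. k - 1" Suc]) auto
  moreover have "(\<Sum>k<m. of_real (bern_coeff k * (real k * a ^ (k - 1))) * L (m - k))
      = (\<Sum>k=1..m-1. of_real (bern_coeff k * (real k * a ^ (k - 1))) * L (m - k))"
    by (rule sum.mono_neutral_right) (auto simp: not_le)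
  ultimately have "(\<Sum>k<m - 1. of_real (bern_coeff k * a ^ k) * L (m - 1 - k)) 
          + (\<Sum>k<m. of_real (bern_coeff k * (real k * a ^ (k - 1))) * L (m - k))
      = (\<Sum>k=1..m-1. of_real ((bern_coeff (k - 1) + real k * bern_coeff k) * a ^ (k - 1)) * L (m - k))"
    by (simp add: sum.distrib[symmetric] algebra_simps)
  also have "\<dots> = (\<Sum>k=1..m-1. \<Sum>j | j \<in> {2..m-1} \<and> j \<le> k. - of_real (bern_coeff j * bern_coeff (k - j) * a ^ (k - 1)) * L (m - k))"
  proof (rule sum.cong)
    fix k assume k: "k \<in> {1..m-1}"
    then have set: "{j. j \<in> {2..m-1} \<and> j \<le> k} = {2..k}" by auto
    have conv: "bern_coeff (k - 1) + real k * bern_coeff k = - (\<Sum>j=2..k. bern_coeff j * bern_coeff (k - j))"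
      using k by (intro bern_coeff_convolution) simp
    show "of_real ((bern_coeff (k - 1) + real k * bern_coeff k) * a ^ (k - 1)) * L (m - k) =
       (\<Sum>j | j \<in> {2..m-1} \<and> j \<le> k. - of_real (bern_coeff j * bern_coeff (k - j) * a ^ (k - 1)) * L (m - k))"
      unfolding set conv by (simp add: sum_distrib_right sum_negf)
  qed simp
  also have "\<dots> = (\<Sum>j=2..m-1. \<Sum>k | k \<in> {1..m-1} \<and> j \<le> k. - of_real (bern_coeff j * bern_coeff (k - j) * a ^ (k - 1)) * L (m - k))"
    by (rule sum.swap_restrict) auto
  also have "\<dots> = (\<Sum>j=2..m-1. - (of_real (bern_coeff j * a ^ (j - 1)) * (\<Sum>i<m - j. of_real (bern_coeff i * a ^ i) * L (m - j - i))))"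
  proof (rule sum.cong)
    fix j assume j: "j \<in> {2..m-1}"
    have "(\<Sum>k | k \<in> {1..m-1} \<and> j \<le> k. - of_real (bern_coeff j * bern_coeff (k - j) * a ^ (k - 1)) * L (m - k))
        = (\<Sum>i<m - j. - of_real (bern_coeff j * bern_coeff i * a ^ (j - 1 + i)) * L (m - j - i))"
      using j by (intro sum.reindex_bij_witness[of _ "\<lambda>i. i + j" "\<lambda>k. k - j"]) auto
    then show "(\<Sum>k | k \<in> {1..m-1} \<and> j \<le> k. - of_real (bern_coeff j * bern_coeff (k - j) * a ^ (k - 1)) * L (m - k))
        = - (of_real (bern_coeff j * a ^ (j - 1)) * (\<Sum>i<m - j. of_real (bern_coeff i * a ^ i) * L (m - j - i)))"
      by (simp add: sum_distrib_left sum_negf power_add mult_ac)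
  qed simp
  finally show ?thesis by (simp add: sum_negf)
qed

text \<open>In dz/z = d log|z| + i d arg z the factor i exchanges real and imaginary parts and
  produces weight m - 1; the multiples of d log|z| are regrouped by
  \<open>log_comb_reorganise\<close>. The last term is the derivative of the function of weight 1.
  Only derivatives of \<open>L\<close> at the point \<open>z\<close> are assumed, which leaves the
  branch open.\<close>

lemma Re_Im_log_comb_has_derivative:
  fixes \<gamma> :: "real \<Rightarrow> complex"
  assumes \<gamma>: "(\<gamma> has_vector_derivative w) (at y)"
    and z: "z = \<gamma> y" "z \<noteq> 0"
    and L1: "(L 1 has_field_derivative 1 / (1 - z)) (at z)"
    and L: "\<And>k. k \<ge> 1 \<Longrightarrow> (L (Suc k) has_field_derivative L k z / z) (at z)"
    and m: "m \<ge> 1"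
  shows "((\<lambda>t. Re_Im m (log_comb L m (\<gamma> t))) has_real_derivative
     (if odd m then -1 else 1) * Im (w / z) * Re_Im (m - 1) (log_comb L (m - 1) z)
     - (\<Sum>j=2..m-1. bern_coeff j * ln (norm z) ^ (j - 1) * Re (w / z) * Re_Im (m - j) (log_comb L (m - j) z))
     + bern_coeff (m - 1) * ln (norm z) ^ (m - 1) * Re_Im m (w / (1 - z))) (at y)"
proof -
  define a where "a = ln (norm z)"
  define q where "q = w / z"
  \<comment> \<open>The value at 0 is Li_0, so that weight 1 obeys the common rule: z / (1 - z)
    times w / z is w / (1 - z).\<close>
  define D where "D = (\<lambda>k. if k = 0 then z / (1 - z) else L k z)"
  have LD: "((\<lambda>t. L (m - k) (\<gamma> t)) has_vector_derivative D (m - 1 - k) * q) (at y)" if "k < m" for k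
  proof (cases "m - 1 - k")
    case 0
    then have "m - k = 1" using that by simp
    then show ?thesis using field_vector_diff_chain_at[OF \<gamma> L1[unfolded z(1)]] 0 z
      by (simp add: o_def D_def q_def mult_ac)
  next
    case (Suc i)
    then have "m - k = Suc (Suc i)" using that by simp
    then show ?thesis using field_vector_diff_chain_at[OF \<gamma> L[of "Suc i", unfolded z(1)]] Suc z
      by (simp add: o_def D_def q_def mult_ac)
  qed
  have aD: "((\<lambda>t. complex_of_real (bern_coeff k * ln (norm (\<gamma> t)) ^ k)) has_vector_derivative 
       of_real (bern_coeff k * (real k * a ^ (k - 1)) * Re q)) (at y)" for k
  proof (rule has_vector_derivative_of_real)
    have "((\<lambda>t. ln (norm (\<gamma> t)) ^ k) has_real_derivative real k * (Re q * a ^ (k - 1))) (at y)"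
      using DERIV_power[OF has_vector_derivative_ln_norm[OF \<gamma>], of k] z by (simp add: a_def q_def)
    from DERIV_cmult[OF this, of "bern_coeff k"]
    show "((\<lambda>t. bern_coeff k * ln (norm (\<gamma> t)) ^ k) has_real_derivative bern_coeff k * (real k * a ^ (k - 1)) * Re q) (at y)"
      by (simp add: mult_ac)
  qed
  define G where "G = (\<lambda>m. log_comb L m z)"
  have "((\<lambda>t. log_comb L m (\<gamma> t)) has_vector_derivative
      (\<Sum>k<m. of_real (bern_coeff k * a ^ k) * (D (m - 1 - k) * q) + of_real (bern_coeff k * (real k * a ^ (k - 1)) * Re q) * L (m - k) z)) (at y)"
    unfolding log_comb_def a_def z(1)
    by (intro has_vector_derivative_sum has_vector_derivative_mult LD aD[unfolded a_def z(1)]) auto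
  also have "(\<Sum>k<m. of_real (bern_coeff k * a ^ k) * (D (m - 1 - k) * q) + of_real (bern_coeff k * (real k * a ^ (k - 1)) * Re q) * L (m - k) z)
      = (\<Sum>k<m. of_real (bern_coeff k * a ^ k) * D (m - 1 - k)) * q + of_real (Re q) * (\<Sum>k<m. of_real (bern_coeff k * (real k * a ^ (k - 1))) * L (m - k) z)"
    by (simp add: sum.distrib sum_distrib_left sum_distrib_right mult_ac)
  also have "(\<Sum>k<m. of_real (bern_coeff k * a ^ k) * D (m - 1 - k)) = G (m - 1) + of_real (bern_coeff (m - 1) * a ^ (m - 1)) * (z / (1 - z))"
  proof -
    have "{..<m} = insert (m - 1) {..<m - 1}" using m by auto
    then have "(\<Sum>k<m. of_real (bern_coeff k * a ^ k) * D (m - 1 - k)) 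
       = of_real (bern_coeff (m - 1) * a ^ (m - 1)) * D 0 + (\<Sum>k<m - 1. of_real (bern_coeff k * a ^ k) * D (m - 1 - k))"
      by simp
    also have "(\<Sum>k<m - 1. of_real (bern_coeff k * a ^ k) * D (m - 1 - k)) = G (m - 1)"
      unfolding G_def log_comb_def a_def by (intro sum.cong) (auto simp: D_def)
    finally show ?thesis by (simp add: D_def)
  qed
  also have "(G (m - 1) + of_real (bern_coeff (m - 1) * a ^ (m - 1)) * (z / (1 - z))) * q + of_real (Re q) * (\<Sum>k<m. of_real (bern_coeff k * (real k * a ^ (k - 1))) * L (m - k) z)
     = of_real (Im q) * (\<i> * G (m - 1)) + of_real (Re q) * (G (m - 1) + (\<Sum>k<m. of_real (bern_coeff k * (real k * a ^ (k - 1))) * L (m - k) z))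
      + of_real (bern_coeff (m - 1) * a ^ (m - 1)) * (w / (1 - z))"
  proof -
    define r p where "r = z / (1 - z)" and "p = w / (1 - z)"
    have "r * q = p" using z by (simp add: q_def r_def p_def)
    moreover have "G (m - 1) * q = of_real (Im q) * (\<i> * G (m - 1)) + of_real (Re q) * G (m - 1)"
      by (subst (1) complex_eq[of q]) (simp add: algebra_simps)
    ultimately show ?thesis unfolding r_def [symmetric] p_def [symmetric] by (simp add: algebra_simps)
  qed
  also have "G (m - 1) + (\<Sum>k<m. of_real (bern_coeff k * (real k * a ^ (k - 1))) * L (m - k) z)
      = - (\<Sum>j=2..m-1. of_real (bern_coeff j * a ^ (j - 1)) * G (m - j))"
    unfolding G_def log_comb_def a_def by (rule log_comb_reorganise)
  finally have D: "((\<lambda>t. Re_Im m (log_comb L m (\<gamma> t))) has_vector_derivative Re_Im m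
     (of_real (Im q) * (\<i> * G (m - 1)) + of_real (Re q) * - (\<Sum>j=2..m-1. of_real (bern_coeff j * a ^ (j - 1)) * G (m - j))
      + of_real (bern_coeff (m - 1) * a ^ (m - 1)) * (w / (1 - z)))) (at y)"
    by (rule bounded_linear.has_vector_derivative[OF bounded_linear_Re_Im])
  have iG: "Re_Im m (\<i> * G (m - 1)) = (if odd m then -1 else 1) * Re_Im (m - 1) (G (m - 1))"
    using m by (auto simp: Re_Im_def)
  \<comment> \<open>For odd j the coefficient vanishes, as j > 1; for even j the operators
    \<open>Re_Im m\<close> and \<open>Re_Im (m - j)\<close> coincide.\<close>
  have sum: "(\<Sum>j=2..m-1. bern_coeff j * a ^ (j - 1) * Re_Im m (G (m - j))) 
       = (\<Sum>j=2..m-1. bern_coeff j * a ^ (j - 1) * Re_Im (m - j) (G (m - j)))"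
  proof (rule sum.cong)
    fix j assume "j \<in> {2..m-1}"
    then show "bern_coeff j * a ^ (j - 1) * Re_Im m (G (m - j)) = bern_coeff j * a ^ (j - 1) * Re_Im (m - j) (G (m - j))"
      using bern_coeff_odd[of j] by (cases "odd j") (auto simp: Re_Im_def)
  qed simp
  have "Re_Im m (of_real (Im q) * (\<i> * G (m - 1)) + of_real (Re q) * - (\<Sum>j=2..m-1. of_real (bern_coeff j * a ^ (j - 1)) * G (m - j))
      + of_real (bern_coeff (m - 1) * a ^ (m - 1)) * (w / (1 - z)))
    = Im q * ((if odd m then -1 else 1) * Re_Im (m - 1) (G (m - 1)))
      + Re q * - (\<Sum>j=2..m-1. bern_coeff j * a ^ (j - 1) * Re_Im (m - j) (G (m - j)))
      + bern_coeff (m - 1) * a ^ (m - 1) * Re_Im m (w / (1 - z))"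
    by (simp only: Re_Im_add Re_Im_of_real_mult Re_Im_minus Re_Im_sum iG sum)
  with D show ?thesis
    unfolding has_real_derivative_iff_has_vector_derivative a_def q_def G_def
    by (simp add: sum_distrib_left mult_ac)
qed

subsection \<open>Polylogarithms continued from below\<close>

text \<open>The plane cut along the ray from \<open>1\<close> upwards. Unlike the principal slit plane it contains the
  half-line \<open>z > 1\<close>, so that the polylogarithms continued from below are holomorphic there.\<close>

definition low_dom :: "complex set" where
  "low_dom = {z. \<not> (Re z = 1 \<and> Im z \<ge> 0)}"

lemma open_low_dom: "open low_dom"
proof -
  have "closed ({z. Re z = 1} \<inter> {z. Im z \<ge> 0})"
    by (intro closed_Int closed_Collect_eq closed_Collect_le continuous_intros)
  then have "open (- ({z. Re z = 1} \<inter> {z. Im z \<ge> 0}))" by (rule open_Compl)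
  also have "- ({z. Re z = 1} \<inter> {z. Im z \<ge> 0}) = low_dom" by (auto simp: low_dom_def)
  finally show ?thesis .
qed

text \<open>The centre lies on the line of the removed ray, below its tip: a segment starting there
  either leaves the line at once or stays on it with negative imaginary part. Starlikeness is what
  guarantees primitives.\<close>

lemma low_dom_segment:
  assumes "z \<in> low_dom"
  shows "closed_segment (1 - \<i> / 2) z \<subseteq> low_dom"
proof
  fix x assume "x \<in> closed_segment (1 - \<i> / 2) z"
  then obtain t where t: "0 \<le> t" "t \<le> 1" and x: "x = (1 - t) *\<^sub>R (1 - \<i> / 2) + t *\<^sub>R z"
    by (auto simp: closed_segment_def)
  have re: "Re x = 1 + t * (Re z - 1)" and im: "Im x = - (1 - t) / 2 + t * Im z"
    unfolding x by (auto simp: field_simps)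
  show "x \<in> low_dom"
  proof (rule ccontr)
    assume "x \<notin> low_dom"
    then have i: "Im x \<ge> 0" and "t = 0 \<or> Re z = 1" using re by (auto simp: low_dom_def)
    from this(2) show False
    proof
      assume "t = 0" then show False using i im by simp
    next
      assume "Re z = 1"
      then have "Im z < 0" using assms by (auto simp: low_dom_def)
      then have "t * Im z \<le> 0" using t by (simp add: mult_nonneg_nonpos)
      have "0 \<le> - (1 - t) / 2 + t * Im z" using i unfolding im .
      also have "\<dots> \<le> - (1 - t) / 2 + 0" by (rule add_left_mono) fact
      finally have "t \<ge> 1" by simp
      with t have "t = 1" by simp
      with i im \<open>Im z < 0\<close> show False by simp
    qed
  qed
qed

lemma starlike_low_dom: "starlike low_dom"
  unfolding starlike_def
proof (intro bexI ballI)
  show "1 - \<i> / 2 \<in> low_dom" by (simp add: low_dom_def)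
qed (rule low_dom_segment)

text \<open>A branch of -log (1 - z). Rotating 1 - z by -i moves the cut of \<open>Ln\<close> to the
  ray from 1 upwards, and the summand i pi / 2 undoes the rotation.\<close>

definition low_log :: "complex \<Rightarrow> complex" where
  "low_log z = - (Ln (- \<i> * (1 - z)) + \<i> * pi / 2)"

lemma low_log_deriv:
  assumes "z \<in> low_dom"
  shows "(low_log has_field_derivative 1 / (1 - z)) (at z)"
proof -
  have "- \<i> * (1 - z) \<notin> \<real>\<^sub>\<le>\<^sub>0"
    using assms by (auto simp: low_dom_def complex_nonpos_Reals_iff)
  moreover from this have "1 - z \<noteq> 0" by auto
  ultimately show ?thesis
    unfolding low_log_def [abs_def] by (auto intro!: derivative_eq_intros simp: field_simps)
qed

lemma low_log_0: "low_log 0 = 0" by (simp add: low_log_def)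

text \<open>The half-line z > 1 is included: there \<open>Ln\<close> gives 1 - z the imaginary part
  pi, which is its limit as z approaches from below.\<close>

lemma low_log_eq_Ln:
  assumes "Im z \<le> 0 \<or> Re z < 1" "z \<noteq> 1"
  shows "low_log z = - Ln (1 - z)"
  using Ln_times_ii[of "- \<i> * (1 - z)"] assms by (auto simp: low_log_def)

text \<open>The value at \<open>0\<close> of the integrand is the one given by continuity.\<close>

lemma primitive_low_dom:
  assumes "h holomorphic_on low_dom" "h 0 = 0"
  shows "\<exists>g. g 0 = 0 \<and> (\<forall>z\<in>low_dom. (g has_field_derivative (if z = 0 then deriv h 0 else h z / z)) (at z))"
proof -
  define f where "f = (\<lambda>z. if z = 0 then deriv h 0 else h z / z)"
  have "f holomorphic_on low_dom"
    by (rule pole_theorem_open_0[OF assms(1) open_low_dom, of 0]) (auto simp: f_def assms)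
  then have "\<exists>g. \<forall>z\<in>low_dom. (g has_field_derivative f z) (at z)"
    by (intro holomorphic_starlike_primitive[where k = "{}"] holomorphic_on_imp_continuous_on starlike_low_dom open_low_dom)
       (auto simp: holomorphic_on_open[OF open_low_dom] field_differentiable_def)
  then obtain g where "\<And>z. z \<in> low_dom \<Longrightarrow> (g has_field_derivative f z) (at z)" by blast
  then have "\<forall>z\<in>low_dom. ((\<lambda>z. g z - g 0) has_field_derivative f z) (at z)"
    by (auto intro!: derivative_eq_intros)
  then show ?thesis unfolding f_def by (intro exI[of _ "\<lambda>z. g z - g 0"]) auto
qed

text \<open>The chosen primitive is determined on the connected set \<open>low_dom\<close> by its
  value at 0; outside this set it is arbitrary.\<close>

fun low_polylog :: "nat \<Rightarrow> complex \<Rightarrow> complex" where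
  "low_polylog 0 = (\<lambda>z. z / (1 - z))"
| "low_polylog (Suc 0) = low_log"
| "low_polylog (Suc (Suc m)) = (SOME g. g 0 = 0 \<and> (\<forall>z\<in>low_dom.
     (g has_field_derivative (if z = 0 then deriv (low_polylog (Suc m)) 0 else low_polylog (Suc m) z / z)) (at z)))"

text \<open>The choice in \<open>low_polylog\<close> is justified only once the preceding function
  is holomorphic and vanishes at 0, so existence and these properties pass through one
  induction.\<close>

lemma low_polylog_holomorphic: "low_polylog (Suc m) holomorphic_on low_dom \<and> low_polylog (Suc m) 0 = 0"
  and low_polylog_deriv_aux: "\<forall>z\<in>low_dom. (low_polylog (Suc (Suc m)) has_field_derivative 
          (if z = 0 then deriv (low_polylog (Suc m)) 0 else low_polylog (Suc m) z / z)) (at z)"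
proof -
  let ?P = "\<lambda>m. low_polylog (Suc m) holomorphic_on low_dom \<and> low_polylog (Suc m) 0 = 0"
  let ?Q = "\<lambda>m. \<forall>z\<in>low_dom. (low_polylog (Suc (Suc m)) has_field_derivative 
          (if z = 0 then deriv (low_polylog (Suc m)) 0 else low_polylog (Suc m) z / z)) (at z)"
  have Q: "low_polylog (Suc (Suc m)) 0 = 0 \<and> ?Q m" if "?P m" for m
    unfolding low_polylog.simps(3)
    by (rule someI_ex[OF primitive_low_dom[OF conjunct1[OF that] conjunct2[OF that]]])
  have P: "?P m" for m
  proof (induction m)
    case 0
    show ?case using low_log_deriv by (auto simp: low_log_0 holomorphic_on_open[OF open_low_dom])
  next
    case (Suc m)
    from Q[OF this] show ?case by (auto simp only: holomorphic_on_open[OF open_low_dom])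
  qed
  show "?P m" by (rule P)
  show "?Q m" using Q[OF P] by blast
qed

declare low_polylog.simps(3) [simp del]

lemma low_polylog_0: "low_polylog (Suc m) 0 = 0"
  using low_polylog_holomorphic by blast

lemma low_polylog_deriv:
  assumes "z \<in> low_dom" "z \<noteq> 0"
  shows "(low_polylog (Suc (Suc m)) has_field_derivative low_polylog (Suc m) z / z) (at z)"
  using low_polylog_deriv_aux[of m] assms by auto

lemma continuous_low_polylog:
  assumes "z \<in> low_dom"
  shows "isCont (low_polylog (Suc m)) z"
  using low_polylog_holomorphic[of m] assms open_low_dom
  by (meson holomorphic_on_imp_continuous_on continuous_on_eq_continuous_at)

section \<open>Agreement of \<open>polylog\<close> with the continuation from below\<close>

lemma polylog_0: "polylog (Suc m) 0 = 0"
  by (induction m) simp_all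

text \<open>\<open>Ln\<close> commutes with conjugation off its cut, and the plane without the
  half-line z \<ge> 1 is stable under scaling by t in [0, 1], so the property passes through the
  integral.\<close>

lemma polylog_cnj:
  assumes "Im z \<noteq> 0 \<or> Re z < 1"
  shows "cnj (polylog (Suc m) (cnj z)) = polylog (Suc m) z"
  using assms
proof (induction m arbitrary: z)
  case 0
  then have "1 - cnj z \<notin> \<real>\<^sub>\<le>\<^sub>0" by (auto simp: complex_nonpos_Reals_iff)
  then show ?case by (simp add: cnj_Ln)
next
  case (Suc m)
  have "cnj (polylog (Suc m) (of_real t * cnj z) / of_real t) = polylog (Suc m) (of_real t * z) / of_real t"
    if "t \<in> {0..1}" for t
  proof (cases "t = 0")
    case False
    then have "Im (of_real t * z) \<noteq> 0 \<or> Re (of_real t * z) < 1"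
      using Suc.prems that mult_left_le_one_le[of "Re z" t] mult_nonneg_nonpos[of t "Re z"]
      by (cases "Re z \<ge> 0") auto
    from Suc.IH[OF this] show ?thesis by simp
  qed simp
  then show ?case unfolding polylog.simps(3) integral_cnj by (rule integral_cong)
qed

text \<open>The bound ln x \<le> x is applied to x = 1 / sqrt r, where r is the norm of w: this
  leaves r / sqrt r, which tends to 0, whereas x = 1 / r would leave a constant.\<close>

lemma tendsto_ident_times_Ln: "((\<lambda>w. w * Ln w) \<longlongrightarrow> 0) (at 0)"
proof (rule Lim_null_comparison)
  show "((\<lambda>w::complex. 2 * sqrt (norm w) + norm w * pi) \<longlongrightarrow> 0) (at 0)"
    by (rule tendsto_eq_intros refl | simp)+
  have "norm (w * Ln w) \<le> 2 * sqrt (norm w) + norm w * pi" if "w \<noteq> 0" "dist w 0 < 1" for w :: complex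
  proof -
    define r where "r = norm w"
    have r: "0 < r" "r < 1" using that by (auto simp: r_def)
    have "norm (Ln w) \<le> \<bar>Re (Ln w)\<bar> + \<bar>Im (Ln w)\<bar>" by (rule cmod_le)
    also have "\<bar>Im (Ln w)\<bar> \<le> pi" using that mpi_less_Im_Ln[of w] Im_Ln_le_pi[of w] by auto
    also have "\<bar>Re (Ln w)\<bar> = - ln r" using that r by (simp add: r_def)
    finally have "norm (Ln w) \<le> - ln r + pi" by simp
    then have "norm (w * Ln w) \<le> r * (- ln r + pi)" using r by (simp add: norm_mult r_def)
    also have "- ln r = 2 * ln (1 / sqrt r)" using r by (simp add: ln_div ln_sqrt)
    also have "ln (1 / sqrt r) \<le> 1 / sqrt r" using r ln_le_minus_one[of "1 / sqrt r"] by simp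
    finally have "norm (w * Ln w) \<le> r * (2 * (1 / sqrt r) + pi)" using r by simp
    also have "\<dots> = 2 * (r / sqrt r) + r * pi" by (simp add: algebra_simps)
    also have "r / sqrt r = sqrt r" using r by (simp add: real_div_sqrt)
    finally show ?thesis by (simp add: r_def)
  qed
  then show "eventually (\<lambda>w. norm (w * Ln w) \<le> 2 * sqrt (norm w) + norm w * pi) (at (0::complex))"
    unfolding eventually_at by (intro exI[of _ 1]) auto
qed

text \<open>\<open>Li\<^sub>2(z) + log(1 - z) log z\<close> is holomorphic near \<open>1\<close>, its derivative being \<open>log z / (z - 1)\<close>.\<close>

lemma low_dilog_limit_1: "\<exists>c. (low_polylog 2 \<longlongrightarrow> c) (at 1 within {z. Im z \<le> 0})"
proof -
  let ?B = "ball (1::complex) 1"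
  let ?V = "?B \<inter> low_dom"
  have B: "Re z > 0" if "z \<in> ?B" for z
    using that abs_Re_le_cmod[of "1 - z"] by (auto simp: dist_norm)
  then have B': "z \<notin> \<real>\<^sub>\<le>\<^sub>0" "z \<noteq> 0" if "z \<in> ?B" for z
    using that by (force simp: complex_nonpos_Reals_iff)+
  \<comment> \<open>As Ln vanishes at 1, the quotient extends holomorphically over 1. Its primitive
    \<open>K\<close> then has a limit there, and \<open>low_log z * Ln z\<close> remains to be
    controlled.\<close>
  define k where "k = (\<lambda>z. if z = 1 then deriv Ln 1 else Ln z / (z - 1))"
  have "k holomorphic_on ?B"
    by (rule pole_theorem_open_0[of Ln _ 1]) (use B' in \<open>auto simp: k_def intro!: holomorphic_intros\<close>)
  then obtain K where K: "\<And>z. z \<in> ?B \<Longrightarrow> (K has_field_derivative k z) (at z)"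
    by (metis holomorphic_convex_primitive' convex_ball open_ball at_within_open)
  define h where "h = (\<lambda>z. low_polylog 2 z - low_log z * Ln z - K z)"
  have "(h has_field_derivative 0) (at z)" if z: "z \<in> ?V" for z
  proof -
    have "z \<noteq> 1" using z by (auto simp: low_dom_def)
    have "(h has_field_derivative (low_log z / z - (1 / (1 - z) * Ln z + (1 / z) * low_log z) - k z)) (at z)"
      unfolding h_def
      by (intro DERIV_diff DERIV_mult low_log_deriv K has_field_derivative_Ln[THEN DERIV_cong])
         (use z B' low_polylog_deriv[of z 0] in \<open>auto simp: numeral_2_eq_2 field_simps\<close>)
    moreover have "k z = - (1 / (1 - z) * Ln z)"
      using \<open>z \<noteq> 1\<close> minus_divide_right[of "Ln z" "1 - z"] by (simp add: k_def)
    ultimately show ?thesis by simp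
  qed
  moreover have "connected ?V"
  proof (rule starlike_imp_connected)
    have c: "1 - \<i> / 2 \<in> ?B" by (simp add: dist_norm norm_divide)
    have "closed_segment (1 - \<i> / 2) z \<subseteq> ?V" if "z \<in> ?V" for z
      using low_dom_segment[of z] closed_segment_subset[OF c, of z] that by auto
    moreover have "1 - \<i> / 2 \<in> ?V" using c by (simp add: low_dom_def)
    ultimately show "starlike ?V" unfolding starlike_def by blast
  qed
  moreover have "open ?V" by (intro open_Int open_ball open_low_dom)
  ultimately obtain c where c: "\<And>z. z \<in> ?V \<Longrightarrow> h z = c"
    using has_field_derivative_0_imp_constant_on[of ?V h] by (auto simp: constant_on_def)
  have "((\<lambda>z. c + low_log z * Ln z + K z) \<longlongrightarrow> c + 0 + K 1) (at 1 within {z. Im z \<le> 0})"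
  proof (intro tendsto_add tendsto_const)
    have "isCont K 1" using K[of 1] DERIV_isCont by fastforce
    then show "(K \<longlongrightarrow> K 1) (at 1 within {z. Im z \<le> 0})"
      unfolding isCont_def by (rule tendsto_within_subset) simp
    have "(Ln has_field_derivative 1) (at 1)" by (auto intro!: derivative_eq_intros)
    then have "((\<lambda>z. Ln z / (z - 1)) \<longlongrightarrow> 1) (at 1)" by (simp add: has_field_derivative_iff)
    moreover have "((\<lambda>z. (- \<i> * (1 - z)) * Ln (- \<i> * (1 - z))) \<longlongrightarrow> 0) (at 1)"
    proof -
      have "filterlim (\<lambda>z. - \<i> * (1 - z)) (at 0) (at (1::complex))"
        unfolding filterlim_at by (auto simp: eventually_at intro!: tendsto_eq_intros exI[of _ 1])
      from filterlim_compose[OF tendsto_ident_times_Ln this] show ?thesis .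
    qed
    moreover have "((\<lambda>z. (1 - z) * (\<i> * pi / 2)) \<longlongrightarrow> 0) (at (1::complex))"
      by (auto intro!: tendsto_eq_intros)
    \<comment> \<open>The first factor is (1 - z) times a branch of log (1 - z), the second is the
      difference quotient of Ln at 1; their product is \<open>low_log z * Ln z\<close>.\<close>
    ultimately have "((\<lambda>z. (\<i> * ((- \<i> * (1 - z)) * Ln (- \<i> * (1 - z))) + (1 - z) * (\<i> * pi / 2)) * (Ln z / (z - 1))) 
        \<longlongrightarrow> (\<i> * 0 + 0) * 1) (at 1)"
      by (intro tendsto_intros)
    then have "((\<lambda>z. low_log z * Ln z) \<longlongrightarrow> (\<i> * 0 + 0) * 1) (at 1)"
    proof (rule Lim_transform_within[of _ _ _ _ 1])
      fix z :: complex assume "0 < dist z 1"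
      then have "z - 1 \<noteq> 0" by auto
      then have "(\<i> * ((- \<i> * (1 - z)) * L) + (1 - z) * (\<i> * pi / 2)) * (l / (z - 1)) = - (L + \<i> * pi / 2) * l" for L l
        by (simp add: field_simps)
      then show "(\<i> * ((- \<i> * (1 - z)) * Ln (- \<i> * (1 - z))) + (1 - z) * (\<i> * pi / 2)) * (Ln z / (z - 1)) = low_log z * Ln z"
        unfolding low_log_def by blast
    qed simp
    then have "((\<lambda>z. low_log z * Ln z) \<longlongrightarrow> 0) (at 1)" by simp
    then show "((\<lambda>z. low_log z * Ln z) \<longlongrightarrow> 0) (at 1 within {z. Im z \<le> 0})"
      by (rule tendsto_within_subset) simp
  qed
  then have "((\<lambda>z. low_polylog 2 z) \<longlongrightarrow> c + 0 + K 1) (at 1 within {z. Im z \<le> 0})"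
  proof (rule Lim_transform_within[of _ _ _ _ 1])
    fix z assume "z \<in> {z. Im z \<le> 0}" "0 < dist z 1" "dist z 1 < 1"
    then have "z \<in> ?V" by (auto simp: low_dom_def dist_commute complex_eq_iff)
    from c[OF this] show "c + low_log z * Ln z + K z = low_polylog 2 z" by (simp add: h_def algebra_simps)
  qed simp
  then show ?thesis by blast
qed

text \<open>For real z > 1 the path defining \<open>polylog\<close> runs through 1, which is not in
  \<open>low_dom\<close>, so a limit has to serve there. Once the preceding function is bounded near
  1 in the lower half-plane, the next one is Lipschitz there and extends continuously to the
  closure. Weight 2 is treated separately because \<open>low_log\<close> is unbounded at 1.\<close>

lemma low_polylog_limit_1: "\<exists>c. (low_polylog (Suc (Suc m)) \<longlongrightarrow> c) (at 1 within {z. Im z \<le> 0})"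
proof (induction m)
  case 0
  then show ?case using low_dilog_limit_1 by (simp add: numeral_2_eq_2)
next
  case (Suc m)
  define f where "f = low_polylog (Suc (Suc (Suc m)))"
  define g where "g = low_polylog (Suc (Suc m))"
  define H where "H = {z. Im z \<le> 0}"
  obtain c where "(g \<longlongrightarrow> c) (at 1 within H)" using Suc unfolding g_def H_def by blast
  then have "((\<lambda>z. g z / z) \<longlongrightarrow> c / 1) (at 1 within H)" by (intro tendsto_intros) auto
  then have "eventually (\<lambda>z. dist (g z / z) (c / 1) < 1) (at 1 within H)"
    by (rule tendstoD) simp
  then obtain r where r: "r > 0" "\<And>z. z \<in> H \<Longrightarrow> z \<noteq> 1 \<Longrightarrow> dist z 1 < r \<Longrightarrow> dist (g z / z) c < 1"
    unfolding eventually_at by auto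
  define B where "B = ball 1 (min r 1) \<inter> {z. Im z < 0}"
  have conv: "convex B" unfolding B_def by (intro convex_Int convex_ball convex_halfspace_Im_lt)
  have Bdom: "z \<in> low_dom" "z \<noteq> 0" if "z \<in> B" for z using that by (auto simp: B_def low_dom_def)
  have lip: "norm (f x - f y) \<le> (norm c + 1) * norm (x - y)" if "x \<in> B" "y \<in> B" for x y
  proof (rule field_differentiable_bound[OF conv _ _ that])
    fix z assume z: "z \<in> B"
    show "(f has_field_derivative g z / z) (at z within B)"
      unfolding f_def g_def by (rule has_field_derivative_at_within) (intro low_polylog_deriv Bdom[OF z])
    have "dist (g z / z) c < 1" using z by (intro r) (auto simp: B_def H_def dist_commute)
    then show "norm (g z / z) \<le> norm c + 1"
      using norm_triangle_ineq2[of "g z / z" c] by (simp add: dist_norm)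
  qed
  have "(norm c + 1)-lipschitz_on B f"
    by (intro lipschitz_onI) (use lip in \<open>auto simp: dist_norm\<close>)
  then have "uniformly_continuous_on B f" by (rule lipschitz_on_uniformly_continuous)
  then obtain F where F: "uniformly_continuous_on (closure B) F" "\<And>x. x \<in> B \<Longrightarrow> f x = F x"
    by (rule uniformly_continuous_on_extension_on_closure) blast
  have cF: "continuous_on (closure B) F" using F(1) by (rule uniformly_continuous_imp_continuous)
  \<comment> \<open>Points of the closed half-plane near 1, real ones included, are approached from
    directly below by points of \<open>B\<close>.\<close>
  have cl: "z \<in> closure B \<and> at z within B \<noteq> bot" if z: "z \<in> H" "dist z 1 < min r 1" for z
  proof -
    have "z islimpt B"
      unfolding islimpt_approachable
    proof (intro allI impI)
      fix e :: real assume "e > 0"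
      define d where "d = min e (min r 1 - dist z 1) / 2"
      have d: "0 < d" "d < e" "d < min r 1 - dist z 1" using \<open>e > 0\<close> z by (auto simp: d_def)
      have "dist (z - \<i> * d) z = d" using d by (simp add: dist_norm norm_mult)
      moreover from this have "dist (z - \<i> * d) 1 < min r 1" using d dist_triangle[of "z - \<i> * d" 1 z] by linarith
      ultimately show "\<exists>x'\<in>B. x' \<noteq> z \<and> dist x' z < e"
        using z d by (intro bexI[of _ "z - \<i> * d"]) (auto simp: B_def H_def dist_commute)
    qed
    then show ?thesis by (auto simp: trivial_limit_within closure_def)
  qed
  have fF: "f z = F z" if z: "z \<in> H" "dist z 1 < min r 1" "z \<noteq> 1" for z
  proof (rule tendsto_unique)
    show "at z within B \<noteq> bot" using cl z by blast
    have "z \<in> low_dom" using z by (auto simp: H_def low_dom_def complex_eq_iff)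
    then have "isCont f z" unfolding f_def by (rule continuous_low_polylog)
    then show "(f \<longlongrightarrow> f z) (at z within B)"
      unfolding isCont_def by (rule tendsto_within_subset) simp
    have "(F \<longlongrightarrow> F z) (at z within B)"
      using cF cl[OF z(1,2)] closure_subset[of B] by (meson continuous_on_def tendsto_within_subset)
    then show "(f \<longlongrightarrow> F z) (at z within B)"
      by (rule Lim_transform_within[of _ _ _ _ 1]) (use F(2) in auto)
  qed
  have "(F \<longlongrightarrow> F 1) (at 1 within H \<inter> ball 1 (min r 1))"
  proof (rule tendsto_within_subset)
    show "(F \<longlongrightarrow> F 1) (at 1 within closure B)" 
      using cF cl[of 1] r(1) by (auto simp: continuous_on_def H_def)
    show "H \<inter> ball 1 (min r 1) \<subseteq> closure B" using cl by (auto simp: dist_commute)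
  qed
  moreover have "at 1 within H \<inter> ball 1 (min r 1) = at 1 within H"
    using r(1) by (intro at_within_nhd[of _ "ball 1 (min r 1)"]) auto
  ultimately have "(F \<longlongrightarrow> F 1) (at 1 within H)" by simp
  then have "(f \<longlongrightarrow> F 1) (at 1 within H)"
    by (rule Lim_transform_within[of _ _ _ _ "min r 1"]) (use fF r(1) in auto)
  then show ?case unfolding f_def H_def by blast
qed

text \<open>The fundamental theorem of calculus along the segment from 0 to z. It tolerates finitely
  many points without derivative as long as the primitive is continuous, which \<open>F\<close> is
  by taking the limit as its value where the segment meets 1.\<close>

lemma polylog_eq_low_polylog:
  assumes "Im z \<le> 0 \<or> Re z < 1" "z \<noteq> 1"
  shows "polylog (Suc m) z = low_polylog (Suc m) z"
  using assms
proof (induction m arbitrary: z)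
  case 0
  then show ?case by (simp add: low_log_eq_Ln)
next
  case (Suc m)
  show ?case
  proof (cases "z = 0")
    case True
    then show ?thesis by (simp add: polylog_0 low_polylog_0)
  next
    case False
    obtain c where c: "(low_polylog (Suc (Suc m)) \<longlongrightarrow> c) (at 1 within {z. Im z \<le> 0})"
      using low_polylog_limit_1 by blast
    define F where "F = (\<lambda>t. if of_real t * z = 1 then c else low_polylog (Suc (Suc m)) (of_real t * z))"
    have dom: "of_real t * z \<in> low_dom \<and> (Im (of_real t * z) \<le> 0 \<or> Re (of_real t * z) < 1)"
      if "t \<in> {0..1}" "of_real t * z \<noteq> 1" for t
    proof (cases "Im z \<le> 0")
      case True
      then have "t * Im z \<le> 0" using that by (simp add: mult_nonneg_nonpos)
      then show ?thesis using that(2) by (auto simp: low_dom_def complex_eq_iff)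
    next
      case False
      then have "Re z < 1" using Suc.prems by auto
      then have "t * Re z < 1" 
        using that(1) mult_left_le_one_le[of "Re z" t] mult_nonneg_nonpos[of t "Re z"]
        by (cases "Re z \<ge> 0") auto
      then show ?thesis by (auto simp: low_dom_def)
    qed
    have opn: "open {s. of_real s * z \<noteq> 1}" by (intro open_Collect_neq continuous_intros)
    have ev: "eventually (\<lambda>s. F s = low_polylog (Suc (Suc m)) (of_real s * z)) (nhds t)"
      if "of_real t * z \<noteq> 1" for t
    proof -
      have "eventually (\<lambda>s. s \<in> {s. of_real s * z \<noteq> 1}) (nhds t)"
        using that opn by (intro eventually_nhds_in_open) auto
      then show ?thesis by eventually_elim (simp add: F_def)
    qed
    have lin: "((\<lambda>s. of_real s * z) has_vector_derivative z) (at t)" for t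
      by (auto intro!: derivative_eq_intros)
    have "((\<lambda>t. polylog (Suc m) (of_real t * z) / of_real t) has_integral F 1 - F 0) {0..1}"
    \<comment> \<open>If t z = 1 then t = Re (1 / z), so this one exceptional parameter serves for
      all z.\<close>
    proof (rule fundamental_theorem_of_calculus_interior_strong[where S = "{Re (1 / z)}"])
      fix t assume t: "t \<in> {0<..<1} - {Re (1 / z)}"
      then have t': "t \<in> {0..1}" "t \<noteq> 0" by auto
      have tz: "of_real t * z \<noteq> 1"
      proof
        assume "of_real t * z = 1"
        then have "of_real t = 1 / z" using False by (simp add: field_simps)
        then have "Re (of_real t) = Re (1 / z)" by simp
        with t show False by simp
      qed
      have "((\<lambda>s. low_polylog (Suc (Suc m)) (of_real s * z)) has_vector_derivative 
             z * (low_polylog (Suc m) (of_real t * z) / (of_real t * z))) (at t)"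
        using field_vector_diff_chain_at[OF lin low_polylog_deriv[of "of_real t * z" m]] dom[OF t'(1) tz] t' False
        by (simp add: o_def)
      also have "z * (low_polylog (Suc m) (of_real t * z) / (of_real t * z)) = polylog (Suc m) (of_real t * z) / of_real t"
        using Suc.IH[OF _ tz] dom[OF t'(1) tz] False t' by (simp add: field_simps)
      finally show "(F has_vector_derivative polylog (Suc m) (of_real t * z) / of_real t) (at t)"
        by (rule has_vector_derivative_transform_within_open[OF _ opn]) (use tz in \<open>auto simp: F_def\<close>)
    next
      show "continuous_on {0..1} F"
        unfolding continuous_on_def
      proof
        fix t :: real assume t: "t \<in> {0..1}"
        show "(F \<longlongrightarrow> F t) (at t within {0..1})"
        proof (cases "of_real t * z = 1")
          case False
          have "isCont (\<lambda>s. low_polylog (Suc (Suc m)) (of_real s * z)) t"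
            by (rule continuous_at_compose[unfolded o_def, where g = "low_polylog (Suc (Suc m))"])
               (use continuous_low_polylog dom[OF t False] in \<open>auto intro!: continuous_intros\<close>)
          then have "isCont F t" using isCont_cong[OF ev[OF False]] by simp
          then show ?thesis unfolding isCont_def by (rule tendsto_within_subset) simp
        next
          case True
          then have t0: "t \<noteq> 0" by auto
          with True have z: "z = of_real (1 / t)" by (simp add: field_simps)
          have ne: "of_real s * z \<noteq> 1" if "s \<noteq> t" for s
          proof -
            have "of_real s * z = of_real (s / t)" by (simp add: z)
            moreover have "s / t \<noteq> 1" using that t0 by simp
            ultimately show ?thesis by (simp only: of_real_eq_1_iff) simp
          qed
          have "filterlim (\<lambda>s. of_real s * z) (at 1 within {z. Im z \<le> 0}) (at t within {0..1})"
            unfolding filterlim_at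
          proof (intro conjI)
            show "((\<lambda>s. of_real s * z) \<longlongrightarrow> 1) (at t within {0..1})"
              using True by (auto intro!: tendsto_eq_intros)
            show "\<forall>\<^sub>F s in at t within {0..1}. of_real s * z \<in> {z. Im z \<le> 0} \<and> of_real s * z \<noteq> 1"
              unfolding eventually_at using ne by (intro exI[of _ 1]) (auto simp: z)
          qed
          from filterlim_compose[OF c this]
          have "((\<lambda>s. low_polylog (Suc (Suc m)) (of_real s * z)) \<longlongrightarrow> F t) (at t within {0..1})"
            using True by (simp add: F_def)
          then show ?thesis
            by (rule Lim_transform_within[of _ _ _ _ 1]) (use ne in \<open>auto simp: F_def\<close>)
        qed
      qed
    qed auto
    then have "polylog (Suc (Suc m)) z = F 1 - F 0" by (simp add: integral_unique)
    also have "\<dots> = low_polylog (Suc (Suc m)) z" using Suc.prems by (simp add: F_def low_polylog_0)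
    finally show ?thesis .
  qed
qed

lemma polylog_eq_cnj_low_polylog:
  assumes "Im z > 0"
  shows "polylog (Suc m) z = cnj (low_polylog (Suc m) (cnj z))"
proof -
  have "cnj z \<noteq> 1" using assms by auto
  then have "polylog (Suc m) (cnj z) = low_polylog (Suc m) (cnj z)"
    using assms by (intro polylog_eq_low_polylog) auto
  then show ?thesis using polylog_cnj[of z m] assms by simp
qed

text \<open>The values at real x < 1 are real, and so is their limit. The same limit is reached from
  x > 1, so the jump tends to 0 at 1; this fixes the constant in
  \<open>low_polylog_jump\<close>.\<close>

lemma low_polylog_limit_1_real:
  obtains c where "c \<in> \<real>" "(low_polylog (Suc (Suc m)) \<longlongrightarrow> c) (at 1 within {z. Im z \<le> 0})"
proof -
  obtain c where c: "(low_polylog (Suc (Suc m)) \<longlongrightarrow> c) (at 1 within {z. Im z \<le> 0})"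
    using low_polylog_limit_1 by blast
  have lim: "filterlim complex_of_real (at 1 within {z. Im z \<le> 0}) (at_left 1)"
    unfolding filterlim_at by (auto simp: eventually_at intro!: tendsto_eq_intros exI[of _ 1])
  have cl: "((\<lambda>x. low_polylog (Suc (Suc m)) (of_real x)) \<longlongrightarrow> c) (at_left 1)"
    by (rule filterlim_compose[OF c lim])
  have "low_polylog (Suc (Suc m)) (of_real x) \<in> \<real>" if "x < 1" for x
    using polylog_cnj[of "of_real x" "Suc m"] polylog_eq_low_polylog[of "of_real x" "Suc m"] that
    by (simp add: Reals_cnj_iff)
  then have "eventually (\<lambda>x. low_polylog (Suc (Suc m)) (of_real x) \<in> \<real>) (at_left 1)"
    unfolding eventually_at by (intro exI[of _ 1]) auto
  then have "c \<in> \<real>" using Lim_in_closed_set[OF closed_complex_Reals _ _ cl] by simp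
  with c show ?thesis by (rule that[rotated])
qed

text \<open>This is the continuation from above minus the continuation from below. By induction both
  sides have the same derivative on the half-plane Re z > 1. The constant is read off at 2 for
  weight 1, and for higher weights from the limit at 1, where the jump and Ln vanish.\<close>

lemma low_polylog_jump:
  assumes "Re z > 1"
  shows "cnj (low_polylog (Suc m) (cnj z)) - low_polylog (Suc m) z = 2 * pi * \<i> * (Ln z ^ m / fact m)"
  using assms
proof (induction m arbitrary: z)
  case 0
  define U where "U = {z. Re z > 1}"
  have U: "z \<in> low_dom \<and> cnj z \<in> low_dom \<and> z \<noteq> 0" if "z \<in> U" for z using that by (auto simp: U_def low_dom_def)
  define d where "d = (\<lambda>z. (cnj \<circ> low_log \<circ> cnj) z - low_log z)"
  have "(d has_field_derivative 0) (at z within U)" if "z \<in> U" for z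
  proof -
    have "(d has_field_derivative (cnj (1 / (1 - cnj z)) - 1 / (1 - z))) (at z)"
      unfolding d_def by (intro DERIV_diff has_field_derivative_cnj_cnj low_log_deriv) (use U that in auto)
    then show ?thesis by (simp add: has_field_derivative_at_within)
  qed
  then obtain c where c: "\<And>z. z \<in> U \<Longrightarrow> d z = c"
    using has_field_derivative_zero_constant[of U d] unfolding U_def by (metis convex_halfspace_Re_gt)
  have "d 2 = 2 * pi * \<i>" by (simp add: d_def low_log_def)
  with c[of 2] c[of z] 0 show ?case by (simp add: d_def U_def)
next
  case (Suc m)
  define U where "U = {z. Re z > 1}"
  have U: "z \<in> low_dom \<and> cnj z \<in> low_dom \<and> z \<noteq> 0 \<and> z \<notin> \<real>\<^sub>\<le>\<^sub>0" if "z \<in> U" for z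
    using that by (auto simp: U_def low_dom_def complex_nonpos_Reals_iff)
  define f where "f = low_polylog (Suc (Suc m))"
  define d where "d = (\<lambda>z. (cnj \<circ> f \<circ> cnj) z - f z - 2 * pi * \<i> * (Ln z ^ Suc m / fact (Suc m)))"
  have "(d has_field_derivative 0) (at z within U)" if "z \<in> U" for z
  proof -
    have 1: "((\<lambda>z. Ln z ^ Suc m / fact (Suc m)) has_field_derivative (Ln z ^ m / fact m) / z) (at z)"
    proof -
      have "((\<lambda>z. Ln z ^ Suc m) has_field_derivative of_nat (Suc m) * Ln z ^ m * (1 / z)) (at z)"
        using U[OF that] by (auto intro!: derivative_eq_intros simp: divide_inverse mult_ac simp del: power_Suc of_nat_Suc)
      from DERIV_cdivide[OF this, of "fact (Suc m)"] show ?thesis by (simp add: field_simps del: power_Suc of_nat_Suc)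
    qed
    have "(d has_field_derivative (cnj (low_polylog (Suc m) (cnj z) / cnj z) - low_polylog (Suc m) z / z
              - 2 * pi * \<i> * ((Ln z ^ m / fact m) / z))) (at z)"
      unfolding d_def f_def
      by (intro DERIV_diff has_field_derivative_cnj_cnj low_polylog_deriv DERIV_cmult 1) (use U that in auto)
    also have "(cnj (low_polylog (Suc m) (cnj z) / cnj z) - low_polylog (Suc m) z / z
              - 2 * pi * \<i> * ((Ln z ^ m / fact m) / z)) 
          = (cnj (low_polylog (Suc m) (cnj z)) - low_polylog (Suc m) z - 2 * pi * \<i> * (Ln z ^ m / fact m)) / z"
      by (simp add: diff_divide_distrib)
    also have "\<dots> = 0" using Suc.IH[of z] that by (simp add: U_def)
    finally show ?thesis by (rule has_field_derivative_at_within)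
  qed
  then obtain C where C: "\<And>z. z \<in> U \<Longrightarrow> d z = C"
    using has_field_derivative_zero_constant[of U d] unfolding U_def by (metis convex_halfspace_Re_gt)
  obtain c where c: "c \<in> \<real>" "(f \<longlongrightarrow> c) (at 1 within {z. Im z \<le> 0})"
    unfolding f_def by (rule low_polylog_limit_1_real)
  have lim: "filterlim complex_of_real (at 1 within {z. Im z \<le> 0}) (at_right 1)"
    unfolding filterlim_at by (auto simp: eventually_at intro!: tendsto_eq_intros exI[of _ 1])
  have fl: "((\<lambda>x. f (of_real x)) \<longlongrightarrow> c) (at_right 1)" by (rule filterlim_compose[OF c(2) lim])
  have Ln: "((\<lambda>x. Ln (complex_of_real x)) \<longlongrightarrow> Ln 1) (at_right 1)"
    by (rule tendsto_Ln) (auto intro!: tendsto_eq_intros)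
  have "((\<lambda>x. d (of_real x)) \<longlongrightarrow> cnj c - c - 2 * pi * \<i> * (Ln 1 ^ Suc m / fact (Suc m))) (at_right 1)"
    unfolding d_def o_def complex_cnj_complex_of_real
    by (intro tendsto_intros fl Ln) (simp_all del: fact_Suc)
  moreover have "((\<lambda>x. d (of_real x)) \<longlongrightarrow> C) (at_right 1)"
    by (rule Lim_transform_within[OF tendsto_const, of 1]) (use C in \<open>auto simp: U_def\<close>)
  ultimately have "C = cnj c - c - 2 * pi * \<i> * (Ln 1 ^ Suc m / fact (Suc m))"
    by (intro tendsto_unique[of "at_right (1::real)"]) auto
  also have "\<dots> = 0" using c(1) by (simp add: Reals_cnj_iff)
  finally have "d z = 0" using C[of z] Suc.prems by (simp add: U_def)
  then show ?case by (simp add: d_def f_def)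
qed

text \<open>The two families differ only where Im z > 0 and Re z > 1. There \<open>polylog\<close>
  is the continuation from above, and the sum of the jumps is removed by
  \<open>Re_Im_bern_exp\<close> with w = Ln z. Thus P_m is smooth across the half-line z >
  1.\<close>

lemma P_fun_eq_low_polylog:
  assumes "z \<in> low_dom" "z \<noteq> 0"
  shows "P_fun m z = Re_Im m (log_comb low_polylog m z)"
proof (cases "Im z \<le> 0 \<or> Re z < 1")
  case True
  have "log_comb polylog m z = log_comb low_polylog m z"
    unfolding log_comb_def
  proof (intro sum.cong refl)
    fix k assume "k \<in> {..<m}"
    then obtain j where "m - k = Suc j" by (metis Suc_diff_Suc lessThan_iff)
    moreover have "z \<noteq> 1" using assms by (auto simp: low_dom_def)
    ultimately show "of_real (bern_coeff k * ln (norm z) ^ k) * polylog (m - k) z = of_real (bern_coeff k * ln (norm z) ^ k) * low_polylog (m - k) z"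
      using polylog_eq_low_polylog[OF True] by simp
  qed
  then show ?thesis using P_fun_log_comb assms by simp
next
  case False
  then have z: "Im z > 0" "Re z > 1" using assms by (auto simp: low_dom_def)
  have Re_Ln: "Re (Ln z) = ln (norm z)" using assms by simp
  have "log_comb polylog m z = log_comb low_polylog m z
      + 2 * pi * \<i> * (\<Sum>k<m. of_real (bern_coeff k * Re (Ln z) ^ k) * (Ln z ^ (m - 1 - k) / fact (m - 1 - k)))"
    unfolding log_comb_def sum_distrib_left sum.distrib[symmetric] Re_Ln
  proof (intro sum.cong refl)
    fix k assume "k \<in> {..<m}"
    then obtain j where j: "m - k = Suc j" by (metis Suc_diff_Suc lessThan_iff)
    then have j': "m - 1 - k = j" by simp
    have "polylog (Suc j) z = low_polylog (Suc j) z + 2 * pi * \<i> * (Ln z ^ j / fact j)"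
      using polylog_eq_cnj_low_polylog[OF z(1), of j] low_polylog_jump[OF z(2), of j] by (simp add: algebra_simps)
    then show "of_real (bern_coeff k * ln (norm z) ^ k) * polylog (m - k) z
      = of_real (bern_coeff k * ln (norm z) ^ k) * low_polylog (m - k) z
       + 2 * pi * \<i> * (of_real (bern_coeff k * ln (norm z) ^ k) * (Ln z ^ (m - 1 - k) / fact (m - 1 - k)))"
      unfolding j j' by (simp add: algebra_simps)
  qed
  then show ?thesis using P_fun_log_comb assms Re_Im_bern_exp[of m "Ln z"] by simp
qed

text \<open>Covers the points of the ray from 1 upwards that \<open>low_dom\<close> leaves
  out.\<close>

lemma P_fun_eq_cnj_low_polylog:
  assumes "Im z > 0"
  shows "P_fun m z = Re_Im m (log_comb (\<lambda>k. cnj \<circ> low_polylog k \<circ> cnj) m z)"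
proof -
  have "log_comb polylog m z = log_comb (\<lambda>k. cnj \<circ> low_polylog k \<circ> cnj) m z"
    unfolding log_comb_def
  proof (intro sum.cong refl)
    fix k assume "k \<in> {..<m}"
    then obtain j where "m - k = Suc j" by (metis Suc_diff_Suc lessThan_iff)
    then show "of_real (bern_coeff k * ln (norm z) ^ k) * polylog (m - k) z = of_real (bern_coeff k * ln (norm z) ^ k) * (cnj \<circ> low_polylog (m - k) \<circ> cnj) z"
      using polylog_eq_cnj_low_polylog[OF assms] by simp
  qed
  moreover have "z \<noteq> 0" using assms by auto
  ultimately show ?thesis using P_fun_log_comb by simp
qed

text \<open>Every point other than 0 and 1 has a neighbourhood on which P_m is formed from one
  holomorphic family: \<open>low_dom\<close> without 0, or the upper half-plane with the reflected
  family.\<close>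

theorem P_fun_has_derivative:
  fixes \<gamma> :: "real \<Rightarrow> complex"
  assumes \<gamma>: "(\<gamma> has_vector_derivative w) (at y)" and z: "z = \<gamma> y" "z \<noteq> 0" "z \<noteq> 1" and m: "m \<ge> 1"
  shows "((\<lambda>t. P_fun m (\<gamma> t)) has_real_derivative
     (if odd m then -1 else 1) * Im (w / z) * P_fun (m - 1) z
     - (\<Sum>j=2..m-1. bern_coeff j * ln (norm z) ^ (j - 1) * Re (w / z) * P_fun (m - j) z)
     + bern_coeff (m - 1) * ln (norm z) ^ (m - 1) * Re_Im m (w / (1 - z))) (at y)" (is "(_ has_real_derivative ?D) _")
proof -
  have local: ?thesis
    if U: "open U" "z \<in> U" "\<And>x k. x \<in> U \<Longrightarrow> P_fun k x = Re_Im k (log_comb L k x)"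
      and L: "(L 1 has_field_derivative 1 / (1 - z)) (at z)"
        "\<And>k. k \<ge> 1 \<Longrightarrow> (L (Suc k) has_field_derivative L k z / z) (at z)" for U L
  proof -
    have "isCont \<gamma> y" using \<gamma> by (rule has_vector_derivative_continuous)
    then have "eventually (\<lambda>t. \<gamma> t \<in> U) (nhds y)"
      using U(1,2) z(1) unfolding isCont_def by (metis eventually_nhds_conv_at topological_tendstoD)
    then have "eventually (\<lambda>t. P_fun m (\<gamma> t) = Re_Im m (log_comb L m (\<gamma> t))) (nhds y)"
      by eventually_elim (rule U(3))
    then show ?thesis
      using Re_Im_log_comb_has_derivative[OF \<gamma> z(1,2) L m] unfolding U(3)[OF U(2), symmetric]
      by (subst DERIV_cong_ev[OF refl _ refl]) auto
  qed
  show ?thesis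
  proof (cases "z \<in> low_dom")
    case True
    have "(low_polylog (Suc k) has_field_derivative low_polylog k z / z) (at z)" if "k \<ge> 1" for k
      using low_polylog_deriv[OF True z(2), of "k - 1"] that by simp
    moreover have "open (low_dom - {0})" using open_low_dom by (intro open_Diff) auto
    ultimately show ?thesis
      using True z low_log_deriv[OF True] by (intro local[of "low_dom - {0}" low_polylog]) (auto simp: P_fun_eq_low_polylog)
  next
    case False
    with z have im: "Im z > 0" by (auto simp: low_dom_def complex_eq_iff)
    have dom: "cnj z \<in> low_dom" "cnj z \<noteq> 0" using im by (auto simp: low_dom_def)
    show ?thesis
    proof (rule local[of "{x. Im x > 0}" "\<lambda>k. cnj \<circ> low_polylog k \<circ> cnj"])
      show "open {x. Im x > 0}" by (rule open_halfspace_Im_gt)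
      show "(cnj \<circ> low_polylog 1 \<circ> cnj has_field_derivative 1 / (1 - z)) (at z)"
        using has_field_derivative_cnj_cnj[OF low_log_deriv[OF dom(1)]] by simp
      fix k :: nat assume "k \<ge> 1"
      then show "(cnj \<circ> low_polylog (Suc k) \<circ> cnj has_field_derivative (cnj \<circ> low_polylog k \<circ> cnj) z / z) (at z)"
        using has_field_derivative_cnj_cnj[OF low_polylog_deriv[OF dom, of "k - 1"]] by simp
    qed (use im in \<open>auto simp: P_fun_eq_cnj_low_polylog\<close>)
  qed
qed

subsection \<open>Logarithmic derivatives of modular units\<close>

no_notation fps_nth (infixl \<open>$\<close> 75)

section \<open>The action of integral matrices of determinant 1 on the upper half-plane\<close>

definition mat22 :: "int \<Rightarrow> int \<Rightarrow> int \<Rightarrow> int \<Rightarrow> int ^ 2 ^ 2" where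
  "mat22 a b c d = vector [vector [a, b], vector [c, d]]"

lemma mat22_entries [simp]:
  "mat22 a b c d $ 1 $ 1 = a" "mat22 a b c d $ 1 $ 2 = b" "mat22 a b c d $ 2 $ 1 = c" "mat22 a b c d $ 2 $ 2 = d"
  by (simp_all add: mat22_def)

lemma mat22_mult_entries:
  fixes A B :: "int ^ 2 ^ 2"
  shows "(A ** B) $ i $ j = A $ i $ 1 * B $ 1 $ j + A $ i $ 2 * B $ 2 $ j"
  by (simp add: matrix_matrix_mult_def sum_2)

lemma SL2Z_iff: "A \<in> SL2Z \<longleftrightarrow> A $ 1 $ 1 * A $ 2 $ 2 - A $ 1 $ 2 * A $ 2 $ 1 = 1"
  by (simp add: SL2Z_def det_2)

lemma SL2Z_mult: "A \<in> SL2Z \<Longrightarrow> B \<in> SL2Z \<Longrightarrow> A ** B \<in> SL2Z"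
  by (simp add: SL2Z_def det_mul)

lemma SL2Z_adj: "A \<in> SL2Z \<Longrightarrow> mat22 (A $ 2 $ 2) (- A $ 1 $ 2) (- A $ 2 $ 1) (A $ 1 $ 1) \<in> SL2Z"
  by (simp add: SL2Z_iff algebra_simps)

lemma mat22_eq_iff:
  fixes A B :: "int ^ 2 ^ 2"
  shows "A = B \<longleftrightarrow> A $ 1 $ 1 = B $ 1 $ 1 \<and> A $ 1 $ 2 = B $ 1 $ 2 \<and> A $ 2 $ 1 = B $ 2 $ 1 \<and> A $ 2 $ 2 = B $ 2 $ 2"
  by (auto simp: vec_eq_iff forall_2)

lemma adj_mult:
  assumes "A \<in> SL2Z"
  shows "mat22 (A $ 2 $ 2) (- A $ 1 $ 2) (- A $ 2 $ 1) (A $ 1 $ 1) ** A = mat 1"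
  using assms by (simp add: SL2Z_iff mat22_eq_iff mat22_mult_entries mat_def algebra_simps)

lemma mult_adj:
  assumes "A \<in> SL2Z"
  shows "A ** mat22 (A $ 2 $ 2) (- A $ 1 $ 2) (- A $ 2 $ 1) (A $ 1 $ 1) = mat 1"
  using assms by (simp add: SL2Z_iff mat22_eq_iff mat22_mult_entries mat_def algebra_simps)

lemma mobius_denom_nonzero:
  assumes "A \<in> SL2Z" "\<tau> \<in> upper_half"
  shows "of_int (A $ 2 $ 1) * \<tau> + of_int (A $ 2 $ 2) \<noteq> 0"
proof
  assume eq: "of_int (A $ 2 $ 1) * \<tau> + of_int (A $ 2 $ 2) = 0"
  then have "Im (of_int (A $ 2 $ 1) * \<tau> + of_int (A $ 2 $ 2)) = 0" by simp
  then have "A $ 2 $ 1 = 0" using assms(2) by (simp add: upper_half_def)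
  with eq have "A $ 2 $ 2 = 0" by simp
  with \<open>A $ 2 $ 1 = 0\<close> assms(1) show False by (simp add: SL2Z_iff)
qed

lemma mobius_mult:
  assumes "B \<in> SL2Z" "\<tau> \<in> upper_half"
  shows "mobius (A ** B) \<tau> = mobius A (mobius B \<tau>)"
proof -
  define n where "n = of_int (B $ 1 $ 1) * \<tau> + of_int (B $ 1 $ 2)"
  define d where "d = of_int (B $ 2 $ 1) * \<tau> + of_int (B $ 2 $ 2)"
  have d: "d \<noteq> 0" unfolding d_def by (rule mobius_denom_nonzero[OF assms])
  have "mobius A (mobius B \<tau>) = ((of_int (A $ 1 $ 1) * (n / d) + of_int (A $ 1 $ 2)) * d) / ((of_int (A $ 2 $ 1) * (n / d) + of_int (A $ 2 $ 2)) * d)"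
    using d by (simp add: mobius_def n_def [symmetric] d_def [symmetric])
  also have "\<dots> = (of_int (A $ 1 $ 1) * n + of_int (A $ 1 $ 2) * d) / (of_int (A $ 2 $ 1) * n + of_int (A $ 2 $ 2) * d)"
    using d by (simp add: distrib_right)
  also have "\<dots> = mobius (A ** B) \<tau>"
    by (simp add: mobius_def mat22_mult_entries n_def d_def algebra_simps)
  finally show ?thesis ..
qed

lemma Im_mobius:
  assumes "A \<in> SL2Z"
  shows "Im (mobius A \<tau>) = Im \<tau> / (norm (of_int (A $ 2 $ 1) * \<tau> + of_int (A $ 2 $ 2)))\<^sup>2"
proof -
  define a b c d where "a = real_of_int (A $ 1 $ 1)" and "b = real_of_int (A $ 1 $ 2)"
    and "c = real_of_int (A $ 2 $ 1)" and "d = real_of_int (A $ 2 $ 2)"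
  have det: "a * d - b * c = 1"
    using arg_cong[OF assms[unfolded SL2Z_iff], of real_of_int] by (simp add: a_def b_def c_def d_def)
  have "Im (mobius A \<tau>) = (a * Im \<tau> * (c * Re \<tau> + d) - (a * Re \<tau> + b) * (c * Im \<tau>)) / ((c * Re \<tau> + d)\<^sup>2 + (c * Im \<tau>)\<^sup>2)"
    by (simp add: mobius_def Im_divide a_def b_def c_def d_def)
  also have "a * Im \<tau> * (c * Re \<tau> + d) - (a * Re \<tau> + b) * (c * Im \<tau>) = (a * d - b * c) * Im \<tau>"
    by (simp add: algebra_simps)
  also have "\<dots> = Im \<tau>" using det by simp
  also have "(c * Re \<tau> + d)\<^sup>2 + (c * Im \<tau>)\<^sup>2 = (norm (of_int (A $ 2 $ 1) * \<tau> + of_int (A $ 2 $ 2)))\<^sup>2"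
    by (simp add: cmod_power2 c_def d_def)
  finally show ?thesis .
qed

lemma mobius_upper_half:
  assumes "A \<in> SL2Z" "\<tau> \<in> upper_half"
  shows "mobius A \<tau> \<in> upper_half"
  using mobius_denom_nonzero[OF assms] Im_mobius[OF assms(1), of \<tau>] assms(2) by (simp add: upper_half_def)

lemma mobius_deriv:
  assumes "A \<in> SL2Z" "\<tau> \<in> upper_half"
  shows "(mobius A has_field_derivative 1 / (of_int (A $ 2 $ 1) * \<tau> + of_int (A $ 2 $ 2)) ^ 2) (at \<tau>)"
proof -
  define a b c d where "a = complex_of_int (A $ 1 $ 1)" and "b = complex_of_int (A $ 1 $ 2)"
    and "c = complex_of_int (A $ 2 $ 1)" and "d = complex_of_int (A $ 2 $ 2)"
  have det: "a * d - b * c = 1"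
    using arg_cong[OF assms(1)[unfolded SL2Z_iff], of complex_of_int] by (simp add: a_def b_def c_def d_def)
  have nz: "c * \<tau> + d \<noteq> 0" unfolding c_def d_def by (rule mobius_denom_nonzero[OF assms])
  have "((\<lambda>\<tau>. (a * \<tau> + b) / (c * \<tau> + d)) has_field_derivative (a * (c * \<tau> + d) - (a * \<tau> + b) * c) / ((c * \<tau> + d) * (c * \<tau> + d))) (at \<tau>)"
    by (rule DERIV_divide) (use nz in \<open>auto intro!: derivative_eq_intros\<close>)
  also have "a * (c * \<tau> + d) - (a * \<tau> + b) * c = 1" using det by (simp add: algebra_simps)
  finally show ?thesis by (simp add: mobius_def [abs_def] a_def b_def c_def d_def power2_eq_square)
qed

lemma open_upper_half: "open upper_half"
  unfolding upper_half_def by (rule open_halfspace_Im_gt)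

lemma convex_upper_half: "convex upper_half"
  unfolding upper_half_def by (rule convex_halfspace_Im_gt)

text \<open>Choosing \<open>(c, d)\<close> with \<open>c \<tau> + d\<close> small by Dirichlet's approximation theorem replaces the
  reduction to a fundamental domain.\<close>

lemma SL2Z_reduction:
  assumes "0 < Im \<tau>" "Im \<tau> \<le> 1"
  obtains M where "M \<in> SL2Z" "Im (mobius M \<tau>) \<ge> 1 / 5" "Im (mobius M \<tau>) \<le> 1 / Im \<tau>"
proof -
  define y where "y = Im \<tau>"
  have y: "0 < y" "y \<le> 1" using assms by (auto simp: y_def)
  \<comment> \<open>With K about 1 / sqrt y, both k Re \<tau> - h and k y are of order sqrt y. Hence
    |k \<tau> - h|^2 is of order y and the imaginary part of the image is bounded below.\<close>
  define K where "K = nat \<lceil>1 / sqrt y\<rceil>"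
  have K1: "1 / sqrt y \<le> real K" using y by (simp add: K_def of_nat_ceiling)
  have "0 \<le> 1 / sqrt y" using y by simp
  then have K2: "real K \<le> 1 / sqrt y + 1" unfolding K_def by linarith
  have "0 < 1 / sqrt y" using y by simp
  then have "K > 0" using K1 by (metis gr0I less_le_not_le of_nat_0 order_trans)
  obtain h k where hk: "coprime h k" "0 < k" "k \<le> int K" "\<bar>of_int k * Re \<tau> - of_int h\<bar> < 1 / real K"
    using Dirichlet_approx_coprime[OF \<open>K > 0\<close>, of "Re \<tau>"] by blast
  obtain a b where ab: "a * h + b * k = 1" using bezout_int[of h k] hk(1) by auto
  define M where "M = mat22 (- a) (- b) k (- h)"
  have M: "M \<in> SL2Z" using ab by (simp add: SL2Z_iff M_def algebra_simps)
  define D where "D = (of_int k * Re \<tau> - of_int h)\<^sup>2 + (of_int k * y)\<^sup>2"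
  have Im: "Im (mobius M \<tau>) = y / D"
    unfolding Im_mobius[OF M] by (simp add: M_def D_def y_def cmod_power2)
  have k1: "1 \<le> real_of_int k" using hk by simp
  have "1 / real K \<le> sqrt y"
    using K1 y \<open>K > 0\<close> by (simp add: field_simps)
  then have "\<bar>of_int k * Re \<tau> - of_int h\<bar> \<le> sqrt y" using hk by linarith
  then have "(of_int k * Re \<tau> - of_int h)\<^sup>2 \<le> (sqrt y)\<^sup>2" using y by (intro abs_le_square_iff[THEN iffD1]) simp
  then have 1: "(of_int k * Re \<tau> - of_int h)\<^sup>2 \<le> y" using y by simp
  have "real_of_int k \<le> real K" using hk by linarith
  then have "real_of_int k * y \<le> (1 / sqrt y + 1) * y" using K2 y by (intro mult_right_mono) auto
  also have "\<dots> = y / sqrt y + y" by (simp add: distrib_right)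
  finally have "real_of_int k * y \<le> sqrt y + y" using y by (simp add: real_div_sqrt)
  moreover have "y \<le> sqrt y" using y by (simp add: real_le_rsqrt power2_eq_square mult_left_le)
  ultimately have "real_of_int k * y \<le> 2 * sqrt y" by linarith
  then have "(real_of_int k * y)\<^sup>2 \<le> (2 * sqrt y)\<^sup>2" using k1 y by (intro power_mono) auto
  then have 2: "(real_of_int k * y)\<^sup>2 \<le> 4 * y" using y by (simp add: power_mult_distrib)
  have "(1 * y)\<^sup>2 \<le> (real_of_int k * y)\<^sup>2" using k1 y by (intro power_mono mult_right_mono) auto
  then have D1: "y\<^sup>2 \<le> D"
    using zero_le_power2[of "of_int k * Re \<tau> - of_int h"] unfolding D_def mult_1 by linarith
  \<comment> \<open>The constant 5 is 1 + 4, from the two squares in \<open>D\<close>; the upper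
    bound for the imaginary part comes from \<open>D1\<close>, that is, from k \<ge> 1.\<close>
  have D: "D \<le> 5 * y" "0 < D" using 1 2 y D1 zero_less_power[of y 2] unfolding D_def by linarith+
  have "1 / 5 \<le> y / D" using D y by (simp add: field_simps)
  moreover have "y / D \<le> 1 / y" using D D1 y by (simp add: field_simps power2_eq_square)
  ultimately show ?thesis using that[OF M] by (simp add: Im y_def)
qed

section \<open>Logarithmic derivatives at the cusp \<open>A\<close> infinity and their expansions in
  q\<close>

definition log_deriv :: "(complex \<Rightarrow> complex) \<Rightarrow> int ^ 2 ^ 2 \<Rightarrow> complex \<Rightarrow> complex" where
  "log_deriv f A \<tau> = deriv (\<lambda>\<tau>. f (mobius A \<tau>)) \<tau> / f (mobius A \<tau>)"

definition nome :: "nat \<Rightarrow> complex \<Rightarrow> complex" where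
  "nome N \<tau> = exp (2 * of_real pi * \<i> * \<tau> / of_nat N)"

lemma norm_nome: "norm (nome N \<tau>) = exp (- (2 * pi * Im \<tau> / real N))"
  by (simp add: nome_def)

text \<open>Near the cusp \<open>h(q) = q\<^sup>k p(q)\<close> with \<open>p(0) \<noteq> 0\<close>, so that the logarithmic derivative is a multiple of
  \<open>k + q p'(q) / p(q)\<close>, without a pole at \<open>q = 0\<close>. As a function of \<open>q\<close> it is periodic near the cusp, hence by
  analytic continuation everywhere.\<close>

lemma log_deriv_q_expansion:
  fixes g h :: "complex \<Rightarrow> complex"
  assumes N: "N > 0"
    and g: "g holomorphic_on upper_half" "\<And>\<tau>. \<tau> \<in> upper_half \<Longrightarrow> g \<tau> \<noteq> 0"
    and h: "h meromorphic_on {0}" "\<And>\<tau>. Im \<tau> > Y \<Longrightarrow> \<tau> \<in> upper_half \<Longrightarrow> g \<tau> = h (nome N \<tau>)"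
  obtains H where "H holomorphic_on ball 0 1" "\<And>\<tau>. \<tau> \<in> upper_half \<Longrightarrow> deriv g \<tau> / g \<tau> = H (nome N \<tau>)"
proof -
  define G where "G = (\<lambda>\<tau>. deriv g \<tau> / g \<tau>)"
  define c where "c = 2 * of_real pi * \<i> / of_nat N"
  have c: "c \<noteq> 0" using N by (simp add: c_def)
  have nome: "nome N \<tau> = exp (c * \<tau>)" for \<tau> by (simp add: nome_def c_def)
  have Gh: "G holomorphic_on upper_half"
    unfolding G_def using g by (intro holomorphic_intros holomorphic_deriv open_upper_half) auto
  define \<rho> where "\<rho> = exp (- (2 * pi * max Y 0 / real N))"
  have \<rho>: "0 < \<rho>" "\<rho> \<le> 1" using N by (auto simp: \<rho>_def)
  have Im_big: "Im \<tau> > Y \<and> \<tau> \<in> upper_half" if "norm (nome N \<tau>) < \<rho>" for \<tau>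
  proof -
    have "max Y 0 < Im \<tau>" using that N unfolding norm_nome \<rho>_def by (simp add: divide_less_cancel)
    then show ?thesis by (auto simp: upper_half_def)
  qed
  define inv where "inv = (\<lambda>q. Ln q / c)"
  have nome_inv: "nome N (inv q) = q" if "q \<noteq> 0" for q using that c by (simp add: nome inv_def)
  have h_nz: "h q \<noteq> 0" if "q \<noteq> 0" "norm q < \<rho>" for q
    using Im_big[of "inv q"] h(2)[of "inv q"] g(2)[of "inv q"] nome_inv[OF that(1)] that by auto
  have "isolated_singularity_at h 0" "not_essential h 0"
    using h(1) by (auto intro: meromorphic_on_isolated_singularity meromorphic_on_not_essential)
  moreover have "eventually (\<lambda>q. h q \<noteq> 0) (at 0)"
    unfolding eventually_at using h_nz \<rho> by (intro exI[of _ \<rho>]) auto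
  then have "frequently (\<lambda>q. h q \<noteq> 0) (at 0)" by (rule eventually_frequently[rotated]) simp
  ultimately obtain p r where p0: "p 0 \<noteq> 0" and r: "r > 0" and p: "p holomorphic_on cball 0 r"
     "\<And>q. q \<in> cball 0 r - {0} \<Longrightarrow> h q = p q * q powi zorder h 0 \<and> p q \<noteq> 0"
    using zorder_exist[of h 0] by (auto simp: ball_simps)
  define k where "k = zorder h 0"
  define r' where "r' = min r \<rho>"
  have r': "r' > 0" "r' \<le> 1" "r' \<le> r" "r' \<le> \<rho>" using r \<rho> by (auto simp: r'_def)
  have pnz: "p q \<noteq> 0" if "q \<in> ball 0 r'" for q using p(2)[of q] p0 that r' by (cases "q = 0") auto
  have ph: "p holomorphic_on ball 0 r'" by (rule holomorphic_on_subset[OF p(1)]) (use r' in auto)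
  define R where "R = (\<lambda>q. c * (of_int k + q * (deriv p q / p q)))"
  have Rh: "R holomorphic_on ball 0 r'"
    unfolding R_def using ph pnz by (intro holomorphic_intros holomorphic_deriv) auto
  have GR: "G \<tau> = R (nome N \<tau>)" if \<tau>: "norm (nome N \<tau>) < r'" for \<tau>
  proof -
    define S where "S = {\<tau>. norm (nome N \<tau>) < r'}"
    have "open S" unfolding S_def norm_nome by (intro open_Collect_less continuous_intros) (use N in auto)
    have gS: "g t = p (exp (c * t)) * exp (c * t) powi k" if "t \<in> S" for t
    proof -
      have "norm (nome N t) < \<rho>" "nome N t \<in> cball 0 r - {0}" using that r' by (auto simp: S_def nome)
      then show ?thesis using Im_big h(2) p(2) unfolding k_def by (metis nome)
    qed
    define q where "q = exp (c * \<tau>)"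
    have q: "q \<noteq> 0" "q \<in> ball 0 r'" using \<tau> by (auto simp: q_def nome)
    have "((\<lambda>t. p (exp (c * t))) has_field_derivative deriv p q * (q * c)) (at \<tau>)"
    proof -
      have "(p has_field_derivative deriv p q) (at q)" using ph q by (intro holomorphic_derivI) auto
      moreover have "((\<lambda>t. exp (c * t)) has_field_derivative q * c) (at \<tau>)"
        by (auto intro!: derivative_eq_intros simp: q_def)
      ultimately show ?thesis using DERIV_chain2[of p "deriv p q" "\<lambda>t. exp (c * t)"] by (simp add: q_def)
    qed
    moreover have "((\<lambda>t. exp (c * t) powi k) has_field_derivative of_int k * c * q powi k) (at \<tau>)"
    proof -
      have "((\<lambda>t. exp (of_int k * (c * t))) has_field_derivative of_int k * c * exp (of_int k * (c * \<tau>))) (at \<tau>)"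
        by (auto intro!: derivative_eq_intros)
      then show ?thesis by (simp add: exp_power_int q_def mult.commute)
    qed
    ultimately have "((\<lambda>t. p (exp (c * t)) * exp (c * t) powi k) has_field_derivative
        deriv p q * (q * c) * (q powi k) + of_int k * c * q powi k * p q) (at \<tau>)"
      unfolding q_def by (rule DERIV_mult)
    then have "(g has_field_derivative deriv p q * (q * c) * (q powi k) + of_int k * c * q powi k * p q) (at \<tau>)"
      by (rule has_field_derivative_transform_within_open[OF _ \<open>open S\<close>]) (use gS \<tau> in \<open>auto simp: S_def\<close>)
    then have "deriv g \<tau> = deriv p q * (q * c) * (q powi k) + of_int k * c * q powi k * p q" by (rule DERIV_imp_deriv)
    moreover have "g \<tau> = p q * q powi k" using gS[of \<tau>] \<tau> by (simp add: S_def q_def)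
    moreover have "nome N \<tau> = q" by (simp add: nome q_def)
    ultimately show ?thesis using pnz[OF q(2)] q(1)
      by (simp add: G_def R_def field_simps)
  qed
  have per1: "G (\<tau> + of_nat N) = G \<tau>" if \<tau>: "\<tau> \<in> upper_half" for \<tau>
  proof (rule analytic_continuation_open[of "{\<tau>. norm (nome N \<tau>) < r'}" upper_half "\<lambda>\<tau>. G (\<tau> + of_nat N)" G \<tau>])
    show "open {\<tau>. norm (nome N \<tau>) < r'}"
      unfolding norm_nome by (intro open_Collect_less continuous_intros) (use N in auto)
    have "nome N (inv (of_real (r' / 2))) = of_real (r' / 2)" using r' by (intro nome_inv) auto
    then have "norm (nome N (inv (of_real (r' / 2)))) < r'" using r' by (simp only: norm_of_real)
    then show "{\<tau>. norm (nome N \<tau>) < r'} \<noteq> {}" by blast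
    show "connected upper_half" by (intro convex_connected convex_upper_half)
    show "{\<tau>. norm (nome N \<tau>) < r'} \<subseteq> upper_half"
    proof
      fix t assume "t \<in> {\<tau>. norm (nome N \<tau>) < r'}"
      then have "norm (nome N t) < \<rho>" using r' by simp
      then show "t \<in> upper_half" using Im_big by blast
    qed
    show "(\<lambda>\<tau>. G (\<tau> + of_nat N)) holomorphic_on upper_half"
      by (rule holomorphic_on_compose_gen[of "\<lambda>\<tau>. \<tau> + of_nat N", OF _ Gh, unfolded o_def])
         (auto simp: upper_half_def intro!: holomorphic_intros)
    fix t assume t: "t \<in> {\<tau>. norm (nome N \<tau>) < r'}"
    have "nome N (t + of_nat N) = nome N t"
      using N by (simp add: nome_def ring_distribs add_divide_distrib exp_add)
    then show "G (t + of_nat N) = G t" using GR[of t] GR[of "t + of_nat N"] t by simp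
  qed (use open_upper_half Gh \<tau> in auto)
  have per_nat: "G (\<tau> + of_nat m * of_nat N) = G \<tau>" if "\<tau> \<in> upper_half" for \<tau> m
  proof (induction m)
    case (Suc m)
    have "\<tau> + of_nat m * of_nat N \<in> upper_half" using that by (simp add: upper_half_def)
    from per1[OF this] Suc show ?case by (simp add: algebra_simps)
  qed simp
  have per: "G \<tau> = G \<sigma>" if eq: "nome N \<tau> = nome N \<sigma>" and \<tau>: "\<tau> \<in> upper_half" and \<sigma>: "\<sigma> \<in> upper_half" for \<tau> \<sigma>
  proof -
    obtain m where "c * \<tau> = c * \<sigma> + of_real (of_int (2 * m) * pi) * \<i>"
      using eq unfolding nome exp_eq by blast
    then have "c * \<tau> = c * (\<sigma> + of_int m * of_nat N)" using N by (simp add: c_def field_simps)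
    then have m: "\<tau> = \<sigma> + of_int m * of_nat N" using c by simp
    show ?thesis
    proof (cases "m \<ge> 0")
      case True
      then have "(of_int m :: complex) = of_nat (nat m)" by simp
      then show ?thesis unfolding m using per_nat[OF \<sigma>, of "nat m"] by simp
    next
      case False
      then have "(of_int m :: complex) = - of_nat (nat (- m))" by simp
      then have "\<sigma> = \<tau> + of_nat (nat (- m)) * of_nat N" using m by simp
      then show ?thesis using per_nat[OF \<tau>, of "nat (- m)"] by simp
    qed
  qed
  \<comment> \<open>Near 0 the regular formula \<open>R\<close> fills in the value at the cusp;
    elsewhere any logarithm of q will do, by periodicity.\<close>
  define H where "H = (\<lambda>q. if norm q < r' then R q else G (inv q))"
  have disc: "\<tau> \<in> upper_half \<longleftrightarrow> norm (nome N \<tau>) < 1" for \<tau>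
    using N by (simp add: norm_nome upper_half_def field_simps zero_less_mult_iff)
  have GH: "G \<tau> = H (nome N \<tau>)" if "\<tau> \<in> upper_half" for \<tau>
  proof (cases "norm (nome N \<tau>) < r'")
    case False
    have "nome N (inv (nome N \<tau>)) = nome N \<tau>" by (rule nome_inv) (simp add: nome)
    then have "G (inv (nome N \<tau>)) = G \<tau>" using that disc by (intro per) auto
    then show ?thesis using False by (simp add: H_def)
  qed (simp add: H_def GR)
  have o1: "open (ball 0 1 - \<real>\<^sub>\<le>\<^sub>0 :: complex set)" by (intro open_Diff open_ball closed_nonpos_Reals_complex)
  have s1: "{q \<in> ball 0 1. q \<notin> \<real>\<^sub>\<le>\<^sub>0} = (ball 0 1 - \<real>\<^sub>\<le>\<^sub>0 :: complex set)" by auto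
  have opA: "open {q \<in> ball 0 1. q \<notin> (\<real>\<^sub>\<le>\<^sub>0 :: complex set)}" unfolding s1 by (rule o1)
  have s2: "{q \<in> ball 0 1. - q \<notin> \<real>\<^sub>\<le>\<^sub>0} = uminus ` (ball 0 1 - \<real>\<^sub>\<le>\<^sub>0 :: complex set)"
    by (auto simp: image_iff intro!: bexI[of _ "- _"])
  have opB: "open {q \<in> ball 0 1. - q \<notin> (\<real>\<^sub>\<le>\<^sub>0 :: complex set)}"
    unfolding s2 using o1 by (rule open_negations)
  \<comment> \<open>The small disc and two oppositely slit discs cover the unit disc. On each slit
    disc a branch of the logarithm is holomorphic, and both branches give the same
    \<open>H\<close>.\<close>
  have "H holomorphic_on (ball 0 r' \<union> {q \<in> ball 0 1. q \<notin> \<real>\<^sub>\<le>\<^sub>0}) \<union> {q \<in> ball 0 1. - q \<notin> \<real>\<^sub>\<le>\<^sub>0}"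
  proof (intro holomorphic_on_Un open_Un open_ball opA opB)
    show "H holomorphic_on ball 0 r'"
      by (rule holomorphic_transform[OF Rh]) (simp add: H_def)
    have "inv holomorphic_on {q \<in> ball 0 1. q \<notin> \<real>\<^sub>\<le>\<^sub>0}"
      unfolding inv_def using c by (auto intro!: holomorphic_intros)
    moreover have "inv ` {q \<in> ball 0 1. q \<notin> \<real>\<^sub>\<le>\<^sub>0} \<subseteq> upper_half"
    proof (rule image_subsetI)
      fix q :: complex assume "q \<in> {q \<in> ball 0 1. q \<notin> \<real>\<^sub>\<le>\<^sub>0}"
      then have "q \<noteq> 0" "norm q < 1" by auto
      then show "inv q \<in> upper_half" using disc[of "inv q"] nome_inv by simp
    qed
    ultimately have "(\<lambda>q. G (inv q)) holomorphic_on {q \<in> ball 0 1. q \<notin> \<real>\<^sub>\<le>\<^sub>0}"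
      by (rule holomorphic_on_compose_gen[OF _ Gh, unfolded o_def])
    then show "H holomorphic_on {q \<in> ball 0 1. q \<notin> \<real>\<^sub>\<le>\<^sub>0}"
    proof (rule holomorphic_transform)
      fix q :: complex assume "q \<in> {q \<in> ball 0 1. q \<notin> \<real>\<^sub>\<le>\<^sub>0}"
      then have "q \<noteq> 0" "norm q < 1" by auto
      then show "G (inv q) = H q" using GH[of "inv q"] disc nome_inv by auto
    qed
    have nome2: "nome N ((Ln (- q) + \<i> * pi) / c) = q" if "q \<noteq> 0" for q
      using that c by (simp add: nome exp_add)
    have "(\<lambda>q. (Ln (- q) + \<i> * pi) / c) holomorphic_on {q \<in> ball 0 1. - q \<notin> \<real>\<^sub>\<le>\<^sub>0}"
      using c by (auto intro!: holomorphic_intros)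
    moreover have "(\<lambda>q. (Ln (- q) + \<i> * pi) / c) ` {q \<in> ball 0 1. - q \<notin> \<real>\<^sub>\<le>\<^sub>0} \<subseteq> upper_half"
    proof (rule image_subsetI)
      fix q :: complex assume "q \<in> {q \<in> ball 0 1. - q \<notin> \<real>\<^sub>\<le>\<^sub>0}"
      then have "q \<noteq> 0" "norm q < 1" by auto
      then show "(Ln (- q) + \<i> * pi) / c \<in> upper_half"
        using disc[of "(Ln (- q) + \<i> * pi) / c"] nome2 by simp
    qed
    ultimately have "(\<lambda>q. G ((Ln (- q) + \<i> * pi) / c)) holomorphic_on {q \<in> ball 0 1. - q \<notin> \<real>\<^sub>\<le>\<^sub>0}"
      by (rule holomorphic_on_compose_gen[OF _ Gh, unfolded o_def])
    then show "H holomorphic_on {q \<in> ball 0 1. - q \<notin> \<real>\<^sub>\<le>\<^sub>0}"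
    proof (rule holomorphic_transform)
      fix q :: complex assume "q \<in> {q \<in> ball 0 1. - q \<notin> \<real>\<^sub>\<le>\<^sub>0}"
      then have "q \<noteq> 0" "norm q < 1" by auto
      then show "G ((Ln (- q) + \<i> * pi) / c) = H q" using GH[of "(Ln (- q) + \<i> * pi) / c"] disc nome2 by auto
    qed
  qed
  also have "(ball 0 r' \<union> {q \<in> ball 0 1. q \<notin> \<real>\<^sub>\<le>\<^sub>0}) \<union> {q \<in> ball 0 1. - q \<notin> \<real>\<^sub>\<le>\<^sub>0} = ball (0::complex) 1"
  proof -
    have "q = 0" if "q \<in> \<real>\<^sub>\<le>\<^sub>0" "- q \<in> \<real>\<^sub>\<le>\<^sub>0" for q :: complex
      using that by (simp add: complex_nonpos_Reals_iff complex_eq_iff)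
    moreover have "(0::complex) \<in> ball 0 r'" using r' by simp
    ultimately have "q \<in> ball 0 r' \<or> q \<notin> \<real>\<^sub>\<le>\<^sub>0 \<or> - q \<notin> \<real>\<^sub>\<le>\<^sub>0" for q :: complex by blast
    moreover have "ball 0 r' \<subseteq> ball (0::complex) 1" using r' by (intro subset_ball)
    ultimately show ?thesis by blast
  qed
  finally show ?thesis using that GH unfolding G_def by blast
qed

text \<open>In the variable q the half-plane Im \<tau> \<ge> 1 / 5 lies in a compact subdisc of the
  unit disc. The constant is that of \<open>SL2Z_reduction\<close>.\<close>

lemma q_expansion_bounded:
  assumes "H holomorphic_on ball 0 1" "N > 0"
  shows "\<exists>C. \<forall>\<tau>. Im \<tau> \<ge> 1 / 5 \<longrightarrow> norm (H (nome N \<tau>)) \<le> C"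
proof -
  define \<rho> where "\<rho> = exp (- (2 * pi * (1 / 5) / real N))"
  have "\<rho> < 1" using assms(2) by (simp add: \<rho>_def)
  then have "continuous_on (cball 0 \<rho>) H"
    by (intro holomorphic_on_imp_continuous_on holomorphic_on_subset[OF assms(1)]) auto
  then have "compact (H ` cball 0 \<rho>)" by (intro compact_continuous_image) auto
  then have "bounded (H ` cball 0 \<rho>)" by (rule compact_imp_bounded)
  then obtain C where "\<forall>q\<in>cball 0 \<rho>. norm (H q) \<le> C" by (auto simp: bounded_iff)
  then have C: "\<And>q. norm q \<le> \<rho> \<Longrightarrow> norm (H q) \<le> C" by simp
  have "norm (H (nome N \<tau>)) \<le> C" if "Im \<tau> \<ge> 1 / 5" for \<tau>
  proof (rule C)
    have "2 * pi * (1 / 5) / real N \<le> 2 * pi * Im \<tau> / real N"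
      using that by (intro divide_right_mono mult_left_mono) auto
    then show "norm (nome N \<tau>) \<le> \<rho>" by (simp add: norm_nome \<rho>_def)
  qed
  then show ?thesis by blast
qed

lemma modular_unit_holomorphic:
  assumes "modular_unit N f"
  shows "f holomorphic_on upper_half"
proof -
  have "f analytic_on {\<tau>}" if "\<tau> \<in> upper_half" for \<tau>
    using assms that unfolding modular_unit_def modular_function_def
    by (intro nicely_meromorphic_on_imp_analytic_at[of f upper_half]) auto
  then show ?thesis using analytic_on_analytic_at analytic_imp_holomorphic by blast
qed

section \<open>Growth of the logarithmic derivatives of a fixed unit towards the real axis\<close>

context
  fixes N :: nat and f :: "complex \<Rightarrow> complex"
  assumes N: "N > 0" and f: "modular_unit N f"
begin

lemma unit_nonzero: "\<tau> \<in> upper_half \<Longrightarrow> f \<tau> \<noteq> 0"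
  using f by (simp add: modular_unit_def)

lemma unit_mobius_holomorphic:
  assumes "A \<in> SL2Z"
  shows "(\<lambda>\<tau>. f (mobius A \<tau>)) holomorphic_on upper_half"
proof (rule holomorphic_on_compose_gen[OF _ modular_unit_holomorphic[OF f], unfolded o_def])
  show "mobius A holomorphic_on upper_half"
    using mobius_deriv[OF assms] by (auto simp: holomorphic_on_open[OF open_upper_half])
qed (use mobius_upper_half[OF assms] in auto)

lemma unit_q_expansion:
  assumes "A \<in> SL2Z"
  obtains H where "H holomorphic_on ball 0 1" "\<And>\<tau>. \<tau> \<in> upper_half \<Longrightarrow> log_deriv f A \<tau> = H (nome N \<tau>)"
proof -
  obtain h Y where h: "h meromorphic_on {0}"
      "\<And>\<tau>. Im \<tau> > Y \<Longrightarrow> \<tau> \<in> upper_half \<Longrightarrow> f (mobius A \<tau>) = h (nome N \<tau>)"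
    using f assms unfolding modular_unit_def modular_function_def meromorphic_at_cusps_def nome_def by blast
  show ?thesis
  proof (rule log_deriv_q_expansion[OF N unit_mobius_holomorphic[OF assms] _ h])
    show "f (mobius A \<tau>) \<noteq> 0" if "\<tau> \<in> upper_half" for \<tau>
      using mobius_upper_half[OF assms that] by (rule unit_nonzero)
  qed (use that in \<open>auto simp: log_deriv_def\<close>)
qed

text \<open>The product of A and the inverse of B is congruent to the identity, so it leaves
  \<open>f\<close> invariant, and f(A \<tau>) = f(B \<tau>).\<close>

lemma log_deriv_cong_mod:
  assumes "A \<in> SL2Z" "B \<in> SL2Z" "\<And>i j. [A $ i $ j = B $ i $ j] (mod int N)" "\<tau> \<in> upper_half"
  shows "log_deriv f A \<tau> = log_deriv f B \<tau>"
proof -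
  define B' where "B' = mat22 (B $ 2 $ 2) (- B $ 1 $ 2) (- B $ 2 $ 1) (B $ 1 $ 1)"
  have B': "B' \<in> SL2Z" unfolding B'_def by (rule SL2Z_adj) fact
  have B'B: "B' ** B = mat 1" unfolding B'_def by (rule adj_mult) fact
  have BB': "B ** B' = mat 1" unfolding B'_def by (rule mult_adj) fact
  have "[(A ** B') $ i $ j = (B ** B') $ i $ j] (mod int N)" for i j
    unfolding mat22_mult_entries by (intro cong_add cong_mult assms cong_refl)
  then have "A ** B' \<in> Gamma_N N"
    unfolding Gamma_N_def BB' using SL2Z_mult[OF assms(1) B'] by blast
  then have inv: "f (mobius (A ** B') \<tau>) = f \<tau>" if "\<tau> \<in> upper_half" for \<tau>
    using f that unfolding modular_unit_def modular_function_def by blast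
  have AB: "(A ** B') ** B = A" by (simp add: matrix_mul_assoc[symmetric] B'B)
  have eq: "f (mobius A \<tau>) = f (mobius B \<tau>)" if "\<tau> \<in> upper_half" for \<tau>
    using inv[OF mobius_upper_half[OF assms(2) that]] mobius_mult[OF assms(2) that, of "A ** B'"] by (simp add: AB)
  have "deriv (\<lambda>\<tau>. f (mobius A \<tau>)) \<tau> = deriv (\<lambda>\<tau>. f (mobius B \<tau>)) \<tau>"
    using eq by (intro complex_derivative_transform_within_open[OF unit_mobius_holomorphic unit_mobius_holomorphic
         open_upper_half] assms) auto
  then show ?thesis by (simp add: log_deriv_def eq assms(4))
qed

text \<open>Only finitely many functions \<open>log_deriv f A\<close> occur, as they depend on \<open>A\<close> modulo \<open>N\<close>.\<close>

lemma log_deriv_bounded: "\<exists>C. \<forall>A\<in>SL2Z. \<forall>\<tau>. Im \<tau> \<ge> 1 / 5 \<longrightarrow> norm (log_deriv f A \<tau>) \<le> C"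
proof -
  define red where "red = (\<lambda>A::int^2^2. (A $ 1 $ 1 mod int N, A $ 1 $ 2 mod int N, A $ 2 $ 1 mod int N, A $ 2 $ 2 mod int N))"
  have "red ` SL2Z \<subseteq> {0..<int N} \<times> {0..<int N} \<times> {0..<int N} \<times> {0..<int N}"
    using N by (auto simp: red_def)
  then have fin: "finite (red ` SL2Z)" by (rule finite_subset) auto
  have "\<exists>C. \<forall>A\<in>SL2Z. red A = s \<longrightarrow> (\<forall>\<tau>. Im \<tau> \<ge> 1 / 5 \<longrightarrow> norm (log_deriv f A \<tau>) \<le> C)" if s: "s \<in> red ` SL2Z" for s
  proof -
    obtain B where B: "B \<in> SL2Z" "red B = s" using s by auto
    obtain H where H: "H holomorphic_on ball 0 1" "\<And>\<tau>. \<tau> \<in> upper_half \<Longrightarrow> log_deriv f B \<tau> = H (nome N \<tau>)"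
      using unit_q_expansion[OF B(1)] by blast
    obtain C where C: "\<And>\<tau>. Im \<tau> \<ge> 1 / 5 \<Longrightarrow> norm (H (nome N \<tau>)) \<le> C"
      using q_expansion_bounded[OF H(1) N] by blast
    have "norm (log_deriv f A \<tau>) \<le> C" if A: "A \<in> SL2Z" "red A = s" and \<tau>: "Im \<tau> \<ge> 1 / 5" for A \<tau>
    proof -
      have uh: "\<tau> \<in> upper_half" using \<tau> by (simp add: upper_half_def)
      have "red A = red B" using A B by simp
      then have "\<forall>i j. [A $ i $ j = B $ i $ j] (mod int N)"
        by (simp add: forall_2 red_def cong_def)
      then have "log_deriv f A \<tau> = log_deriv f B \<tau>"
        by (intro log_deriv_cong_mod A B uh) auto
      then show ?thesis using C[OF \<tau>] H(2)[OF uh] by simp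
    qed
    then show ?thesis by blast
  qed
  then obtain c where c: "\<And>s A \<tau>. s \<in> red ` SL2Z \<Longrightarrow> A \<in> SL2Z \<Longrightarrow> red A = s \<Longrightarrow> Im \<tau> \<ge> 1 / 5 \<Longrightarrow> norm (log_deriv f A \<tau>) \<le> c s"
    by metis
  have "norm (log_deriv f A \<tau>) \<le> (\<Sum>s\<in>red ` SL2Z. \<bar>c s\<bar>)" if "A \<in> SL2Z" "Im \<tau> \<ge> 1 / 5" for A \<tau>
  proof -
    have "norm (log_deriv f A \<tau>) \<le> c (red A)" using that by (intro c) auto
    also have "\<dots> \<le> \<bar>c (red A)\<bar>" by simp
    also have "\<dots> \<le> (\<Sum>s\<in>red ` SL2Z. \<bar>c s\<bar>)" using that fin by (intro member_le_sum) auto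
    finally show ?thesis .
  qed
  then show ?thesis by blast
qed

text \<open>The transformation law of weight 2: the chain rule contributes the derivative of
  \<open>mobius M\<close>, whose numerator is the determinant 1.\<close>

lemma log_deriv_mobius:
  assumes "A \<in> SL2Z" "M \<in> SL2Z" "\<tau> \<in> upper_half"
  shows "log_deriv f (A ** M) \<tau> = log_deriv f A (mobius M \<tau>) / (of_int (M $ 2 $ 1) * \<tau> + of_int (M $ 2 $ 2)) ^ 2"
proof -
  define d where "d = of_int (M $ 2 $ 1) * \<tau> + of_int (M $ 2 $ 2)"
  define g where "g = (\<lambda>\<tau>. f (mobius A \<tau>))"
  have "mobius M \<tau> \<in> upper_half" by (intro mobius_upper_half assms)
  then have "(g has_field_derivative deriv g (mobius M \<tau>)) (at (mobius M \<tau>))"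
    unfolding g_def by (intro holomorphic_derivI[OF unit_mobius_holomorphic open_upper_half] assms)
  from DERIV_chain2[OF this mobius_deriv[OF assms(2,3)]]
  have "((\<lambda>\<tau>. g (mobius M \<tau>)) has_field_derivative deriv g (mobius M \<tau>) * (1 / d ^ 2)) (at \<tau>)"
    by (simp add: d_def)
  then have "((\<lambda>\<tau>. f (mobius (A ** M) \<tau>)) has_field_derivative deriv g (mobius M \<tau>) * (1 / d ^ 2)) (at \<tau>)"
    by (rule has_field_derivative_transform_within_open[OF _ open_upper_half assms(3)])
       (simp add: g_def mobius_mult[OF assms(2)])
  then have "deriv (\<lambda>\<tau>. f (mobius (A ** M) \<tau>)) \<tau> = deriv g (mobius M \<tau>) * (1 / d ^ 2)" by (rule DERIV_imp_deriv)
  then show ?thesis unfolding log_deriv_def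
    by (simp add: g_def d_def mobius_mult[OF assms(2,3)])
qed

text \<open>Move \<tau> up by M and write A as the product of A M^(-1) and M. The matrix A M^(-1)
  varies with \<tau>, which is why a bound uniform over all matrices was needed. The factor 1 / |c
  \<tau> + d|^2 is at most 1 / (Im \<tau>)^2 by the upper bound for the imaginary part of M
  \<tau>.\<close>

lemma log_deriv_growth:
  obtains C where "\<And>A \<tau>. A \<in> SL2Z \<Longrightarrow> 0 < Im \<tau> \<Longrightarrow> Im \<tau> \<le> 1 \<Longrightarrow> norm (log_deriv f A \<tau>) \<le> C / (Im \<tau>)\<^sup>2"
proof -
  obtain C where C: "\<And>A \<tau>. A \<in> SL2Z \<Longrightarrow> Im \<tau> \<ge> 1 / 5 \<Longrightarrow> norm (log_deriv f A \<tau>) \<le> C"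
    using log_deriv_bounded by blast
  have "norm (log_deriv f A \<tau>) \<le> C / (Im \<tau>)\<^sup>2" if A: "A \<in> SL2Z" and \<tau>: "0 < Im \<tau>" "Im \<tau> \<le> 1" for A \<tau>
  proof -
    obtain M where M: "M \<in> SL2Z" "Im (mobius M \<tau>) \<ge> 1 / 5" "Im (mobius M \<tau>) \<le> 1 / Im \<tau>"
      by (rule SL2Z_reduction[OF \<tau>])
    define M' where "M' = mat22 (M $ 2 $ 2) (- M $ 1 $ 2) (- M $ 2 $ 1) (M $ 1 $ 1)"
    define d where "d = of_int (M $ 2 $ 1) * \<tau> + of_int (M $ 2 $ 2)"
    have M': "M' \<in> SL2Z" unfolding M'_def by (rule SL2Z_adj) fact
    have uh: "\<tau> \<in> upper_half" using \<tau> by (simp add: upper_half_def)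
    have "(A ** M') ** M = A" using adj_mult[OF M(1)] by (simp add: matrix_mul_assoc[symmetric] M'_def)
    then have "log_deriv f A \<tau> = log_deriv f (A ** M') (mobius M \<tau>) / d ^ 2"
      using log_deriv_mobius[OF SL2Z_mult[OF A M'] M(1) uh] by (simp add: d_def)
    then have eq: "norm (log_deriv f A \<tau>) = norm (log_deriv f (A ** M') (mobius M \<tau>)) * (1 / (norm d)\<^sup>2)"
      by (simp add: norm_divide norm_power)
    have "Im \<tau> / (norm d)\<^sup>2 \<le> 1 / Im \<tau>" using M(3) unfolding Im_mobius[OF M(1)] by (simp add: d_def)
    then have d: "1 / (norm d)\<^sup>2 \<le> 1 / (Im \<tau>)\<^sup>2" using \<tau> by (simp add: field_simps power2_eq_square)
    have bd: "norm (log_deriv f (A ** M') (mobius M \<tau>)) \<le> C" by (intro C SL2Z_mult A M' M)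
    then have "0 \<le> C" using norm_ge_zero order_trans by blast
    then have "norm (log_deriv f A \<tau>) \<le> C * (1 / (Im \<tau>)\<^sup>2)"
      unfolding eq using bd d by (intro mult_mono) auto
    then show ?thesis by simp
  qed
  then show ?thesis using that by blast
qed

lemma log_deriv_expansion:
  assumes A: "A \<in> SL2Z"
  shows "has_exp_expansion N (\<lambda>y. log_deriv f A (\<i> * of_real y))"
proof -
  obtain H where H: "H holomorphic_on ball 0 1" "\<And>\<tau>. \<tau> \<in> upper_half \<Longrightarrow> log_deriv f A \<tau> = H (nome N \<tau>)"
    using unit_q_expansion[OF A] by blast
  obtain C where C: "\<And>\<tau>. 0 < Im \<tau> \<Longrightarrow> Im \<tau> \<le> 1 \<Longrightarrow> norm (log_deriv f A \<tau>) \<le> C / (Im \<tau>)\<^sup>2"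
    using log_deriv_growth A by metis
  define a where "a = (\<lambda>n. (deriv ^^ n) H 0 / fact n)"
  define K where "K = exp (2 * pi / real N)"
  have bound: "norm (a n) \<le> (C * K) * real n ^ 2" if n: "n \<ge> 1" for n
  proof -
    \<comment> \<open>The circle of radius r is Im \<tau> = 1 / n, where the growth bound is C n^2,
      while r^n = exp (-2 pi / N) does not depend on n. Cauchy's inequality then gives coefficients
      of order n^2.\<close>
    define r where "r = exp (- (2 * pi / (real N * real n)))"
    have r: "0 < r" "r < 1" using N n by (auto simp: r_def)
    have "norm ((deriv ^^ n) H 0) \<le> fact n * (C * real n ^ 2) / r ^ n"
    proof (rule Cauchy_inequality)
      show "H holomorphic_on ball 0 r" by (rule holomorphic_on_subset[OF H(1)]) (use r in auto)
      show "continuous_on (cball 0 r) H"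
        by (intro holomorphic_on_imp_continuous_on holomorphic_on_subset[OF H(1)]) (use r in auto)
      show "0 < r" by fact
      fix q :: complex assume "norm (0 - q) = r"
      then have q: "norm q = r" by simp
      then have "q \<noteq> 0" using r by auto
      define \<tau> where "\<tau> = Ln q / (2 * of_real pi * \<i> / of_nat N)"
      have nq: "nome N \<tau> = q" using N \<open>q \<noteq> 0\<close> by (simp add: nome_def \<tau>_def)
      have "exp (- (2 * pi * Im \<tau> / real N)) = r" using norm_nome[of N \<tau>] q nq by simp
      then have "2 * pi * Im \<tau> / real N = 2 * pi / (real N * real n)" by (simp add: r_def)
      then have Im: "Im \<tau> = 1 / real n" using N n by (simp add: field_simps)
      have "norm (log_deriv f A \<tau>) \<le> C / (Im \<tau>)\<^sup>2" using n by (intro C) (auto simp: Im)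
      moreover have "\<tau> \<in> upper_half" using n by (simp add: upper_half_def Im)
      ultimately show "norm (H q) \<le> C * real n ^ 2" using H(2)[of \<tau>] by (simp add: nq Im power_divide)
    qed
    moreover have "r ^ n = 1 / K" using N n by (simp add: r_def K_def exp_minus field_simps flip: exp_of_nat_mult)
    ultimately show ?thesis by (simp add: a_def norm_divide field_simps)
  qed
  have "a \<in> O(\<lambda>n. of_nat n ^ 2)"
    by (rule bigoI[of _ "C * K"], rule eventually_mono[OF eventually_ge_at_top[of 1]])
       (use bound in \<open>simp add: norm_power\<close>)
  then have "poly_growth a" unfolding poly_growth_def by blast
  moreover have "log_deriv f A (\<i> * of_real y) = (\<Sum>n. a n * of_real (exp (- 2 * pi * real n * y / real N)))" if "y > 0" for y
  proof -
    define q where "q = nome N (\<i> * of_real y)"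
    have uh: "\<i> * of_real y \<in> upper_half" using that by (simp add: upper_half_def)
    have "norm q < 1" using that N by (simp add: q_def norm_nome)
    then have "(\<lambda>n. a n * q ^ n) sums H q"
      using holomorphic_power_series[OF H(1), of q] by (simp add: a_def)
    moreover have "q ^ n = of_real (exp (- 2 * pi * real n * y / real N))" for n
    proof -
      have "q ^ n = exp (of_nat n * (2 * of_real pi * \<i> * (\<i> * of_real y) / of_nat N))"
        by (simp only: q_def nome_def exp_of_nat_mult)
      also have "of_nat n * (2 * of_real pi * \<i> * (\<i> * of_real y) / of_nat N) = complex_of_real (- 2 * pi * real n * y / real N)"
        by (simp add: complex_eq_iff)
      finally show ?thesis by (simp only: exp_of_real)
    qed
    ultimately show ?thesis using H(2)[OF uh] by (simp add: sums_iff q_def)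
  qed
  ultimately show ?thesis
    unfolding has_exp_expansion_def by (intro exI[of _ 0] exI[of _ "\<lambda>_. a"]) auto
qed

text \<open>The two expansions belong to the cusps \<open>\<infinity>\<close> and \<open>0\<close>.\<close>

lemma unit_dlog_expansions:
  shows "has_exp_expansion N (\<lambda>y. deriv f (\<i> * of_real y) / f (\<i> * of_real y))"
    and "has_exp_expansion N (\<lambda>y. - (deriv f (\<i> * of_real (1 / y)) / f (\<i> * of_real (1 / y)) / of_real (y ^ 2)))"
proof -
  have 1: "mat 1 \<in> SL2Z" by (simp add: SL2Z_iff mat_def)
  have id: "mobius (mat 1) = (\<lambda>\<tau>. \<tau>)" by (simp add: mobius_def mat_def fun_eq_iff)
  have ld: "log_deriv f (mat 1) \<tau> = deriv f \<tau> / f \<tau>" for \<tau> by (simp add: log_deriv_def id)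
  show "has_exp_expansion N (\<lambda>y. deriv f (\<i> * of_real y) / f (\<i> * of_real y))"
    using log_deriv_expansion[OF 1] by (simp add: ld)
  define S where "S = mat22 0 (-1) 1 0"
  have S: "S \<in> SL2Z" by (simp add: S_def SL2Z_iff)
  \<comment> \<open>The sign is that of (i y)^2 = - y^2, the square of the denominator for the
    inversion \<open>S\<close>.\<close>
  have eq: "log_deriv f S (\<i> * of_real y) = - (deriv f (\<i> * of_real (1 / y)) / f (\<i> * of_real (1 / y)) / of_real (y ^ 2))"
    if "y > 0" for y
  proof -
    have uh: "\<i> * of_real y \<in> upper_half" using that by (simp add: upper_half_def)
    have m: "mobius S (\<i> * of_real y) = \<i> * of_real (1 / y)"
      using that by (simp add: mobius_def S_def field_simps)
    have "log_deriv f S (\<i> * of_real y) = log_deriv f (mat 1 ** S) (\<i> * of_real y)" by simp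
    also have "\<dots> = deriv f (\<i> * of_real (1 / y)) / f (\<i> * of_real (1 / y)) / (\<i> * of_real y) ^ 2"
      unfolding log_deriv_mobius[OF 1 S uh] ld m by (simp add: S_def)
    finally show ?thesis by (simp add: power_mult_distrib)
  qed
  show "has_exp_expansion N (\<lambda>y. - (deriv f (\<i> * of_real (1 / y)) / f (\<i> * of_real (1 / y)) / of_real (y ^ 2)))"
    using log_deriv_expansion[OF S] eq unfolding has_exp_expansion_def by simp
qed

end

subsection \<open>Functions on the imaginary axis\<close>

text \<open>The function is the coefficient of df/f pulled back to the imaginary axis; the factor i
  is the tangent vector of y \<mapsto> i y.\<close>

lemma unit_weight_P:
  assumes "N > 0" "modular_unit N f"
  shows "weight_P N 2 (\<lambda>y. deriv f (\<i> * of_real y) * \<i> / f (\<i> * of_real y))"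
proof -
  let ?D = "\<lambda>y. deriv f (\<i> * of_real y) / f (\<i> * of_real y)"
  have "has_exp_expansion N (\<lambda>y. -1 * - (?D (1 / y) / of_real (y ^ 2)))"
    by (intro has_exp_expansion_mult has_exp_expansion_const unit_dlog_expansions assms)
  then have "weight_P N 2 ?D"
    using unit_dlog_expansions(1)[OF assms] unfolding weight_P_def by simp
  from weight_P_cmult[OF assms(1) this, of \<i>] show ?thesis by (simp add: mult.commute)
qed

lemma unit_imag_axis_deriv:
  assumes "modular_unit N f" "y > 0"
  shows "((\<lambda>y. f (\<i> * of_real y)) has_vector_derivative deriv f (\<i> * of_real y) * \<i>) (at y)"
proof -
  have 1: "((\<lambda>y. \<i> * of_real y) has_vector_derivative \<i>) (at y)" by (auto intro!: derivative_eq_intros)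
  have 2: "(f has_field_derivative deriv f (\<i> * of_real y)) (at (\<i> * of_real y))"
    by (rule holomorphic_derivI[OF modular_unit_holomorphic[OF assms(1)] open_upper_half])
       (use assms in \<open>simp add: upper_half_def\<close>)
  from field_vector_diff_chain_at[OF 1 2] show ?thesis by (simp add: o_def mult.commute)
qed

lemma unit_imag_axis_nonzero: "modular_unit N f \<Longrightarrow> y > 0 \<Longrightarrow> f (\<i> * of_real y) \<noteq> 0"
  by (simp add: modular_unit_def upper_half_def)

lemma unit_ln_norm_weight_P:
  assumes "N > 0" "modular_unit N f"
  shows "weight_P N 0 (\<lambda>y. of_real (ln (norm (f (\<i> * of_real y)))))"
proof (rule weight_P_primitive[OF assms(1) weight_P_Re[OF assms(1) unit_weight_P[OF assms]]])
  fix y :: real assume y: "y > 0"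
  show "((\<lambda>y. complex_of_real (ln (norm (f (\<i> * of_real y))))) has_vector_derivative
      of_real (Re (deriv f (\<i> * of_real y) * \<i> / f (\<i> * of_real y)))) (at y)"
    by (intro has_vector_derivative_of_real has_vector_derivative_ln_norm unit_imag_axis_deriv[OF assms(2) y]
          unit_imag_axis_nonzero[OF assms(2) y])
qed

text \<open>The induction starts from P_1 = -log|1 - z|. For m \<ge> 2 the weights m - 1 and m - j
  in the differential lie between 1 and m - 1. That 1 - u is a unit gives the base case, the
  expansion of du / (1 - u), and u \<noteq> 1 on the axis.\<close>

lemma P_fun_weight_P:
  assumes N: "N > 0" and u: "modular_unit N u" and u1: "modular_unit N (\<lambda>\<tau>. 1 - u \<tau>)" and "m \<ge> 1"
  shows "weight_P N 0 (\<lambda>y. of_real (P_fun m (u (\<i> * of_real y))))"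
  using \<open>m \<ge> 1\<close>
proof (induction m rule: less_induct)
  case (less m)
  note ui = unit_imag_axis_nonzero[OF u]
  have u1i: "u (\<i> * of_real y) \<noteq> 1" if "y > 0" for y using unit_imag_axis_nonzero[OF u1 that] by simp
  show ?case
  proof (cases "m = 1")
    case True
    from weight_P_minus[OF N unit_ln_norm_weight_P[OF N u1]] show ?thesis
    proof (rule weight_P_cong)
      fix y :: real assume "y > 0"
      then show "- complex_of_real (ln (norm (1 - u (\<i> * of_real y)))) = of_real (P_fun m (u (\<i> * of_real y)))"
        using ui[of y] u1i[of y] by (simp add: True P_fun_def bernoulli_0)
    qed
  next
    case False
    then have m: "m \<ge> 2" using less.prems by simp
    define D where "D = (\<lambda>y. deriv u (\<i> * of_real y) * \<i> / u (\<i> * of_real y))"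
    define D1 where "D1 = (\<lambda>y. deriv u (\<i> * of_real y) * \<i> / (1 - u (\<i> * of_real y)))"
    define a where "a = (\<lambda>y. complex_of_real (ln (norm (u (\<i> * of_real y)))))"
    define P where "P = (\<lambda>k y. complex_of_real (P_fun k (u (\<i> * of_real y))))"
    have D: "weight_P N 2 D" unfolding D_def by (rule unit_weight_P[OF N u])
    have d1: "deriv (\<lambda>\<tau>. 1 - u \<tau>) (\<i> * of_real y) = - deriv u (\<i> * of_real y)" if "y > 0" for y
    proof (rule DERIV_imp_deriv)
      have "(u has_field_derivative deriv u (\<i> * of_real y)) (at (\<i> * of_real y))"
        by (rule holomorphic_derivI[OF modular_unit_holomorphic[OF u] open_upper_half])
           (use that in \<open>simp add: upper_half_def\<close>)
      then show "((\<lambda>\<tau>. 1 - u \<tau>) has_field_derivative - deriv u (\<i> * of_real y)) (at (\<i> * of_real y))"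
        by (auto intro!: derivative_eq_intros)
    qed
    \<comment> \<open>Here du / (1 - u) is minus the logarithmic differential of the unit 1 -
      u.\<close>
    have D1: "weight_P N 2 D1"
      using weight_P_minus[OF N unit_weight_P[OF N u1]]
      by (rule weight_P_cong) (simp add: d1 D1_def)
    have a: "weight_P N 0 a" unfolding a_def by (rule unit_ln_norm_weight_P[OF N u])
    have Pk: "weight_P N 0 (P k)" if "1 \<le> k" "k < m" for k
      unfolding P_def using less.IH that by blast
    have RI: "weight_P N 2 (\<lambda>y. of_real (Re_Im m (D1 y)))"
      using weight_P_Re[OF N D1] weight_P_Im[OF N D1] by (simp add: Re_Im_def)
    have "weight_P N 2 (\<lambda>y. P (m - 1) y * of_real (Im (D y)))"
      by (intro weight_P_mult_0[OF N] weight_P_Im[OF N D] Pk) (use m in auto)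
    moreover have "weight_P N 2 (\<lambda>y. a y ^ (j - 1) * P (m - j) y * of_real (Re (D y)))" if "j \<in> {2..m-1}" for j
      by (intro weight_P_mult_0[OF N] weight_P_Re[OF N D] weight_P_power[OF N a] Pk) (use that in auto)
    moreover have "weight_P N 2 (\<lambda>y. a y ^ (m - 1) * of_real (Re_Im m (D1 y)))"
      by (intro weight_P_mult_0[OF N] weight_P_power[OF N a] RI)
    ultimately have "weight_P N 2 (\<lambda>y. (if odd m then -1 else 1) * (P (m - 1) y * of_real (Im (D y)))
       - (\<Sum>j=2..m-1. of_real (bern_coeff j) * (a y ^ (j - 1) * P (m - j) y * of_real (Re (D y))))
       + of_real (bern_coeff (m - 1)) * (a y ^ (m - 1) * of_real (Re_Im m (D1 y))))" (is "weight_P N 2 ?\<phi>")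
      by (intro weight_P_add[OF N] weight_P_diff[OF N] weight_P_sum[OF N] weight_P_cmult[OF N])
    then show ?thesis
    proof (rule weight_P_primitive[OF N])
      fix y :: real assume y: "y > 0"
      have "((\<lambda>t. P_fun m (u (\<i> * of_real t))) has_real_derivative
         (if odd m then -1 else 1) * Im (D y) * P_fun (m - 1) (u (\<i> * of_real y))
         - (\<Sum>j=2..m-1. bern_coeff j * ln (norm (u (\<i> * of_real y))) ^ (j - 1) * Re (D y) * P_fun (m - j) (u (\<i> * of_real y)))
         + bern_coeff (m - 1) * ln (norm (u (\<i> * of_real y))) ^ (m - 1) * Re_Im m (D1 y)) (at y)"
        unfolding D_def D1_def
        by (rule P_fun_has_derivative[OF unit_imag_axis_deriv[OF u y] refl ui[OF y] u1i[OF y] less.prems])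
      from has_vector_derivative_of_real[OF this]
      show "((\<lambda>y. complex_of_real (P_fun m (u (\<i> * of_real y)))) has_vector_derivative ?\<phi> y) (at y)"
        by (rule has_vector_derivative_eq_rhs) (simp add: P_def a_def mult_ac)
    qed
  qed
qed

theorem theorem7p8:
  fixes N n :: nat and u v :: "complex \<Rightarrow> complex" and \<phi> :: "real \<Rightarrow> complex"
  assumes "N \<ge> 1" and "n \<ge> 3"
    and "modular_unit N u" and "modular_unit N v" and "modular_unit N (\<lambda>\<tau>. 1 - u \<tau>)"
    and "\<And>y. y > 0 \<Longrightarrow> \<phi> y = restrict_form (r2 n u v) (\<lambda>y. \<i> * of_real y) y"
  shows "\<phi> \<in> class_P N"
proof -
  have N: "N > 0" using assms(1) by simp
  define D where "D = (\<lambda>f y. deriv f (\<i> * of_real y) * \<i> / f (\<i> * of_real y) :: complex)"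
  define l where "l = (\<lambda>f y. complex_of_real (ln (norm (f (\<i> * of_real y) :: complex))))"
  define L where "L = (\<lambda>m y. L_hat m (u (\<i> * of_real y)))"
  define w where "w = (\<lambda>\<tau>. 1 - u \<tau>)"
  have w: "modular_unit N w" using assms(5) by (simp add: w_def)
  have D: "weight_P N 2 (D f)" if "modular_unit N f" for f
    unfolding D_def by (rule unit_weight_P[OF N that])
  have l: "weight_P N 0 (l f)" if "modular_unit N f" for f
    unfolding l_def by (rule unit_ln_norm_weight_P[OF N that])
  have L: "weight_P N 0 (L m)" if "m \<ge> 1" for m
    using P_fun_weight_P[OF N assms(3,5) that] weight_P_cmult[OF N, of 0 "\<lambda>y. of_real (P_fun m (u (\<i> * of_real y)))" \<i>]
    by (cases "odd m") (simp_all add: L_def L_hat_def)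
  have dlog: "dlog f (\<i> * of_real y) \<i> = D f y" for f y by (simp add: dlog_def D_def)
  have vd: "vector_derivative (\<lambda>y. \<i> * of_real y) (at y) = \<i>" for y
    by (rule vector_derivative_at) (auto intro!: derivative_eq_intros)
  \<comment> \<open>Each kind of term in the regulator contains exactly one factor from a 1-form, of
    weight 2, multiplied by functions of weight 0; \<alpha>(1 - u, u) is a difference of two such
    products.\<close>
  have "weight_P N 2 (\<lambda>y. L (n - 1) y * of_real (Im (D v y)))"
    using assms(2) by (intro weight_P_mult_0[OF N] weight_P_Im[OF N] L D assms) auto
  moreover have "weight_P N 2 (\<lambda>y. l u y ^ (n - 3) * l v y
       * (l u y * of_real (Re (D w y)) - l w y * of_real (Re (D u y))))"
    by (intro weight_P_mult_0[OF N] weight_P_diff[OF N] weight_P_power[OF N] weight_P_Re[OF N] l D w assms)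
  moreover have "weight_P N 2 (\<lambda>y. L (n - k) y * (l u y ^ (k - 2) * l v y) * of_real (Re (D u y)))"
    if "k \<in> {2..n-2}" for k
    using that assms(2)
    by (intro weight_P_mult_0[OF N] weight_P_power[OF N] weight_P_Re[OF N] l L D assms) auto
  ultimately have "weight_P N 2 (\<lambda>y. \<i> * (L (n - 1) y * of_real (Im (D v y)))
     - of_real (2 ^ (n - 1) * bernoulli (n - 1) / fact (n - 1)) * (l u y ^ (n - 3) * l v y
          * (l u y * of_real (Re (D w y)) - l w y * of_real (Re (D u y))))
     - (\<Sum>k=2..n-2. of_real (2 ^ k * bernoulli k / fact k) * (L (n - k) y * (l u y ^ (k - 2) * l v y) * of_real (Re (D u y)))))"
    (is "weight_P N 2 ?\<psi>")
    by (intro weight_P_diff[OF N] weight_P_sum[OF N] weight_P_cmult[OF N])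
  then have "weight_P N 2 \<phi>"
  proof (rule weight_P_cong)
    fix y :: real assume "y > 0"
    have "\<phi> y = r2 n u v (\<i> * of_real y) \<i>"
      using assms(6)[OF \<open>y > 0\<close>] by (simp add: restrict_form_def vd)
    also have "\<dots> = ?\<psi> y"
      unfolding r2_def alpha_def d_arg_def dlog_abs_def w_def [symmetric] dlog
      by (simp add: L_def l_def w_def algebra_simps)
    finally show "?\<psi> y = \<phi> y" ..
  qed
  then show ?thesis by (rule weight_P_imp_class_P[OF N])
qed

end
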